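(* Let $F$ be a number field with ring of integers $O_F$, $\overline{\mathbb{Z}}$ the ring of all algebraic integers, $\mathcal{J}$ a non-zero ideal of $O_F$, $t\in O_F$ with $\mathcal{J}+tO_F=O_F$, and $a\in O_F$. For real $X,Y>0$ let $N(t,a,\mathcal{J},X,Y)\in\{0,1,2,\dots\}\cup\{\infty\}$ be the number of pairs $(x,y)\in\overline{\mathbb{Z}}\times\overline{\mathbb{Z}}$ with $x+ty+a\in\mathcal{J}\overline{\mathbb{Z}}$ and $|\lambda(x)|\le X$, $|\lambda(y)|\le Y$ for every ring embedding $\lambda:\overline{\mathbb{Z}}\to\mathbb{C}$. Then: (1) When $a=0$, either there are no such pairs or there are infinitely many, i.e. $N(t,0,\mathcal{J},X,Y)\in\{0,\infty\}$. (2) Suppose $a=0$, $X>0$, $Y>1/3$, and let $g_1=b_1x+b_2y+b_3\in\mathcal{J}^{-1}O_F[x,y]$ with $b_1\ne0$, $g_1\equiv b_1(x+ty)\bmod O_F[x,y]$, and $|\lambda(b_1)|<1/(3X)$, $|\lambda(b_2)|<1/(3Y)$, $|\lambda(b_3)|<1/3$ for all embeddings $\lambda:F\to\mathbb{C}$. If the capacity $\gamma(\mathcal{E})$ of the adelic set attached to $g_1$ (see context, with $a=0$) satisfies $\gamma(\mathcal{E})<1$, then $N(t,0,\mathcal{J},X,Y)=0$. (3) For all $a$, $N(t,a,\mathcal{J},X/2,Y/2)\le1+N(t,0,\mathcal{J},X,Y)$. Thus either $N(t,0,\mathcal{J},X,Y)=\infty$, or $N(t,0,\mathcal{J},X,Y)=0$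 and $N(t,a,\mathcal{J},X/2,Y/2)\le1$.
   Context: The adelic set $\mathcal{E}=\prod_vE_v$ attached to $g_1$, $X$, $Y$, $t$, $a$: for non-archimedean $v$ (with $|\cdot|_v$ an extension to an algebraic closure $\overline{F}_v$ of the normalized absolute value on $F_v$ and $|\mathcal{J}|_v$ its value on a local generator of $\mathcal{J}$), $E_v=\{y\in\overline{F}_v:|y|_v\le1,\ |b_2y+b_3|_v\le|b_1|_v,\ |-(b_2y+b_3)/b_1+ty+a|_v\le|\mathcal{J}|_v\}$; for archimedean $v$ ($\overline{F}_v=\mathbb{C}$), $E_v=\{y:|y|\le Y,\ |b_2y+b_3|\le|b_1|_vX\}$. Its capacity relative to $\infty\in\mathbb{P}^1_F$ is $\gamma(\mathcal{E})=\prod_v\gamma_v(E_v)$, where for non-archimedean $v$ of residue characteristic $p(v)$ and $E_v$ a disk of radius $r_v$, $\gamma_v(E_v)=r_v^{[F_v:\mathbb{Q}_{p(v)}]}$, and for archimedean $v$, $\gamma_v(E_v)$ is the classical transfinite diameter of $E_v$ raised to the power $[F_v:\mathbb{R}]$.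
   Formalization: For a=0 the pair (0,0) is always a solution, so (1) and (2) fail as written (X=Y=1/2 gives N=1); the formal statement counts only pairs (x,y)≠(0,0) in N(t,0,J,X,Y) in (1), (2) and the right side of (3), and all pairs in N(t,a,J,X/2,Y/2). *)

theory Defs
  imports
    "HOL-Analysis.Analysis"
    "HOL-Computational_Algebra.Computational_Algebra"
    "HOL-Algebra.Algebra"
    "HOL-Algebra.Algebraic_Closure_Type"
    "HOL-Library.Extended_Nat"
begin

section \<open>Number fields and algebraic integers\<close>

text \<open>
  Number fields are subfields of finite degree over \<^term>\<open>\<rat>\<close> of an arbitrary algebraically closed
  field \<open>'a\<close> of characteristic 0 (for instance \<^typ>\<open>complex\<close>), so that the field and the ring of
  all algebraic integers live in a common ambient field.
\<close>

abbreviation ring_on :: "'a::ring_1 set \<Rightarrow> 'a ring" where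
  "ring_on R \<equiv> ring_of_type_algebra \<lparr>carrier := R\<rparr>"

definition number_field :: "'a::field_char_0 set \<Rightarrow> bool" where
  "number_field F \<longleftrightarrow>
     subfield F (ring_on UNIV) \<and> ring.finite_dimension (ring_on UNIV) \<rat> F"

definition alg_ints :: "'a::field_char_0 set" where
  "alg_ints = {z. algebraic_int z}"

definition ring_of_integers :: "'a::field_char_0 set \<Rightarrow> 'a set" where
  "ring_of_integers F = F \<inter> alg_ints"

definition inverse_ideal :: "'a::field_char_0 set \<Rightarrow> 'a set \<Rightarrow> 'a set" where
  "inverse_ideal F J = {x \<in> F. \<forall>j\<in>J. x * j \<in> ring_of_integers F}"

definition complex_embeddings :: "'a::ring_1 set \<Rightarrow> ('a \<Rightarrow> complex) set" where
  "complex_embeddings R = {h \<in> ring_hom (ring_on R) (ring_on UNIV). inj_on h R}"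

text \<open>
  An element of \<open>'a[x,y]\<close> is represented in \<open>'a[y][x]\<close>: the outer variable is \<open>x\<close> and the inner
  variable is \<open>y\<close>.
\<close>

definition bipolys_over :: "'a::zero set \<Rightarrow> 'a poly poly set" where
  "bipolys_over S = {g. \<forall>i j. Polynomial.coeff (Polynomial.coeff g i) j \<in> S}"

definition linear_bipoly :: "'a::zero \<Rightarrow> 'a \<Rightarrow> 'a \<Rightarrow> 'a poly poly" where
  "linear_bipoly b1 b2 b3 = [: [:b3, b2:], [:b1:] :]"  \<comment> \<open>\<open>b1 x + b2 y + b3\<close>\<close>


section \<open>Counting the solutions\<close>

definition solutions ::
  "'a::field_char_0 \<Rightarrow> 'a \<Rightarrow> 'a set \<Rightarrow> real \<Rightarrow> real \<Rightarrow> ('a \<times> 'a) set" where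
  "solutions t a J Bx By =
     {(x, y). x \<in> alg_ints \<and> y \<in> alg_ints \<and> x + t * y + a \<in> Idl\<^bsub>ring_on alg_ints\<^esub> J \<and>
        (\<forall>h \<in> complex_embeddings alg_ints. norm (h x) \<le> Bx \<and> norm (h y) \<le> By)}"

definition ecardinality :: "'b set \<Rightarrow> enat" where
  "ecardinality S = (if finite S then enat (card S) else \<infinity>)"

definition num_solutions ::
  "'a::field_char_0 \<Rightarrow> 'a \<Rightarrow> 'a set \<Rightarrow> real \<Rightarrow> real \<Rightarrow> enat" where
  "num_solutions t a J Bx By = ecardinality (solutions t a J Bx By)"

text \<open>
  For \<open>a = 0\<close> the pair \<open>(0, 0)\<close> is always a solution, so assertions that the homogeneous problem has
  no solution, or only finitely many, only make sense for the nontrivial ones.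
\<close>

definition num_nontrivial_homogeneous_solutions ::
  "'a::field_char_0 \<Rightarrow> 'a set \<Rightarrow> real \<Rightarrow> real \<Rightarrow> enat" where
  "num_nontrivial_homogeneous_solutions t J Bx By =
     ecardinality (solutions t 0 J Bx By - {(0, 0)})"


section \<open>Finite places and their algebraically closed local fields\<close>

definition nonarch_abs_on :: "'a::field set \<Rightarrow> ('a \<Rightarrow> real) \<Rightarrow> bool" where
  "nonarch_abs_on R v \<longleftrightarrow>
     (\<forall>x\<in>R. 0 \<le> v x \<and> (v x = 0 \<longleftrightarrow> x = 0)) \<and>
     (\<forall>x\<in>R. \<forall>y\<in>R. v (x * y) = v x * v y \<and> v (x + y) \<le> max (v x) (v y))"

text \<open>
  A finite place is identified with its normalized absolute value. The normalization is the one that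
  extends the usual absolute value of the \<open>p\<close>-adic numbers (\<open>v p = 1/p\<close>): it is the local degree in
  the exponent of the local capacity that accounts for the size of the completion.
  Restriction to \<open>extensional F\<close> makes a place determined by its values on \<open>F\<close>.
\<close>

definition finite_places :: "'a::field_char_0 set \<Rightarrow> ('a \<Rightarrow> real) set" where
  "finite_places F =
     {v \<in> extensional F. nonarch_abs_on F v \<and> (\<exists>p::nat. Factorial_Ring.prime p \<and> v (of_nat p) = 1 / of_nat p)}"

definition abs_closure :: "('b::field \<Rightarrow> real) \<Rightarrow> 'b set \<Rightarrow> 'b set" where
  "abs_closure av S = {z. \<forall>e>0. \<exists>s\<in>S. av (z - s) < e}"

definition abs_complete :: "('b::field \<Rightarrow> real) \<Rightarrow> 'b set \<Rightarrow> bool" where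
  "abs_complete av S \<longleftrightarrow>
     (\<forall>u::nat \<Rightarrow> 'b. range u \<subseteq> S \<longrightarrow>
        (\<forall>e>0. \<exists>N. \<forall>m\<ge>N. \<forall>n\<ge>N. av (u m - u n) < e) \<longrightarrow>
        (\<exists>l\<in>S. (\<lambda>n. av (u n - l)) \<longlonglongrightarrow> 0))"

text \<open>
  The type \<open>'b\<close>, together with the embedding \<open>emb\<close> of \<open>F\<close> and the absolute value \<open>av\<close>, is an
  algebraic closure of the completion of \<open>F\<close> at \<open>v\<close> with an absolute value extending \<open>v\<close>. The
  completion is the closure of the image of \<open>F\<close>. One type \<open>'b\<close> can serve for all places at once, as
  the fields in question are all isomorphic to the complex numbers as abstract fields.
\<close>

definition local_closure ::
  "'a::field_char_0 set \<Rightarrow> ('a \<Rightarrow> real) \<Rightarrow> ('a \<Rightarrow> 'b::field) \<Rightarrow> ('b \<Rightarrow> real) \<Rightarrow> bool" where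
  "local_closure F v emb av \<longleftrightarrow>
     emb \<in> ring_hom (ring_on F) (ring_on UNIV) \<and>
     nonarch_abs_on UNIV av \<and> (\<forall>x\<in>F. av (emb x) = v x) \<and>
     abs_complete av (abs_closure av (emb ` F)) \<and>
     algebraic_closure (ring_on UNIV) (abs_closure av (emb ` F))"

text \<open>The closure of the image of \<^term>\<open>\<rat>\<close> is the field of \<open>p\<close>-adic numbers.\<close>

definition local_degree ::
  "'a::field_char_0 set \<Rightarrow> ('a \<Rightarrow> 'b::field) \<Rightarrow> ('b \<Rightarrow> real) \<Rightarrow> nat" where
  "local_degree F emb av =
     ring.dim (ring_on UNIV) (abs_closure av (emb ` \<rat>)) (abs_closure av (emb ` F))"

definition valuation_ring :: "'a::field_char_0 set \<Rightarrow> ('a \<Rightarrow> real) \<Rightarrow> 'a set" where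
  "valuation_ring F v = {x \<in> F. v x \<le> 1}"

definition local_generator :: "'a::field_char_0 set \<Rightarrow> ('a \<Rightarrow> real) \<Rightarrow> 'a set \<Rightarrow> 'a \<Rightarrow> bool" where
  "local_generator F v J c \<longleftrightarrow> c \<in> valuation_ring F v \<and>
     Idl\<^bsub>ring_on (valuation_ring F v)\<^esub> J = PIdl\<^bsub>ring_on (valuation_ring F v)\<^esub> c"

definition ideal_abs :: "'a::field_char_0 set \<Rightarrow> ('a \<Rightarrow> real) \<Rightarrow> 'a set \<Rightarrow> real" where
  "ideal_abs F v J = v (SOME c. local_generator F v J c)"

definition finite_local_set ::
  "'a::field_char_0 set \<Rightarrow> 'a set \<Rightarrow> 'a \<Rightarrow> 'a \<Rightarrow> 'a \<Rightarrow> 'a \<Rightarrow> 'a \<Rightarrow>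
     ('a \<Rightarrow> real) \<Rightarrow> ('a \<Rightarrow> 'b::field) \<Rightarrow> ('b \<Rightarrow> real) \<Rightarrow> 'b set" where
  "finite_local_set F J t a b1 b2 b3 v emb av =
     {y. av y \<le> 1 \<and>
         av (emb b2 * y + emb b3) \<le> av (emb b1) \<and>
         av (- (emb b2 * y + emb b3) / emb b1 + emb t * y + emb a) \<le> ideal_abs F v J}"

definition is_disk :: "('b::field \<Rightarrow> real) \<Rightarrow> 'b set \<Rightarrow> real \<Rightarrow> bool" where
  "is_disk av E r \<longleftrightarrow> r > 0 \<and> (\<exists>c. E = {y. av (y - c) \<le> r})"

text \<open>
  An intersection of disks is a disk or empty; the empty set has capacity 0. Since the absolute
  value on the algebraic closure has dense value group, a disk determines its radius.
\<close>

definition finite_local_capacity ::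
  "'a::field_char_0 set \<Rightarrow> ('a \<Rightarrow> 'b::field) \<Rightarrow> ('b \<Rightarrow> real) \<Rightarrow> 'b set \<Rightarrow> real" where
  "finite_local_capacity F emb av E =
     (if E = {} then 0 else (THE r. is_disk av E r) ^ local_degree F emb av)"


section \<open>Infinite places\<close>

text \<open>
  An infinite place is identified with an absolute value, that is, with a pair of complex conjugate
  embeddings (or one real embedding). The set attached to it is well defined up to complex
  conjugation, so its transfinite diameter does not depend on the choice of the embedding.
\<close>

definition induces_place :: "'a::field_char_0 set \<Rightarrow> ('a \<Rightarrow> real) \<Rightarrow> ('a \<Rightarrow> complex) \<Rightarrow> bool" where
  "induces_place F v h \<longleftrightarrow> h \<in> complex_embeddings F \<and> v = restrict (\<lambda>x. norm (h x)) F"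

definition infinite_places :: "'a::field_char_0 set \<Rightarrow> ('a \<Rightarrow> real) set" where
  "infinite_places F = {v. \<exists>h. induces_place F v h}"

definition infinite_local_set ::
  "real \<Rightarrow> real \<Rightarrow> 'a::field_char_0 \<Rightarrow> 'a \<Rightarrow> 'a \<Rightarrow> ('a \<Rightarrow> complex) \<Rightarrow> complex set" where
  "infinite_local_set Bx By b1 b2 b3 h =
     {y. norm y \<le> By \<and> norm (h b2 * y + h b3) \<le> norm (h b1) * Bx}"

definition nth_diameter :: "complex set \<Rightarrow> nat \<Rightarrow> real" where
  "nth_diameter E n =
     (SUP z \<in> {z. z ` {..<n} \<subseteq> E}.
        (\<Prod>(i, j) \<in> {(i, j). i < j \<and> j < n}. norm (z i - z j)) powr (2 / (real n * (real n - 1))))"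

definition transfinite_diameter :: "complex set \<Rightarrow> real" where
  "transfinite_diameter E = (if E = {} then 0 else lim (nth_diameter E))"

definition infinite_local_capacity ::
  "'a::field_char_0 set \<Rightarrow> real \<Rightarrow> real \<Rightarrow> 'a \<Rightarrow> 'a \<Rightarrow> 'a \<Rightarrow> ('a \<Rightarrow> real) \<Rightarrow> real" where
  "infinite_local_capacity F Bx By b1 b2 b3 v =
     (let h = (SOME h. induces_place F v h) in
        transfinite_diameter (infinite_local_set Bx By b1 b2 b3 h) ^
          (if h ` F \<subseteq> \<real> then 1 else 2))"


section \<open>The capacity of the adelic set\<close>

text \<open>
  For \<open>b1 \<noteq> 0\<close> and \<open>J \<noteq> {0}\<close> only finitely many local capacities differ from 1, so the product over
  all finite places is the product over those.
\<close>

definition adelic_capacity ::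
  "'a::field_char_0 set \<Rightarrow> 'a set \<Rightarrow> 'a \<Rightarrow> 'a \<Rightarrow> real \<Rightarrow> real \<Rightarrow> 'a \<Rightarrow> 'a \<Rightarrow> 'a \<Rightarrow>
     (('a \<Rightarrow> real) \<Rightarrow> 'a \<Rightarrow> 'b::field) \<Rightarrow> (('a \<Rightarrow> real) \<Rightarrow> 'b \<Rightarrow> real) \<Rightarrow> real" where
  "adelic_capacity F J t a Bx By b1 b2 b3 emb av =
     (let c = (\<lambda>v. finite_local_capacity F (emb v) (av v)
                     (finite_local_set F J t a b1 b2 b3 v (emb v) (av v)))
      in (\<Prod>v \<in> infinite_places F. infinite_local_capacity F Bx By b1 b2 b3 v) *
         (\<Prod>v \<in> {v \<in> finite_places F. c v \<noteq> 1}. c v))"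

end

(*
  Multiplication by roots of unity and the formation of differences give parts (1) and (3). For
  part (2), g_1 takes an algebraic integer value with all conjugates of absolute value less than 1,
  hence the value 0, at every solution (x, y) and at (-x, -y); so b_3 = 0 and b_1 x = - b_2 y. The sets
  E_v are then disks around 0 which contain all conjugates of y, and Fekete's theorem is not needed:
  if y is not 0, its norm N to F violates the inequality
    1 <= (product of |N|_v ^ n_v over the infinite places and any finitely many finite places).
  This half of the product formula is proved by counting the residue classes modulo N^k as k tends to
  infinity. At a finite place, n_v elements of F which are independent over Q_p yield about
  |N|_v ^ (- k n_v) classes. All classes have representatives in a box around 0 in the product of the
  archimedean completions, and cutting the box into small cells bounds their number, because a nonzero
  integer of F has norm at least 1.
*)
theory Submission
  imports Defs "Jordan_Normal_Form.Char_Poly"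
begin


section \<open>Closure properties of algebraic integers\<close>

text \<open>The conjugates of \<open>y\<close> are needed in two kinds of fields: in the complex
  numbers, where the bounds on a solution are stated for embeddings of all algebraic integers, and
  in the local field at each finite place. Isomorphisms between subfields are therefore handled
  through their graphs. Such a graph can be prolonged, with a prescribed conjugate as image of
  \<open>y\<close>, to all algebraic numbers, and the prolongation carries bounds and integrality
  over to that conjugate. If \<open>y\<close> has degree d over F, then N is up to sign a product of
  d conjugates, so |N|_v is at most the d-th power of the radius of E_v, and the product in the
  inequality is at most the d-th power of the capacity. For this the capacities have to be bounded
  from below only: a disk of radius R has transfinite diameter at least R. The exponent n_v in the
  count is the degree of an extension of completions. Completeness makes finite-dimensional
  subspaces closed; hence this degree is finite, and a basis can be moved into F without losing
  independence.\<close>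

lemma algebraic_int_if_stable:
  fixes w :: "nat \<Rightarrow> 'a::field_char_0"
  assumes stable: "\<And>i. i < n \<Longrightarrow> z * w i = (\<Sum>j<n. of_int (A i j) * w j)"
    and nonzero: "k < n" "w k \<noteq> 0"
  shows "algebraic_int z"
proof -
  define AZ where "AZ = Matrix.mat n n (\<lambda>(i, j). A i j)"
  define AF where "AF = map_mat (of_int :: int \<Rightarrow> 'a) AZ"
  have AZ: "AZ \<in> carrier_mat n n" and AF: "AF \<in> carrier_mat n n"
    by (auto simp: AZ_def AF_def)
  \<comment> \<open>The hypothesis \<open>stable\<close> says that \<open>w\<close> is an
    eigenvector of the integer matrix \<open>A\<close> for the eigenvalue \<open>z\<close>, and the
    characteristic polynomial of \<open>A\<close> is monic with integer coefficients.\<close>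
  have "eigenvector AF (Matrix.vec n w) z"
    unfolding eigenvector_def
  proof (intro conjI)
    show "Matrix.vec n w \<in> carrier_vec (dim_row AF)"
      using AF by auto
    show "Matrix.vec n w \<noteq> 0\<^sub>v (dim_row AF)"
      using nonzero AF by (metis carrier_matD(1) index_vec index_zero_vec(1))
    show "AF *\<^sub>v Matrix.vec n w = z \<cdot>\<^sub>v Matrix.vec n w"
      by (rule eq_vecI)
         (auto simp: AF_def AZ_def scalar_prod_def stable lessThan_atLeast0 intro!: sum.cong)
  qed
  then have "eigenvalue AF z"
    by (auto simp: eigenvalue_def)
  then have "poly (char_poly AF) z = 0"
    using eigenvalue_root_char_poly[OF AF] by simp
  moreover have "char_poly AF = map_poly of_int (char_poly AZ)"
    unfolding AF_def by (rule of_int_hom.char_poly_hom[OF AZ])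
  ultimately have "poly (map_poly of_int (char_poly AZ)) z = 0"
    by (simp only:)
  moreover have "Polynomial.lead_coeff (char_poly AZ) = 1"
    using degree_monic_char_poly[OF AZ] by simp
  ultimately show ?thesis
    unfolding algebraic_int_altdef_ipoly by blast
qed

lemma algebraic_int_if_stable_set:
  fixes w :: "'i \<Rightarrow> 'a::field_char_0"
  assumes fin: "finite I"
    and stable: "\<And>i. i \<in> I \<Longrightarrow> \<exists>A. z * w i = (\<Sum>j\<in>I. of_int (A j) * w j)"
    and nonzero: "k \<in> I" "w k \<noteq> 0"
  shows "algebraic_int z"
proof -
  obtain e where e: "bij_betw e {..<card I} I"
    using fin bij_betw_from_nat_into_finite atLeast0LessThan ex_bij_betw_nat_finite by metis
  obtain A where A: "\<And>i. i \<in> I \<Longrightarrow> z * w i = (\<Sum>j\<in>I. of_int (A i j) * w j)"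
    using stable by metis
  obtain l where l: "l < card I" "e l = k"
    using e nonzero(1) by (metis bij_betw_def imageE lessThan_iff)
  show ?thesis
  proof (rule algebraic_int_if_stable[where w = "w \<circ> e" and n = "card I" and k = l])
    fix i assume i: "i < card I"
    then have "e i \<in> I"
      using e by (auto simp: bij_betw_def)
    then have "z * w (e i) = (\<Sum>j\<in>I. of_int (A (e i) j) * w j)"
      by (rule A)
    also have "\<dots> = (\<Sum>j<card I. of_int (A (e i) (e j)) * w (e j))"
      by (rule sum.reindex_bij_betw[OF e, symmetric])
    finally show "z * (w \<circ> e) i = (\<Sum>j<card I. of_int (A (e i) (e j)) * (w \<circ> e) j)"
      by simp
  qed (use l nonzero in auto)
qed

lemma algebraic_int_top_power:
  fixes x :: "'a::field_char_0"
  assumes "algebraic_int x"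
  obtains m and c :: "nat \<Rightarrow> int" where "m > 0" "x ^ m = (\<Sum>i<m. of_int (c i) * x ^ i)"
proof -
  obtain p where p: "poly (map_poly of_int p) x = 0" "Polynomial.lead_coeff p = 1"
    using assms by (auto simp: algebraic_int_altdef_ipoly)
  define m where "m = Polynomial.degree p"
  have "m > 0"
  proof (rule ccontr)
    assume "\<not> m > 0"
    then have "p = [:1:]"
      using p(2) by (auto simp: m_def elim: degree_eq_zeroE)
    with p(1) show False by (simp add: map_poly_pCons)
  qed
  have deg: "Polynomial.degree (map_poly of_int p :: 'a poly) = m"
    unfolding m_def by (rule degree_map_poly) auto
  have "0 = (\<Sum>i\<le>m. of_int (Polynomial.coeff p i) * x ^ i)"
    using p(1) unfolding poly_altdef deg by (simp only: coeff_map_poly of_int_0)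
  also have "\<dots> = (\<Sum>i<m. of_int (Polynomial.coeff p i) * x ^ i) + x ^ m"
    using p(2) by (simp add: m_def lessThan_Suc_atMost[symmetric])
  finally have "x ^ m = (\<Sum>i<m. of_int (- Polynomial.coeff p i) * x ^ i)"
    by (simp add: sum_negf eq_neg_iff_add_eq_0 add.commute)
  with \<open>m > 0\<close> show ?thesis by (rule that)
qed

section \<open>Finitely generated additive subgroups and their multipliers\<close>

definition int_span :: "('i \<Rightarrow> 'a::ring_1) \<Rightarrow> 'i set \<Rightarrow> 'a set" where
  "int_span w I = {\<Sum>i\<in>I. of_int (c i) * w i | c. True}"

lemma int_spanI: "x = (\<Sum>i\<in>I. of_int (c i) * w i) \<Longrightarrow> x \<in> int_span w I"
  unfolding int_span_def by blast

lemma int_span_add: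
  assumes "x \<in> int_span w I" "y \<in> int_span w I"
  shows "x + y \<in> int_span w I"
proof -
  obtain c d where "x = (\<Sum>i\<in>I. of_int (c i) * w i)" "y = (\<Sum>i\<in>I. of_int (d i) * w i)"
    using assms by (auto simp: int_span_def)
  then show ?thesis
    by (intro int_spanI[of _ "\<lambda>i. c i + d i"]) (simp add: sum.distrib distrib_right)
qed

lemma int_span_zero: "0 \<in> int_span w I"
  by (rule int_spanI[of _ "\<lambda>_. 0"]) simp

lemma int_span_of_int_mult: "x \<in> int_span w I \<Longrightarrow> of_int k * x \<in> int_span w I"
  unfolding int_span_def
proof clarify
  fix c
  show "\<exists>d. of_int k * (\<Sum>i\<in>I. of_int (c i) * w i) = (\<Sum>i\<in>I. of_int (d i) * w i) \<and> True"
    by (rule exI[of _ "\<lambda>i. k * c i"]) (simp add: sum_distrib_left mult.assoc)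
qed

lemma int_span_sum: "(\<And>j. j \<in> B \<Longrightarrow> f j \<in> int_span w I) \<Longrightarrow> sum f B \<in> int_span w I"
  by (induction B rule: infinite_finite_induct) (auto intro: int_span_add int_span_zero)

lemma int_span_base:
  assumes "finite I" "i \<in> I"
  shows "w i \<in> int_span w I"
proof -
  have "w i = (\<Sum>j\<in>I. of_int (if j = i then 1 else 0) * w j)"
    using assms by (subst sum.remove[of _ i]) auto
  then show ?thesis by (rule int_spanI)
qed

lemma algebraic_int_if_int_span:
  fixes w :: "'i \<Rightarrow> 'a::field_char_0"
  assumes "finite I" "\<And>i. i \<in> I \<Longrightarrow> z * w i \<in> int_span w I" "k \<in> I" "w k \<noteq> 0"
  shows "algebraic_int z"
proof (rule algebraic_int_if_stable_set[of I z w k])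
  fix i assume "i \<in> I"
  from assms(2)[OF this] show "\<exists>A. z * w i = (\<Sum>j\<in>I. of_int (A j) * w j)"
    unfolding int_span_def by blast
qed (rule assms)+

text \<open>The products \<open>x ^ i * y ^ j\<close> with exponents below the degrees of the two
  integral equations generate a group that is stable under \<open>x\<close> and under
  \<open>y\<close>, hence under their sum and product.\<close>

lemma
  fixes x y :: "'a::field_char_0"
  assumes x: "algebraic_int x" and y: "algebraic_int y"
  shows algebraic_int_add: "algebraic_int (x + y)" and algebraic_int_mult: "algebraic_int (x * y)"
proof -
  obtain m a where m: "m > 0" "x ^ m = (\<Sum>i<m. of_int (a i) * x ^ i)"
    using x by (rule algebraic_int_top_power)
  obtain n b where n: "n > 0" "y ^ n = (\<Sum>i<n. of_int (b i) * y ^ i)"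
    using y by (rule algebraic_int_top_power)
  define w where "w = (\<lambda>(i, j). x ^ i * y ^ j)"
  define I where "I = {..<m} \<times> {..<n}"
  have fin: "finite I" and I0: "(0, 0) \<in> I" "w (0, 0) \<noteq> 0"
    using m(1) n(1) by (auto simp: I_def w_def)
  have wx: "x * w i \<in> int_span w I" if "i \<in> I" for i
  proof (cases i)
    case (Pair k l)
    show ?thesis
    proof (cases "Suc k < m")
      case True
      then show ?thesis
        using that Pair int_span_base[OF fin, of "(Suc k, l)" w]
        by (auto simp: I_def w_def mult_ac)
    next
      case False
      then have "Suc k = m" using that Pair by (auto simp: I_def)
      then have "x * w i = x ^ m * y ^ l" by (auto simp: Pair w_def)
      also have "\<dots> = (\<Sum>j<m. of_int (a j) * w (j, l))"
        unfolding m(2) by (simp add: sum_distrib_right w_def mult.assoc)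
      also have "\<dots> \<in> int_span w I"
        using that Pair by (intro int_span_sum int_span_of_int_mult int_span_base fin) (auto simp: I_def)
      finally show ?thesis .
    qed
  qed
  have wy: "y * w i \<in> int_span w I" if "i \<in> I" for i
  proof (cases i)
    case (Pair k l)
    show ?thesis
    proof (cases "Suc l < n")
      case True
      then show ?thesis
        using that Pair int_span_base[OF fin, of "(k, Suc l)" w]
        by (auto simp: I_def w_def mult_ac)
    next
      case False
      then have "Suc l = n" using that Pair by (auto simp: I_def)
      then have "y * w i = x ^ k * y ^ n" by (auto simp: Pair w_def)
      also have "\<dots> = (\<Sum>j<n. of_int (b j) * w (k, j))"
        unfolding n(2) by (simp add: sum_distrib_left w_def mult.left_commute)
      also have "\<dots> \<in> int_span w I"
        using that Pair by (intro int_span_sum int_span_of_int_mult int_span_base fin) (auto simp: I_def)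
      finally show ?thesis .
    qed
  qed
  have wxu: "x * u \<in> int_span w I" if u: "u \<in> int_span w I" for u
  proof -
    from u obtain c where "u = (\<Sum>i\<in>I. of_int (c i) * w i)" by (auto simp: int_span_def)
    then have "x * u = (\<Sum>i\<in>I. of_int (c i) * (x * w i))"
      by (simp add: sum_distrib_left mult.left_commute)
    then show ?thesis by (simp add: int_span_sum int_span_of_int_mult wx)
  qed
  have "(x + y) * w i \<in> int_span w I" if "i \<in> I" for i
    using int_span_add[OF wx[OF that] wy[OF that]] by (simp only: distrib_right)
  then show "algebraic_int (x + y)"
    by (rule algebraic_int_if_int_span[of I _ w "(0, 0)", OF fin _ I0])
  have "(x * y) * w i \<in> int_span w I" if "i \<in> I" for i
    using wxu[OF wy[OF that]] by (simp only: mult.assoc)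
  then show "algebraic_int (x * y)"
    by (rule algebraic_int_if_int_span[of I _ w "(0, 0)", OF fin _ I0])
qed

lemma algebraic_int_diff:
  fixes x y :: "'a::field_char_0"
  shows "algebraic_int x \<Longrightarrow> algebraic_int y \<Longrightarrow> algebraic_int (x - y)"
  using algebraic_int_add[of x "- y"] by auto

lemma algebraic_int_sum:
  fixes f :: "'b \<Rightarrow> 'a::field_char_0"
  shows "(\<And>i. i \<in> A \<Longrightarrow> algebraic_int (f i)) \<Longrightarrow> algebraic_int (sum f A)"
  by (induction A rule: infinite_finite_induct) (auto intro: algebraic_int_add)

lemma algebraic_int_prod:
  fixes f :: "'b \<Rightarrow> 'a::field_char_0"
  shows "(\<And>i. i \<in> A \<Longrightarrow> algebraic_int (f i)) \<Longrightarrow> algebraic_int (prod f A)"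
  by (induction A rule: infinite_finite_induct) (auto intro: algebraic_int_mult)

lemma algebraic_int_power:
  fixes x :: "'a::field_char_0"
  shows "algebraic_int x \<Longrightarrow> algebraic_int (x ^ n)"
  by (induction n) (auto intro: algebraic_int_mult)

text \<open>
  The partial sums of an integral equation for \<open>z\<close> stabilise the module generated by
  \<open>1, z, \<dots>, z ^ (n - 1)\<close>.
\<close>

lemma algebraic_int_partial_sum:
  fixes z :: "'a::field_char_0"
  assumes root: "(\<Sum>i\<le>n. of_int (a i) * z ^ i) = 0" and j: "j \<le> n"
  shows "algebraic_int (\<Sum>i=j..n. of_int (a i) * z ^ (i - j))"
proof (cases "n = 0")
  case True
  then show ?thesis using j by simp
next
  case False
  define b where "b = (\<Sum>i=j..n. of_int (a i) * z ^ (i - j))"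
  define w where "w = (\<lambda>i::nat. z ^ i)"
  have "b * w i \<in> int_span w {..<n}" if "i < n" for i
  proof (cases "i < j")
    case True
    \<comment> \<open>All exponents \<open>k - j + i\<close> are below \<open>n\<close> because
      \<open>i < j\<close>.\<close>
    have "b * w i = (\<Sum>k=j..n. of_int (a k) * w (k - j + i))"
      unfolding b_def w_def sum_distrib_right by (simp only: power_add mult.assoc)
    also have "\<dots> \<in> int_span w {..<n}"
      using True j by (intro int_span_sum int_span_of_int_mult int_span_base) auto
    finally show ?thesis .
  next
    case False
    have "b * w i = z ^ (i - j) * (\<Sum>k=j..n. of_int (a k) * z ^ k)"
      unfolding b_def w_def sum_distrib_right sum_distrib_left
    proof (rule sum.cong)
      fix k assume "k \<in> {j..n}"
      then have "k - j + i = (i - j) + k" using False by simp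
      then have "z ^ (k - j) * z ^ i = z ^ (i - j) * z ^ k"
        by (metis power_add)
      then show "of_int (a k) * z ^ (k - j) * z ^ i = z ^ (i - j) * (of_int (a k) * z ^ k)"
        by (metis mult.assoc mult.left_commute)
    qed simp
    \<comment> \<open>The equation exchanges the upper part of the sum for the lower one, whose
      exponents \<open>i - j + k\<close> with \<open>k < j\<close> stay below \<open>i\<close>,
      hence below \<open>n\<close>.\<close>
    also have "(\<Sum>k=j..n. of_int (a k) * z ^ k) = - (\<Sum>k<j. of_int (a k) * z ^ k)"
    proof -
      have "{..n} = {..<j} \<union> {j..n}"
        using j by auto
      then have "(\<Sum>i\<le>n. of_int (a i) * z ^ i)
          = (\<Sum>k<j. of_int (a k) * z ^ k) + (\<Sum>k=j..n. of_int (a k) * z ^ k)"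
        by (simp only:) (rule sum.union_disjoint, auto)
      then show ?thesis using root by (simp add: eq_neg_iff_add_eq_0 add.commute)
    qed
    also have "z ^ (i - j) * - (\<Sum>k<j. of_int (a k) * z ^ k)
        = (\<Sum>k<j. of_int (- a k) * w (i - j + k))"
      by (simp add: w_def sum_distrib_left sum_negf power_add mult.left_commute)
    also have "\<dots> \<in> int_span w {..<n}"
      using False that by (intro int_span_sum int_span_of_int_mult int_span_base) auto
    finally show ?thesis .
  qed
  then have "algebraic_int b"
    by (intro algebraic_int_if_int_span[of "{..<n}" b w 0]) (use False in \<open>simp_all add: w_def\<close>)
  then show ?thesis by (simp add: b_def)
qed


section \<open>Partial isomorphisms of fields and their extension\<close>

text \<open>
  A partial isomorphism between subfields of two fields, given by its graph. The condition on \<open>0\<close>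
  makes the relation single-valued; injectivity is automatic.
\<close>

definition field_graph :: "('a::field \<times> 'b::field) set \<Rightarrow> bool" where
  "field_graph G \<longleftrightarrow> (1, 1) \<in> G \<and>
     (\<forall>x u y w. (x, u) \<in> G \<longrightarrow> (y, w) \<in> G \<longrightarrow> (x - y, u - w) \<in> G \<and> (x * y, u * w) \<in> G) \<and>
     (\<forall>x u. (x, u) \<in> G \<longrightarrow> (inverse x, inverse u) \<in> G) \<and> (\<forall>u. (0, u) \<in> G \<longrightarrow> u = 0)"

context
  fixes G :: "('a::field \<times> 'b::field) set"
  assumes G: "field_graph G"
begin

lemma
  shows field_graph_1: "(1, 1) \<in> G"
    and field_graph_diff: "(x, u) \<in> G \<Longrightarrow> (y, w) \<in> G \<Longrightarrow> (x - y, u - w) \<in> G"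
    and field_graph_mult: "(x, u) \<in> G \<Longrightarrow> (y, w) \<in> G \<Longrightarrow> (x * y, u * w) \<in> G"
    and field_graph_inverse: "(x, u) \<in> G \<Longrightarrow> (inverse x, inverse u) \<in> G"
    and field_graph_zeroD: "(0, u) \<in> G \<Longrightarrow> u = 0"
  using G unfolding field_graph_def by auto

lemma field_graph_0: "(0, 0) \<in> G"
  using field_graph_diff[OF field_graph_1 field_graph_1] by simp

lemma field_graph_minus: "(x, u) \<in> G \<Longrightarrow> (- x, - u) \<in> G"
  using field_graph_diff[OF field_graph_0, of x u] by simp

lemma field_graph_add: "(x, u) \<in> G \<Longrightarrow> (y, w) \<in> G \<Longrightarrow> (x + y, u + w) \<in> G"
  using field_graph_diff[of x u "- y" "- w"] field_graph_minus[of y w] by simp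

lemma field_graph_divide: "(x, u) \<in> G \<Longrightarrow> (y, w) \<in> G \<Longrightarrow> (x / y, u / w) \<in> G"
  using field_graph_mult[of x u "inverse y" "inverse w"] field_graph_inverse[of y w]
  by (simp add: divide_inverse)

lemma field_graph_power: "(x, u) \<in> G \<Longrightarrow> (x ^ n, u ^ n) \<in> G"
  by (induction n) (auto intro: field_graph_1 field_graph_mult)

lemma field_graph_of_nat: "(of_nat n, of_nat n) \<in> G"
  by (induction n) (auto intro: field_graph_0 field_graph_1 field_graph_add)

lemma field_graph_of_int: "(of_int n, of_int n) \<in> G"
  by (cases n) (auto intro: field_graph_of_nat field_graph_minus simp del: of_nat_Suc)

lemma field_graph_sum:
  "(\<And>i. i \<in> A \<Longrightarrow> (f i, g i) \<in> G) \<Longrightarrow> (sum f A, sum g A) \<in> G"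
  by (induction A rule: infinite_finite_induct) (auto intro: field_graph_0 field_graph_add)

lemma field_graph_prod:
  "(\<And>i. i \<in> A \<Longrightarrow> (f i, g i) \<in> G) \<Longrightarrow> (prod f A, prod g A) \<in> G"
  by (induction A rule: infinite_finite_induct) (auto intro: field_graph_1 field_graph_mult)

lemma field_graph_right_unique: "(x, u) \<in> G \<Longrightarrow> (x, w) \<in> G \<Longrightarrow> u = w"
  using field_graph_diff[of x u x w] field_graph_zeroD[of "u - w"] by simp

lemma field_graph_zeroD': 
  assumes "(x, 0) \<in> G"
  shows "x = 0"
proof (rule ccontr)
  assume "x \<noteq> 0"
  \<comment> \<open>Here \<open>inverse 0 = 0\<close> matters: closure under the total inverse turns
    \<open>(x, 0)\<close> into \<open>(inverse x, 0)\<close>, and the product of the two pairs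
    contradicts single-valuedness at 1.\<close>
  have "(x * inverse x, 0 * inverse 0) \<in> G"
    using assms by (intro field_graph_mult field_graph_inverse)
  with \<open>x \<noteq> 0\<close> have "(1, 0) \<in> G" by simp
  with field_graph_1 show False using field_graph_right_unique by (metis zero_neq_one)
qed

lemma field_graph_zero_iff: "(x, u) \<in> G \<Longrightarrow> x = 0 \<longleftrightarrow> u = 0"
  using field_graph_zeroD field_graph_zeroD' by blast

lemma field_graph_converse: "field_graph (G\<inverse>)"
  using G field_graph_zeroD' unfolding field_graph_def by auto

end

section \<open>Polynomials with coefficients related by a partial isomorphism\<close>

definition graph_poly :: "('a::zero \<times> 'b::zero) set \<Rightarrow> 'a poly \<Rightarrow> 'b poly \<Rightarrow> bool" where
  "graph_poly G p q \<longleftrightarrow> (\<forall>i. (Polynomial.coeff p i, Polynomial.coeff q i) \<in> G)"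

lemma graph_poly_converse: "graph_poly (G\<inverse>) q p \<longleftrightarrow> graph_poly G p q"
  by (auto simp: graph_poly_def)

context
  fixes G :: "('a::field \<times> 'b::field) set"
  assumes G: "field_graph G"
begin

lemma graph_poly_degree:
  assumes "graph_poly G p q"
  shows "Polynomial.degree p = Polynomial.degree q"
proof -
  have "Polynomial.coeff p i = 0 \<longleftrightarrow> Polynomial.coeff q i = 0" for i
    using assms field_graph_zero_iff[OF G] by (auto simp: graph_poly_def)
  then show ?thesis
    unfolding Polynomial.degree_def by simp
qed

lemma graph_poly_eq_0_iff: "graph_poly G p q \<Longrightarrow> p = 0 \<longleftrightarrow> q = 0"
  using field_graph_zero_iff[OF G] by (auto simp: graph_poly_def poly_eq_iff)

lemma graph_poly_const: "(x, u) \<in> G \<Longrightarrow> graph_poly G [:x:] [:u:]"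
  using field_graph_0[OF G] by (auto simp: graph_poly_def coeff_pCons split: nat.split)

lemma graph_poly_X: "graph_poly G [:0, 1:] [:0, 1:]"
  using field_graph_0[OF G] field_graph_1[OF G]
  by (auto simp: graph_poly_def coeff_pCons split: nat.split)

lemma graph_poly_add: "graph_poly G p q \<Longrightarrow> graph_poly G r s \<Longrightarrow> graph_poly G (p + r) (q + s)"
  using field_graph_add[OF G] by (auto simp: graph_poly_def)

lemma graph_poly_diff: "graph_poly G p q \<Longrightarrow> graph_poly G r s \<Longrightarrow> graph_poly G (p - r) (q - s)"
  using field_graph_diff[OF G] by (auto simp: graph_poly_def)

lemma graph_poly_mult: "graph_poly G p q \<Longrightarrow> graph_poly G r s \<Longrightarrow> graph_poly G (p * r) (q * s)"
  by (auto simp: graph_poly_def coeff_mult intro!: field_graph_sum[OF G] field_graph_mult[OF G])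

lemma graph_poly_monom: "(x, u) \<in> G \<Longrightarrow> graph_poly G (Polynomial.monom x n) (Polynomial.monom u n)"
  using field_graph_0[OF G] by (auto simp: graph_poly_def)

lemma graph_poly_eval:
  assumes pq: "graph_poly G p q" and xu: "(x, u) \<in> G"
  shows "(poly p x, poly q u) \<in> G"
  unfolding poly_altdef graph_poly_degree[OF pq]
  using pq xu
  by (intro field_graph_sum[OF G] field_graph_mult[OF G] field_graph_power[OF G])
     (auto simp: graph_poly_def)

text \<open>Long division is done on both sides at once. Each quotient coefficient arises by field
  operations from coefficients already related by \<open>G\<close>, so quotient and remainder are
  again related.\<close>

lemma graph_poly_division:
  assumes "graph_poly G p q" and mm': "graph_poly G m m'" "m \<noteq> 0"
  shows "\<exists>a b r s. graph_poly G a b \<and> graph_poly G r s \<and> p = a * m + r \<and> q = b * m' + s \<and>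
    (r = 0 \<or> Polynomial.degree r < Polynomial.degree m)"
  using assms(1)
proof (induction "Polynomial.degree p" arbitrary: p q rule: less_induct)
  case less
  show ?case
  proof (cases "p = 0 \<or> Polynomial.degree p < Polynomial.degree m")
    case True
    then show ?thesis
      using less.prems graph_poly_const[OF field_graph_0[OF G]]
      by (intro exI[of _ 0] exI[of _ p] exI[of _ q]) auto
  next
    case False
    define k where "k = Polynomial.degree p - Polynomial.degree m"
    define t where "t = Polynomial.monom (Polynomial.lead_coeff p / Polynomial.lead_coeff m) k"
    define t' where "t' = Polynomial.monom (Polynomial.lead_coeff q / Polynomial.lead_coeff m') k"
    have deg: "Polynomial.degree q = Polynomial.degree p" "Polynomial.degree m' = Polynomial.degree m"
      using graph_poly_degree less.prems mm' by auto
    have tt': "graph_poly G t t'"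
      unfolding t_def t'_def deg using less.prems mm'
      by (intro graph_poly_monom field_graph_divide[OF G]) (auto simp: graph_poly_def)
    define p1 where "p1 = p - t * m"
    define q1 where "q1 = q - t' * m'"
    have p1q1: "graph_poly G p1 q1"
      unfolding p1_def q1_def by (intro graph_poly_diff graph_poly_mult less.prems tt' mm')
    have "Polynomial.degree (t * m) = Polynomial.degree p"
    proof -
      have c: "Polynomial.lead_coeff p / Polynomial.lead_coeff m \<noteq> 0"
        using False mm'(2) by auto
      then have "Polynomial.degree (t * m) = Polynomial.degree t + Polynomial.degree m"
        using mm'(2) by (intro degree_mult_eq) (simp_all add: t_def)
      moreover have "Polynomial.degree t = k"
        unfolding t_def using c by (rule degree_monom_eq)
      ultimately show ?thesis
        using False by (simp add: k_def)
    qed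
    moreover have "Polynomial.coeff (t * m) (Polynomial.degree p) = Polynomial.lead_coeff p"
    proof -
      have "Polynomial.lead_coeff (t * m) = Polynomial.lead_coeff p"
        unfolding lead_coeff_mult t_def lead_coeff_monom using mm'(2) by simp
      with calculation show ?thesis by simp
    qed
    ultimately have small: "p1 = 0 \<or> Polynomial.degree p1 < Polynomial.degree p"
      unfolding p1_def
      by (metis (no_types, lifting) Polynomial.coeff_diff degree_diff_le diff_self eq_zero_or_degree_less
          order_refl)
    show ?thesis
    proof (cases "p1 = 0")
      case True
      then have "q1 = 0" using graph_poly_eq_0_iff[OF p1q1] by simp
      with True show ?thesis
        using tt' graph_poly_const[OF field_graph_0[OF G]]
        by (intro exI[of _ t] exI[of _ t'] exI[of _ 0]) (auto simp: p1_def q1_def)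
    next
      case False
      with small have "Polynomial.degree p1 < Polynomial.degree p" by simp
      from less.hyps[OF this p1q1] obtain a b r s where
        IH: "graph_poly G a b" "graph_poly G r s" "p1 = a * m + r" "q1 = b * m' + s"
        "r = 0 \<or> Polynomial.degree r < Polynomial.degree m"
        by blast
      have "p = (t + a) * m + r" "q = (t' + b) * m' + s"
        using IH(3,4) by (auto simp: p1_def q1_def algebra_simps)
      with IH tt' show ?thesis
        by (intro exI[of _ "t + a"] exI[of _ "t' + b"] exI[of _ r] exI[of _ s])
           (auto intro: graph_poly_add)
    qed
  qed
qed

end

text \<open>\<open>m\<close> is a minimal polynomial of \<open>z\<close> over the domain of \<open>G\<close>, and \<open>m'\<close> is its image.\<close>

definition min_graph_poly ::
  "('a::field \<times> 'b::field) set \<Rightarrow> 'a \<Rightarrow> 'a poly \<Rightarrow> 'b poly \<Rightarrow> bool" where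
  "min_graph_poly G z m m' \<longleftrightarrow> graph_poly G m m' \<and> m \<noteq> 0 \<and> poly m z = 0 \<and>
     (\<forall>p q. graph_poly G p q \<longrightarrow> p \<noteq> 0 \<longrightarrow> poly p z = 0 \<longrightarrow> Polynomial.degree m \<le> Polynomial.degree p)"

lemma min_graph_poly_exists:
  assumes "graph_poly G p q" "p \<noteq> 0" "poly p z = 0"
  obtains m m' where "min_graph_poly G z m m'"
proof -
  define P where "P = (\<lambda>m. m \<noteq> 0 \<and> poly m z = 0 \<and> (\<exists>m'. graph_poly G m m'))"
  define m where "m = arg_min Polynomial.degree P"
  have "P p" using assms by (auto simp: P_def)
  then have "P m" and "\<And>p. P p \<Longrightarrow> Polynomial.degree m \<le> Polynomial.degree p"
    unfolding m_def by (auto intro: arg_min_natI arg_min_nat_le)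
  then show ?thesis
    using that unfolding P_def min_graph_poly_def by metis
qed

lemma min_graph_poly_dvd:
  assumes G: "field_graph G" and m: "min_graph_poly G z m m'"
    and pq: "graph_poly G p q" and "poly p z = 0"
  shows "\<exists>a b. graph_poly G a b \<and> p = a * m \<and> q = b * m'"
proof -
  have mm': "graph_poly G m m'" "m \<noteq> 0" "poly m z = 0"
    using m by (auto simp: min_graph_poly_def)
  obtain a b r s where d: "graph_poly G a b" "graph_poly G r s" "p = a * m + r" "q = b * m' + s"
    "r = 0 \<or> Polynomial.degree r < Polynomial.degree m"
    using graph_poly_division[OF G pq mm'(1,2)] by blast
  have "poly r z = 0"
    using d(3) mm'(3) assms(4) by simp
  with m d(2,5) have "r = 0"
    unfolding min_graph_poly_def by (metis leD)
  moreover from this have "s = 0"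
    using graph_poly_eq_0_iff[OF G d(2)] by simp
  ultimately show ?thesis using d by auto
qed

lemma min_graph_poly_degree_pos:
  assumes "min_graph_poly G z m m'"
  shows "Polynomial.degree m > 0"
proof (rule ccontr)
  assume "\<not> Polynomial.degree m > 0"
  then obtain c where "m = [:c:]"
    using degree_eq_zeroE by blast
  with assms show False by (auto simp: min_graph_poly_def)
qed

text \<open>Irreducibility in disguise. A minimal polynomial \<open>n'\<close> of \<open>w\<close>
  divides \<open>m'\<close>, and this is transported back to a factorization
  \<open>m = a * n\<close>. As \<open>a\<close> has smaller degree than \<open>m\<close>, it cannot
  vanish at \<open>z\<close>; so \<open>n\<close> does, and minimality of \<open>m\<close> gives
  \<open>n\<close> at least the degree of \<open>m\<close>.\<close>

lemma min_graph_poly_converse: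
  assumes G: "field_graph G" and m: "min_graph_poly G z m m'" and w: "poly m' w = 0"
  shows "min_graph_poly (G\<inverse>) w m' m"
proof -
  have mm': "graph_poly G m m'" "m \<noteq> 0" "poly m z = 0"
    using m by (auto simp: min_graph_poly_def)
  have m'0: "m' \<noteq> 0"
    using graph_poly_eq_0_iff[OF G mm'(1)] mm'(2) by simp
  obtain n' n where n: "min_graph_poly (G\<inverse>) w n' n"
    using min_graph_poly_exists[of "G\<inverse>" m' m w] mm'(1) m'0 w by (auto simp: graph_poly_converse)
  have nn': "graph_poly G n n'" "n' \<noteq> 0" "poly n' w = 0"
    using n by (auto simp: min_graph_poly_def graph_poly_converse)
  have n0: "n \<noteq> 0"
    using graph_poly_eq_0_iff[OF G nn'(1)] nn'(2) by simp
  have "graph_poly (G\<inverse>) m' m"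
    using mm'(1) by (simp add: graph_poly_converse)
  from min_graph_poly_dvd[OF field_graph_converse[OF G] n this w]
  obtain a a' where a: "graph_poly G a a'" "m = a * n"
    by (auto simp: graph_poly_converse)
  have deg: "Polynomial.degree n = Polynomial.degree n'" "Polynomial.degree m = Polynomial.degree m'"
    using graph_poly_degree[OF G] nn' mm' by auto
  have "Polynomial.degree n > 0"
    using min_graph_poly_degree_pos[OF n] deg by simp
  moreover have "Polynomial.degree m = Polynomial.degree a + Polynomial.degree n" and a0: "a \<noteq> 0"
    using a(2) mm'(2) n0 by (auto simp: degree_mult_eq)
  ultimately have "poly a z \<noteq> 0"
    using m a(1) unfolding min_graph_poly_def by fastforce
  with mm'(3) a(2) have "poly n z = 0" by simp
  then have "Polynomial.degree m \<le> Polynomial.degree n"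
    using m nn'(1) n0 unfolding min_graph_poly_def by blast
  then have "Polynomial.degree m' \<le> Polynomial.degree n'"
    using deg by simp
  moreover have "Polynomial.degree n' \<le> Polynomial.degree p"
    if "graph_poly (G\<inverse>) p q" "p \<noteq> 0" "poly p w = 0" for p q
    using n that unfolding min_graph_poly_def by blast
  ultimately show ?thesis
    using mm'(1) m'0 w unfolding min_graph_poly_def graph_poly_converse by (meson order_trans)
qed

text \<open>This makes the assignment of \<open>poly q w\<close> to \<open>poly p z\<close> well
  defined and injective.\<close>

lemma min_graph_poly_zero_iff:
  assumes G: "field_graph G" and m: "min_graph_poly G z m m'" and w: "poly m' w = 0"
    and pq: "graph_poly G p q"
  shows "poly p z = 0 \<longleftrightarrow> poly q w = 0"
proof
  assume "poly p z = 0"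
  from min_graph_poly_dvd[OF G m pq this] show "poly q w = 0" using w by auto
next
  assume "poly q w = 0"
  moreover have "graph_poly (G\<inverse>) q p" using pq by (simp add: graph_poly_converse)
  ultimately obtain a where "p = a * m"
    using min_graph_poly_dvd[OF field_graph_converse[OF G] min_graph_poly_converse[OF G m w]] by blast
  then show "poly p z = 0"
    using m by (auto simp: min_graph_poly_def)
qed

text \<open>The new domain is the field generated by \<open>z\<close>, written as fractions of
  polynomial values, so that closure under inverses is the exchange of numerator and
  denominator.\<close>

lemma field_graph_simple_extension:
  assumes G: "field_graph G" and m: "min_graph_poly G z m m'" and w: "poly m' w = 0"
  obtains H where "field_graph H" "G \<subseteq> H" "(z, w) \<in> H"
proof -
  define H where
    "H = {(poly p z / poly d z, poly q w / poly e w) | p q d e.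
            graph_poly G p q \<and> graph_poly G d e \<and> poly d z \<noteq> 0}"
  note zero_iff = min_graph_poly_zero_iff[OF G m w]
  have HI: "(x, u) \<in> H"
    if "graph_poly G p q" "graph_poly G d e" "poly d z \<noteq> 0" "x = poly p z / poly d z"
      "u = poly q w / poly e w" for x u p q d e
    using that unfolding H_def by blast
  have HE: "\<exists>p q d e. graph_poly G p q \<and> graph_poly G d e \<and> poly d z \<noteq> 0 \<and> poly e w \<noteq> 0 \<and>
      x = poly p z / poly d z \<and> u = poly q w / poly e w" if "(x, u) \<in> H" for x u
    using that zero_iff unfolding H_def by blast
  have one: "graph_poly G 1 1"
    using graph_poly_const[OF G field_graph_1[OF G]] by (simp add: one_pCons)
  have GH: "(x, u) \<in> H" if "(x, u) \<in> G" for x u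
    by (rule HI[OF graph_poly_const[OF G that] one]) auto
  have "field_graph H"
    unfolding field_graph_def
  proof (intro conjI allI impI)
    show "(1, 1) \<in> H"
      using GH field_graph_1[OF G] by blast
  next
    fix x u y v assume "(x, u) \<in> H" "(y, v) \<in> H"
    then obtain p q d e p' q' d' e' where
      *: "graph_poly G p q" "graph_poly G d e" "poly d z \<noteq> 0" "poly e w \<noteq> 0"
         "x = poly p z / poly d z" "u = poly q w / poly e w"
         "graph_poly G p' q'" "graph_poly G d' e'" "poly d' z \<noteq> 0" "poly e' w \<noteq> 0"
         "y = poly p' z / poly d' z" "v = poly q' w / poly e' w"
      by (meson HE)
    show "(x - y, u - v) \<in> H"
    proof (rule HI[of "p * d' - p' * d" "q * e' - q' * e" "d * d'" "e * e'"])
      show "x - y = poly (p * d' - p' * d) z / poly (d * d') z"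
        using * by (simp add: diff_frac_eq)
      show "u - v = poly (q * e' - q' * e) w / poly (e * e') w"
        using * by (simp add: diff_frac_eq)
    qed (use * in \<open>auto intro!: graph_poly_diff[OF G] graph_poly_mult[OF G]\<close>)
    show "(x * y, u * v) \<in> H"
      by (rule HI[of "p * p'" "q * q'" "d * d'" "e * e'"])
         (use * in \<open>auto intro!: graph_poly_mult[OF G]\<close>)
  next
    fix x u assume "(x, u) \<in> H"
    then obtain p q d e where
      *: "graph_poly G p q" "graph_poly G d e" "poly d z \<noteq> 0" "poly e w \<noteq> 0"
         "x = poly p z / poly d z" "u = poly q w / poly e w"
      by (meson HE)
    show "(inverse x, inverse u) \<in> H"
    proof (cases "poly p z = 0")
      case True
      then have "x = 0" "u = 0" using * zero_iff by auto
      then show ?thesis using GH field_graph_0[OF G] by simp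
    next
      case False
      then show ?thesis
        by (intro HI[of d e p q]) (use * in auto)
    qed
  next
    fix u assume "(0, u) \<in> H"
    then obtain p q d e where
      *: "graph_poly G p q" "graph_poly G d e" "poly d z \<noteq> 0" "poly e w \<noteq> 0"
         "0 = poly p z / poly d z" "u = poly q w / poly e w"
      by (meson HE)
    then show "u = 0" using zero_iff by auto
  qed
  moreover have "(z, w) \<in> H"
    by (rule HI[OF graph_poly_X[OF G] one]) auto
  ultimately show ?thesis
    using GH that by (metis subrelI)
qed

section \<open>Prolongation of partial isomorphisms to all algebraic numbers\<close>

lemma field_graph_Union:
  assumes "C \<noteq> {}" "\<And>G. G \<in> C \<Longrightarrow> field_graph G" "\<And>G H. G \<in> C \<Longrightarrow> H \<in> C \<Longrightarrow> G \<subseteq> H \<or> H \<subseteq> G"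
  shows "field_graph (\<Union>C)"
  unfolding field_graph_def
proof (intro conjI allI impI)
  show "(1, 1) \<in> \<Union>C"
    using assms(1,2) field_graph_1 by blast
next
  fix x u y w assume "(x, u) \<in> \<Union>C" "(y, w) \<in> \<Union>C"
  then obtain G where "G \<in> C" "(x, u) \<in> G" "(y, w) \<in> G"
    using assms(3) by blast
  with assms(2) show "(x - y, u - w) \<in> \<Union>C" "(x * y, u * w) \<in> \<Union>C"
    by (meson UnionI field_graph_diff field_graph_mult)+
next
  fix x u assume "(x, u) \<in> \<Union>C"
  with assms(2) show "(inverse x, inverse u) \<in> \<Union>C"
    by (meson UnionE UnionI field_graph_inverse)
next
  fix u assume "(0, u) \<in> \<Union>C"
  with assms(2) show "u = 0"
    by (meson UnionE field_graph_zeroD)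
qed

text \<open>A predicate on the type, because the local field \<open>'b\<close> belongs only to the
  class \<open>field\<close>; that it is algebraically closed is extracted from the assumption
  \<open>local_closure\<close>.\<close>

definition alg_closed_type :: "'b::field itself \<Rightarrow> bool" where
  "alg_closed_type _ \<longleftrightarrow> (\<forall>p::'b poly. Polynomial.degree p > 0 \<longrightarrow> (\<exists>x. poly p x = 0))"

lemma field_graph_of_int_poly:
  assumes "field_graph (G :: ('a::field \<times> 'b::field) set)"
  shows "graph_poly G (map_poly of_int p) (map_poly of_int p)"
  using field_graph_of_int[OF assms] by (auto simp: graph_poly_def coeff_map_poly)

text \<open>A maximal prolongation exists by Zorn's lemma. If an algebraic \<open>z\<close> were
  missing from its domain, the image of its minimal polynomial would have a root on the other side,
  and \<open>z\<close> could be adjoined.\<close>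

lemma field_graph_extend_algebraic:
  fixes G :: "('a::field_char_0 \<times> 'b::field) set"
  assumes G: "field_graph G" and ac: "alg_closed_type TYPE('b)"
  obtains H where "field_graph H" "G \<subseteq> H" "Collect algebraic \<subseteq> Domain H"
proof -
  have "\<exists>M\<in>{H. field_graph H \<and> G \<subseteq> H}. \<forall>K\<in>{H. field_graph H \<and> G \<subseteq> H}. M \<subseteq> K \<longrightarrow> K = M"
  proof (rule subset_Zorn_nonempty)
    show "{H. field_graph H \<and> G \<subseteq> H} \<noteq> {}" using G by blast
    fix C assume C: "C \<noteq> {}" "subset.chain {H. field_graph H \<and> G \<subseteq> H} C"
    then have "field_graph (\<Union>C)"
      unfolding subset_chain_def by (intro field_graph_Union) blast+
    moreover have "G \<subseteq> \<Union>C"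
      using C unfolding subset_chain_def by blast
    ultimately show "\<Union>C \<in> {H. field_graph H \<and> G \<subseteq> H}"
      by simp
  qed
  then obtain M where M: "field_graph M" "G \<subseteq> M"
    and max: "\<And>K. field_graph K \<Longrightarrow> G \<subseteq> K \<Longrightarrow> M \<subseteq> K \<Longrightarrow> K = M"
    by auto
  have "z \<in> Domain M" if z: "algebraic z" for z
  proof -
    obtain p :: "int poly" where p: "p \<noteq> 0" "poly (map_poly of_int p) z = 0"
      using z by (rule algebraicE')
    have "map_poly of_int p \<noteq> (0 :: 'a poly)"
      using p(1) by (auto simp: poly_eq_iff coeff_map_poly)
    then obtain m m' where m: "min_graph_poly M z m m'"
      using min_graph_poly_exists[OF field_graph_of_int_poly[OF M(1)]] p(2) by metis
    have "Polynomial.degree m' > 0"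
      using min_graph_poly_degree_pos[OF m] graph_poly_degree[OF M(1), of m m'] m
      by (auto simp: min_graph_poly_def)
    then obtain w where "poly m' w = 0"
      using ac by (auto simp: alg_closed_type_def)
    from field_graph_simple_extension[OF M(1) m this] obtain H where
      "field_graph H" "M \<subseteq> H" "(z, w) \<in> H" .
    with max M(2) show ?thesis by blast
  qed
  then have "Collect algebraic \<subseteq> Domain M" by blast
  with M show ?thesis by (rule that)
qed

lemma field_graph_extend:
  fixes G :: "('a::field_char_0 \<times> 'b::field) set"
  assumes G: "field_graph G" and ac: "alg_closed_type TYPE('b)"
    and m: "min_graph_poly G z m m'" and w: "poly m' w = 0"
  obtains H where "field_graph H" "G \<subseteq> H" "(z, w) \<in> H" "Collect algebraic \<subseteq> Domain H"
proof -
  obtain H1 where H1: "field_graph H1" "G \<subseteq> H1" "(z, w) \<in> H1"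
    using field_graph_simple_extension[OF G m w] .
  show ?thesis
  proof (rule field_graph_extend_algebraic[OF H1(1) ac])
    fix H assume "field_graph H" "H1 \<subseteq> H" "Collect algebraic \<subseteq> Domain H"
    with H1 show ?thesis by (intro that[of H]) auto
  qed
qed

lemma poly_splits:
  fixes p :: "'b::field poly"
  assumes ac: "alg_closed_type TYPE('b)" and "p \<noteq> 0"
  obtains ws where "length ws = Polynomial.degree p"
    "p = Polynomial.smult (Polynomial.lead_coeff p) (\<Prod>w\<leftarrow>ws. [:- w, 1:])"
proof -
  have "\<exists>ws. length ws = Polynomial.degree p \<and>
      p = Polynomial.smult (Polynomial.lead_coeff p) (\<Prod>w\<leftarrow>ws. [:- w, 1:])"
    using \<open>p \<noteq> 0\<close>
  proof (induction "Polynomial.degree p" arbitrary: p)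
    case 0
    then obtain c where "p = [:c:]" using degree_eq_zeroE by metis
    then show ?case by auto
  next
    case (Suc n)
    then obtain w where "poly p w = 0"
      using ac unfolding alg_closed_type_def by (metis zero_less_Suc)
    then obtain q where q: "p = [:- w, 1:] * q"
      by (auto simp: poly_eq_0_iff_dvd)
    with Suc.prems have "q \<noteq> 0" by auto
    then have "Polynomial.degree p = Suc (Polynomial.degree q)"
      unfolding q by (subst degree_mult_eq) auto
    with Suc.hyps(2) have n: "n = Polynomial.degree q" by simp
    from Suc.hyps(1)[OF n \<open>q \<noteq> 0\<close>] obtain ws where ws: "length ws = Polynomial.degree q"
      "q = Polynomial.smult (Polynomial.lead_coeff q) (\<Prod>w\<leftarrow>ws. [:- w, 1:])"
      by blast
    have "Polynomial.lead_coeff p = Polynomial.lead_coeff q"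
      unfolding q lead_coeff_mult by simp
    moreover have "p = Polynomial.smult (Polynomial.lead_coeff q) (\<Prod>w\<leftarrow>w # ws. [:- w, 1:])"
      by (subst q, subst ws(2)) (simp only: list.map prod_list.Cons mult_smult_right)
    ultimately show ?case
      using ws(1) Suc.hyps(2) n by (intro exI[of _ "w # ws"]) (simp only: list.size, simp)
  qed
  then show ?thesis using that by blast
qed


section \<open>Number fields\<close>

lemma ring_of_type_algebra_simps [simp]:
  "x \<otimes>\<^bsub>ring_of_type_algebra\<^esub> y = x * y" "x \<oplus>\<^bsub>ring_of_type_algebra\<^esub> y = x + y"
  "\<one>\<^bsub>ring_of_type_algebra\<^esub> = 1" "\<zero>\<^bsub>ring_of_type_algebra\<^esub> = 0"
  by (simp_all add: ring_of_type_algebra_def)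

lemma ring_on_simps:
  "carrier (ring_on R) = R" "x \<otimes>\<^bsub>ring_on R\<^esub> y = x * y" "x \<oplus>\<^bsub>ring_on R\<^esub> y = x + y"
  "\<one>\<^bsub>ring_on R\<^esub> = 1" "\<zero>\<^bsub>ring_on R\<^esub> = 0"
  by (simp_all add: ring_of_type_algebra_def)

lemma field_ring_on_UNIV: "field (ring_on (UNIV :: 'a::field set))"
proof -
  have "ring_on (UNIV :: 'a set) = ring_of_type_algebra"
    by (simp add: ring_of_type_algebra_def)
  then show ?thesis using field_from_type_algebra by simp
qed

lemma ring_ring_on_UNIV: "ring (ring_on (UNIV :: 'a::field set))"
  using field_ring_on_UNIV field.is_ring by blast

lemma combine_ring_on:
  "ring.combine (ring_on (UNIV :: 'a::field set)) Ks Us = (\<Sum>i<min (length Ks) (length Us). Ks ! i * Us ! i)"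
proof -
  interpret ring "ring_on (UNIV :: 'a set)" by (rule ring_ring_on_UNIV)
  show ?thesis
    by (induction Ks Us rule: combine.induct)
       (simp_all add: sum.lessThan_Suc_shift del: sum.lessThan_Suc)
qed

lemma a_inv_ring_on: "a_inv (ring_on (UNIV :: 'a::field set)) x = - x"
proof -
  interpret ring "ring_on (UNIV :: 'a set)" by (rule ring_ring_on_UNIV)
  have "x + a_inv (ring_on UNIV) x = 0"
    using r_neg[of x] by simp
  then show ?thesis by (simp add: add_eq_0_iff)
qed

text \<open>Subfields are handled as identity graphs, so that all their closure properties are
  instances of those of \<open>field_graph\<close>.\<close>

lemma subfield_ring_on_iff:
  "subfield K (ring_on (UNIV :: 'a::field set)) \<longleftrightarrow> field_graph (Id_on K)"
proof
  interpret field "ring_on (UNIV :: 'a set)" by (rule field_ring_on_UNIV)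
  assume K: "subfield K (ring_on UNIV)"
  note E = subringE[OF subfieldE(1)[OF K]]
  have inv: "inverse x \<in> K" if x: "x \<in> K" for x
  proof (cases "x = 0")
    case True
    then show ?thesis using E(2) by simp
  next
    case False
    then have "m_inv (ring_on UNIV) x \<in> K" "x * m_inv (ring_on UNIV) x = 1"
      using subfield_m_inv[OF K, of x] x by auto
    then show ?thesis using inverse_unique by metis
  qed
  have "x - y \<in> K" if "x \<in> K" "y \<in> K" for x y
    using E(7)[of x "- y"] E(5)[of y] that by (simp add: a_inv_ring_on)
  then show "field_graph (Id_on K)"
    using E(3,6) inv by (auto simp: field_graph_def Id_on_def)
next
  interpret field "ring_on (UNIV :: 'a set)" by (rule field_ring_on_UNIV)
  assume K: "field_graph (Id_on K)"
  show "subfield K (ring_on UNIV)"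
  proof (rule subfieldI')
    show "subring K (ring_on UNIV)"
      by (rule subringI)
         (use field_graph_1[OF K] field_graph_minus[OF K] field_graph_mult[OF K]
           field_graph_add[OF K] in \<open>auto simp: a_inv_ring_on Id_on_def\<close>)
    fix k assume k: "k \<in> K - {\<zero>\<^bsub>ring_on UNIV\<^esub>}"
    then have "k * m_inv (ring_on UNIV) k = 1"
      using Units_r_inv[of k] field_Units by auto
    then have "m_inv (ring_on UNIV) k = inverse k"
      using inverse_unique by metis
    then show "m_inv (ring_on UNIV) k \<in> K"
      using k field_graph_inverse[OF K] by auto
  qed
qed

lemma field_graph_Rats: "field_graph (Id_on (\<rat> :: 'a::field_char_0 set))"
  by (auto simp: field_graph_def Id_on_def)

lemma number_field_field_graph: "number_field F \<Longrightarrow> field_graph (Id_on F)"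
  by (simp add: number_field_def subfield_ring_on_iff)

context
  fixes F :: "'a::field set"
  assumes F: "field_graph (Id_on F)"
begin

lemma
  shows subfield_1: "1 \<in> F"
    and subfield_0: "0 \<in> F"
    and subfield_diff: "x \<in> F \<Longrightarrow> y \<in> F \<Longrightarrow> x - y \<in> F"
    and subfield_add: "x \<in> F \<Longrightarrow> y \<in> F \<Longrightarrow> x + y \<in> F"
    and subfield_mult: "x \<in> F \<Longrightarrow> y \<in> F \<Longrightarrow> x * y \<in> F"
    and subfield_divide: "x \<in> F \<Longrightarrow> y \<in> F \<Longrightarrow> x / y \<in> F"
    and subfield_uminus: "x \<in> F \<Longrightarrow> - x \<in> F"
    and subfield_inverse: "x \<in> F \<Longrightarrow> inverse x \<in> F"
    and subfield_power: "x \<in> F \<Longrightarrow> x ^ n \<in> F"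
    and subfield_of_int: "of_int k \<in> F"
    and subfield_of_nat: "of_nat n \<in> F"
  using field_graph_1[OF F] field_graph_0[OF F] apply blast+
  using field_graph_diff[OF F, of x x y y] apply blast
  using field_graph_add[OF F, of x x y y] apply blast
  using field_graph_mult[OF F, of x x y y] apply blast
  using field_graph_divide[OF F, of x x y y] apply blast
  using field_graph_minus[OF F, of x x] apply blast
  using field_graph_inverse[OF F, of x x] apply blast
  using field_graph_power[OF F, of x x n] apply blast
  using field_graph_of_int[OF F, of k] apply blast
  using field_graph_of_nat[OF F, of n] apply blast
  done

lemma subfield_sum: "(\<And>i. i \<in> A \<Longrightarrow> f i \<in> F) \<Longrightarrow> sum f A \<in> F"
  by (induction A rule: infinite_finite_induct) (auto intro: subfield_0 subfield_add)

lemma subfield_prod: "(\<And>i. i \<in> A \<Longrightarrow> f i \<in> F) \<Longrightarrow> prod f A \<in> F"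
  by (induction A rule: infinite_finite_induct) (auto intro: subfield_1 subfield_mult)

end

lemma subfield_Rats:
  fixes F :: "'a::field_char_0 set"
  assumes "field_graph (Id_on F)" "x \<in> \<rat>"
  shows "x \<in> F"
proof -
  from assms(2) obtain a b where "x = of_int a / of_int b"
    by (rule Rats_cases')
  then show ?thesis
    by (simp add: subfield_divide[OF assms(1)] subfield_of_int[OF assms(1)])
qed

lemma number_field_basis:
  fixes F :: "'a::field_char_0 set"
  assumes "number_field F"
  obtains Us where "set Us \<subseteq> F"
    "\<forall>z\<in>F. \<exists>q. (\<forall>i. q i \<in> \<rat>) \<and> z = (\<Sum>i<length Us. q i * Us ! i)"
proof -
  interpret field "ring_on (UNIV :: 'a set)" by (rule field_ring_on_UNIV)
  have Q: "subfield \<rat> (ring_on (UNIV :: 'a set))"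
    using field_graph_Rats subfield_ring_on_iff by blast
  obtain n where "dimension n \<rat> F"
    using assms by (auto simp: number_field_def finite_dimension_def)
  then obtain Us where Us: "Span \<rat> Us = F" "set Us \<subseteq> UNIV"
    using exists_base[OF Q] by auto
  have "set Us \<subseteq> F"
    using Span_base_incl[OF Q] Us by auto
  moreover have "\<exists>q. (\<forall>i. q i \<in> \<rat>) \<and> z = (\<Sum>i<length Us. q i * Us ! i)" if "z \<in> F" for z
  proof -
    from that obtain Ks where Ks: "set Ks \<subseteq> \<rat>" "length Ks = length Us" "z = combine Ks Us"
      using Span_eq_combine_set_length_version[OF Q] Us by auto
    define q where "q = (\<lambda>i. if i < length Us then Ks ! i else 0)"
    have "\<forall>i. q i \<in> \<rat>"
      using Ks(1,2) nth_mem[of _ Ks] by (auto simp: q_def)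
    moreover have "z = (\<Sum>i<length Us. q i * Us ! i)"
      using Ks by (simp add: combine_ring_on q_def)
    ultimately show ?thesis by blast
  qed
  ultimately show ?thesis by (intro that) auto
qed

lemma number_field_dependence:
  fixes F :: "'a::field_char_0 set"
  assumes "number_field F"
  shows "\<exists>n. \<forall>f :: nat \<Rightarrow> 'a. (\<forall>i\<le>n. f i \<in> F) \<longrightarrow>
    (\<exists>q. (\<forall>i. q i \<in> \<rat>) \<and> (\<Sum>i\<le>n. q i * f i) = 0 \<and> (\<exists>i\<le>n. q i \<noteq> 0))"
proof -
  interpret field "ring_on (UNIV :: 'a set)" by (rule field_ring_on_UNIV)
  have Q: "subfield \<rat> (ring_on (UNIV :: 'a set))"
    using field_graph_Rats subfield_ring_on_iff by blast
  obtain n where n: "dimension n \<rat> F"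
    using assms by (auto simp: number_field_def finite_dimension_def)
  show ?thesis
  proof (intro exI[of _ n] allI impI)
    fix f :: "nat \<Rightarrow> 'a" assume f: "\<forall>i\<le>n. f i \<in> F"
    define fs where "fs = map f [0..<Suc n]"
    have "set fs \<subseteq> F" using f by (auto simp: fs_def)
    moreover have "length fs = Suc n" by (simp add: fs_def)
    ultimately have "dependent \<rat> fs"
      using independent_length_le_dimension[OF Q n, of fs] by linarith
    then have "\<not> (\<forall>Ks. set Ks \<subseteq> \<rat> \<longrightarrow> combine Ks fs = \<zero>\<^bsub>ring_on UNIV\<^esub> \<longrightarrow>
        set (take (length fs) Ks) \<subseteq> {\<zero>\<^bsub>ring_on UNIV\<^esub>})"
      using trivial_combine_imp_independent[OF Q, of fs] by (metis ring_on_simps(1) subset_UNIV)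
    then obtain Ks where Ks: "set Ks \<subseteq> \<rat>" "combine Ks fs = 0" "\<not> set (take (length fs) Ks) \<subseteq> {0}"
      unfolding ring_on_simps by blast
    \<comment> \<open>\<open>combine\<close> truncates to the shorter list, so \<open>Ks\<close> may
      have any length; padding by 0 turns it into a function without changing the sum.\<close>
    define q where "q = (\<lambda>i. if i < length Ks then Ks ! i else 0)"
    have q: "\<forall>i. q i \<in> \<rat>"
      using Ks(1) nth_mem[of _ Ks] by (auto simp: q_def)
    have "(\<Sum>i\<le>n. q i * f i) = (\<Sum>i<min (length Ks) (Suc n). Ks ! i * f i)"
      by (rule sum.mono_neutral_cong_right) (auto simp: q_def)
    also have "\<dots> = combine Ks fs"
      unfolding combine_ring_on by (rule sum.cong) (auto simp: fs_def simp del: upt_Suc)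
    finally have "(\<Sum>i\<le>n. q i * f i) = 0" using Ks(2) by simp
    moreover have "\<exists>i\<le>n. q i \<noteq> 0"
    proof -
      from Ks(3) obtain k where "k \<in> set (take (length fs) Ks)" "k \<noteq> 0" by blast
      then obtain i where "i < length fs" "i < length Ks" "Ks ! i = k"
        by (auto simp: in_set_conv_nth)
      with \<open>k \<noteq> 0\<close> show ?thesis
        by (intro exI[of _ i]) (auto simp: q_def fs_def)
    qed
    ultimately show "\<exists>q. (\<forall>i. q i \<in> \<rat>) \<and> (\<Sum>i\<le>n. q i * f i) = 0 \<and> (\<exists>i\<le>n. q i \<noteq> 0)"
      using q by blast
  qed
qed

lemma number_field_algebraic:
  fixes F :: "'a::field_char_0 set"
  assumes F: "number_field F" and z: "z \<in> F"
  shows "algebraic z"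
proof -
  obtain n where n: "\<forall>f :: nat \<Rightarrow> 'a. (\<forall>i\<le>n. f i \<in> F) \<longrightarrow>
    (\<exists>q. (\<forall>i. q i \<in> \<rat>) \<and> (\<Sum>i\<le>n. q i * f i) = 0 \<and> (\<exists>i\<le>n. q i \<noteq> 0))"
    using number_field_dependence[OF F] by (rule exE)
  obtain q where q: "\<forall>i. q i \<in> \<rat>" "(\<Sum>i\<le>n. q i * z ^ i) = 0" "\<exists>i\<le>n. q i \<noteq> 0"
    using n[rule_format, of "\<lambda>i. z ^ i"] subfield_power[OF number_field_field_graph[OF F] z] by auto
  define p where "p = (\<Sum>i\<le>n. Polynomial.monom (q i) i)"
  have c: "Polynomial.coeff p i = (if i \<le> n then q i else 0)" for i
    by (auto simp: p_def coeff_sum)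
  show ?thesis
  proof (rule algebraicI')
    show "Polynomial.coeff p i \<in> \<rat>" for i
      using q(1) by (simp add: c)
    show "p \<noteq> 0"
      using q(3) c by (metis coeff_0)
    show "poly p z = 0"
      using q(2) by (simp add: p_def poly_sum poly_monom)
  qed
qed

lemma algebraic_int_multiple:
  fixes z :: "'a::field_char_0"
  assumes "algebraic z"
  obtains k :: nat where "k > 0" "algebraic_int (of_nat k * z)"
proof (cases "z = 0")
  case True
  then show ?thesis using that[of 1] by simp
next
  case False
  obtain p :: "int poly" where p: "p \<noteq> 0" "poly (map_poly of_int p) z = 0"
    using assms by (rule algebraicE')
  define n where "n = Polynomial.degree p"
  define a where "a = Polynomial.coeff p"
  have deg: "Polynomial.degree (map_poly of_int p :: 'a poly) = n"
    unfolding n_def by (rule degree_map_poly) auto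
  have root: "(\<Sum>i\<le>n. of_int (a i) * z ^ i) = 0"
    using p(2) unfolding poly_altdef deg a_def by (simp only: coeff_map_poly of_int_0)
  have an: "a n \<noteq> 0" using p(1) by (simp add: a_def n_def)
  have "n > 0"
    using root an by (cases "n = 0") auto
  \<comment> \<open>This partial sum is \<open>a (n - 1) + a n * z\<close>, so the leading
    coefficient is a denominator of \<open>z\<close>.\<close>
  have "algebraic_int (\<Sum>i=n - 1..n. of_int (a i) * z ^ (i - (n - 1)))"
    by (rule algebraic_int_partial_sum[OF root]) simp
  also have "{n - 1..n} = {n - 1, n}" using \<open>n > 0\<close> by auto
  finally have "algebraic_int (of_int (a n) * z + of_int (a (n - 1)))"
    using \<open>n > 0\<close> by (simp add: add.commute)
  then have "algebraic_int (of_int (a n) * z + of_int (a (n - 1)) - of_int (a (n - 1)))"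
    by (rule algebraic_int_diff) simp
  then have "algebraic_int (of_int (a n) * z)"
    by simp
  \<comment> \<open>The sign turns the multiplier into a positive natural number.\<close>
  then have "algebraic_int (of_int (sgn (a n)) * (of_int (a n) * z))"
    by (rule algebraic_int_mult[rotated]) simp
  also have "of_int (sgn (a n)) * (of_int (a n) * z) = of_int (int (nat \<bar>a n\<bar>)) * z"
  proof -
    have "sgn (a n) * a n = int (nat \<bar>a n\<bar>)"
      by (simp add: sgn_if)
    then show ?thesis by (metis mult.assoc of_int_mult)
  qed
  finally show ?thesis using an by (intro that[of "nat \<bar>a n\<bar>"]) auto
qed

lemma algebraic_int_field_graph:
  fixes G :: "('a::field_char_0 \<times> 'b::field_char_0) set"
  assumes G: "field_graph G" and zw: "(z, w) \<in> G" and z: "algebraic_int z"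
  shows "algebraic_int w"
proof -
  obtain p where p: "poly (map_poly of_int p) z = 0" "Polynomial.lead_coeff p = 1"
    using z by (auto simp: algebraic_int_altdef_ipoly)
  have "(poly (map_poly of_int p) z, poly (map_poly of_int p) w) \<in> G"
    by (rule graph_poly_eval[OF G field_graph_of_int_poly[OF G] zw])
  then have "poly (map_poly of_int p) w = 0"
    using p(1) field_graph_zeroD[OF G] by simp
  with p(2) show ?thesis by (auto simp: algebraic_int_altdef_ipoly)
qed

lemma algebraic_field_graph:
  fixes G :: "('a::field_char_0 \<times> 'b::field_char_0) set"
  assumes G: "field_graph G" and zw: "(z, w) \<in> G" and z: "algebraic z"
  shows "algebraic w"
proof -
  obtain p :: "int poly" where p: "p \<noteq> 0" "poly (map_poly of_int p) z = 0"
    using z by (rule algebraicE')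
  have "(poly (map_poly of_int p) z, poly (map_poly of_int p) w) \<in> G"
    by (rule graph_poly_eval[OF G field_graph_of_int_poly[OF G] zw])
  then have "poly (map_poly of_int p) w = 0"
    using p(2) field_graph_zeroD[OF G] by simp
  then show ?thesis
    using p(1) by (intro algebraicI[of "map_poly of_int p"]) (auto simp: coeff_map_poly poly_eq_iff)
qed

section \<open>Passage between graphs and ring homomorphisms\<close>

definition the_image :: "('a \<times> 'b) set \<Rightarrow> 'a \<Rightarrow> 'b" where
  "the_image G x = (THE u. (x, u) \<in> G)"

lemma the_image_eq: "field_graph G \<Longrightarrow> (x, u) \<in> G \<Longrightarrow> the_image G x = u"
  unfolding the_image_def using field_graph_right_unique by blast

lemma the_image_in: "field_graph G \<Longrightarrow> x \<in> Domain G \<Longrightarrow> (x, the_image G x) \<in> G"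
  using the_image_eq by fastforce

lemma ring_hom_ring_onD:
  assumes "h \<in> Ring.ring_hom (ring_on R) (ring_on UNIV)"
  shows "x \<in> R \<Longrightarrow> y \<in> R \<Longrightarrow> h (x + y) = h x + h y" "x \<in> R \<Longrightarrow> y \<in> R \<Longrightarrow> h (x * y) = h x * h y" "h 1 = 1"
  using ring_hom_add[OF assms, of x y] ring_hom_mult[OF assms, of x y] ring_hom_one[OF assms] by auto

lemma field_graph_hom:
  fixes h :: "'a::field \<Rightarrow> 'b::field"
  assumes F: "field_graph (Id_on F)" and h: "h \<in> Ring.ring_hom (ring_on F) (ring_on UNIV)"
  shows "field_graph {(x, h x) | x. x \<in> F}"
proof -
  note hom = ring_hom_ring_onD[OF h]
  have h0: "h 0 = 0"
    using hom(1)[of 0 0] subfield_0[OF F] by (metis add_0 add_cancel_right_right)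
  have hm: "h (- x) = - h x" if "x \<in> F" for x
    using hom(1)[of x "- x"] subfield_uminus[OF F that] that h0 by (simp add: add_eq_0_iff)
  have hd: "h (x - y) = h x - h y" if "x \<in> F" "y \<in> F" for x y
    using hom(1)[of x "- y"] subfield_uminus[OF F that(2)] that hm by simp
  have hi: "h (inverse x) = inverse (h x)" if "x \<in> F" for x
  proof (cases "x = 0")
    case False
    then have "h x * h (inverse x) = 1"
      using hom(2)[of x "inverse x"] subfield_inverse[OF F that] that hom(3) by simp
    then show ?thesis by (metis inverse_unique)
  qed (simp add: h0)
  show ?thesis
    unfolding field_graph_def
  proof (intro conjI allI impI)
    show "(1, 1) \<in> {(x, h x) | x. x \<in> F}"
      using hom(3) subfield_1[OF F] by force
  next
    fix x u y w assume "(x, u) \<in> {(x, h x) | x. x \<in> F}" "(y, w) \<in> {(x, h x) | x. x \<in> F}"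
    then have "x \<in> F" "y \<in> F" "u = h x" "w = h y" by auto
    then show "(x - y, u - w) \<in> {(x, h x) | x. x \<in> F}" "(x * y, u * w) \<in> {(x, h x) | x. x \<in> F}"
      using hd[of x y] hom(2)[of x y] subfield_diff[OF F, of x y] subfield_mult[OF F, of x y] by auto
  next
    fix x u assume "(x, u) \<in> {(x, h x) | x. x \<in> F}"
    then show "(inverse x, inverse u) \<in> {(x, h x) | x. x \<in> F}"
      using hi[of x] subfield_inverse[OF F, of x] by auto
  next
    fix u assume "(0, u) \<in> {(x, h x) | x. x \<in> F}"
    then show "u = 0" using h0 by auto
  qed
qed

lemma complex_embeddings_field_graph:
  assumes "field_graph (Id_on F)" "h \<in> complex_embeddings F"
  shows "field_graph {(x, h x) | x. x \<in> F}"
  using assms field_graph_hom by (auto simp: complex_embeddings_def)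

lemma field_graph_complex_embedding:
  fixes R :: "'a::field set"
  assumes G: "field_graph G" and R: "R \<subseteq> Domain G" "1 \<in> R"
    "\<And>x y. x \<in> R \<Longrightarrow> y \<in> R \<Longrightarrow> x + y \<in> R \<and> x * y \<in> R"
    and h: "\<And>x. x \<in> R \<Longrightarrow> (x, h x) \<in> G"
  shows "h \<in> complex_embeddings R"
  unfolding complex_embeddings_def
proof (intro CollectI conjI ring_hom_memI)
  fix x y assume "x \<in> carrier (ring_on R)" "y \<in> carrier (ring_on R)"
  then have xy: "x \<in> R" "y \<in> R" by auto
  show "h (x \<otimes>\<^bsub>ring_on R\<^esub> y) = h x \<otimes>\<^bsub>ring_on UNIV\<^esub> h y"
    using field_graph_mult[OF G h[OF xy(1)] h[OF xy(2)]] h[of "x * y"] R(3)[OF xy]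
      field_graph_right_unique[OF G] by auto
  show "h (x \<oplus>\<^bsub>ring_on R\<^esub> y) = h x \<oplus>\<^bsub>ring_on UNIV\<^esub> h y"
    using field_graph_add[OF G h[OF xy(1)] h[OF xy(2)]] h[of "x + y"] R(3)[OF xy]
      field_graph_right_unique[OF G] by auto
next
  show "h \<one>\<^bsub>ring_on R\<^esub> = \<one>\<^bsub>ring_on UNIV\<^esub>"
    using h[OF R(2)] field_graph_1[OF G] field_graph_right_unique[OF G] by auto
next
  show "inj_on h R"
    using h field_graph_right_unique[OF field_graph_converse[OF G]] by (intro inj_onI) (metis converseI)
qed auto


section \<open>Complex embeddings and relative norms\<close>

lemma alg_closed_type_class: "alg_closed_type TYPE('a::alg_closed_field)"
  unfolding alg_closed_type_def using alg_closed_imp_poly_has_root by blast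

lemma poly_prod_list_linear_0: "poly (\<Prod>w\<leftarrow>ws. [:- w, 1:]) 0 = (\<Prod>w\<leftarrow>ws. - w :: 'a::comm_ring_1)"
  by (induction ws) auto

lemma field_graph_relcomp:
  assumes "field_graph G" "field_graph M"
  shows "field_graph (G O M)"
  unfolding field_graph_def
proof (intro conjI allI impI)
  show "(1, 1) \<in> G O M"
    using field_graph_1[OF assms(1)] field_graph_1[OF assms(2)] by blast
next
  fix x u y w assume "(x, u) \<in> G O M" "(y, w) \<in> G O M"
  then obtain a b where *: "(x, a) \<in> G" "(a, u) \<in> M" "(y, b) \<in> G" "(b, w) \<in> M" by blast
  show "(x - y, u - w) \<in> G O M"
    using field_graph_diff[OF assms(1) *(1,3)] field_graph_diff[OF assms(2) *(2,4)] by blast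
  show "(x * y, u * w) \<in> G O M"
    using field_graph_mult[OF assms(1) *(1,3)] field_graph_mult[OF assms(2) *(2,4)] by blast
next
  fix x u assume "(x, u) \<in> G O M"
  then obtain a where *: "(x, a) \<in> G" "(a, u) \<in> M" by blast
  show "(inverse x, inverse u) \<in> G O M"
    using field_graph_inverse[OF assms(1) *(1)] field_graph_inverse[OF assms(2) *(2)] by blast
next
  fix u assume "(0, u) \<in> G O M"
  then show "u = 0"
    using field_graph_zeroD[OF assms(1)] field_graph_zeroD[OF assms(2)] by blast
qed

text \<open>\<open>extensional F\<close> fixes the values outside \<open>F\<close>, so that every
  embedding of \<open>F\<close> is counted exactly once.\<close>

definition field_embeddings :: "'a::field set \<Rightarrow> ('a \<Rightarrow> complex) set" where
  "field_embeddings F = complex_embeddings F \<inter> extensional F"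

lemma field_embeddings_complex: "h \<in> field_embeddings F \<Longrightarrow> h \<in> complex_embeddings F"
  by (simp add: field_embeddings_def)

lemma restrict_field_embedding:
  assumes "h \<in> complex_embeddings F" and F: "field_graph (Id_on F)"
  shows "restrict h F \<in> field_embeddings F"
proof -
  note G = complex_embeddings_field_graph[OF F assms(1)]
  have "restrict h F \<in> complex_embeddings F"
    by (rule field_graph_complex_embedding[OF G])
       (auto simp: Domain_iff subfield_1[OF F] subfield_add[OF F] subfield_mult[OF F])
  then show ?thesis
    by (simp add: field_embeddings_def)
qed

text \<open>An embedding is determined by its values on a list that spans \<open>F\<close> over the
  rationals, and each of these values is a root of a fixed integer polynomial.\<close>

lemma finite_field_embeddings:
  fixes F :: "'a::field_char_0 set"
  assumes nf: "number_field F"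
  shows "finite (field_embeddings F)"
proof -
  note F = number_field_field_graph[OF nf]
  obtain Us where Us: "set Us \<subseteq> F"
    "\<forall>z\<in>F. \<exists>q. (\<forall>i. q i \<in> \<rat>) \<and> z = (\<Sum>i<length Us. q i * Us ! i)"
    by (rule number_field_basis[OF nf])
  have "\<forall>u\<in>set Us. \<exists>p :: int poly. p \<noteq> 0 \<and> poly (map_poly of_int p) u = 0"
    using Us(1) number_field_algebraic[OF nf] algebraicE' by (metis subsetD)
  then obtain p :: "'a \<Rightarrow> int poly" where
    p: "\<And>u. u \<in> set Us \<Longrightarrow> p u \<noteq> 0" "\<And>u. u \<in> set Us \<Longrightarrow> poly (map_poly of_int (p u)) u = 0"
    by metis
  define S where "S = (\<Pi>\<^sub>E u\<in>set Us. {w :: complex. poly (map_poly of_int (p u)) w = 0})"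
  have "finite S"
    unfolding S_def
  proof (rule finite_PiE)
    fix u assume "u \<in> set Us"
    then have "map_poly of_int (p u) \<noteq> (0 :: complex poly)"
      using p(1)[of u] by (auto simp: poly_eq_iff coeff_map_poly)
    then show "finite {w :: complex. poly (map_poly of_int (p u)) w = 0}"
      by (rule poly_roots_finite)
  qed simp
  moreover have "(\<lambda>h. restrict h (set Us)) ` field_embeddings F \<subseteq> S"
  proof (rule image_subsetI)
    fix h assume "h \<in> field_embeddings F"
    then have G: "field_graph {(x, h x) | x. x \<in> F}"
      using complex_embeddings_field_graph[OF F] field_embeddings_complex by blast
    have "poly (map_poly of_int (p u)) (h u) = 0" if u: "u \<in> set Us" for u
    proof -
      have "(u, h u) \<in> {(x, h x) | x. x \<in> F}"
        using u Us(1) by blast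
      from graph_poly_eval[OF G field_graph_of_int_poly[OF G] this, of "p u"]
      show ?thesis using p(2)[OF u] field_graph_zeroD[OF G] by simp
    qed
    then show "restrict h (set Us) \<in> S" by (auto simp: S_def)
  qed
  moreover have "inj_on (\<lambda>h. restrict h (set Us)) (field_embeddings F)"
  proof (rule inj_onI)
    fix h g assume h: "h \<in> field_embeddings F" and g: "g \<in> field_embeddings F"
      and eq: "restrict h (set Us) = restrict g (set Us)"
    have sum: "f z = (\<Sum>i<length Us. f (q i) * f (Us ! i))"
      if f: "f \<in> field_embeddings F" and q: "\<forall>i. q i \<in> \<rat>" and z: "z = (\<Sum>i<length Us. q i * Us ! i)"
      for f q z
    proof -
      have G: "field_graph {(x, f x) | x. x \<in> F}"
        using f complex_embeddings_field_graph[OF F] field_embeddings_complex by blast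
      have "(z, \<Sum>i<length Us. f (q i) * f (Us ! i)) \<in> {(x, f x) | x. x \<in> F}"
        unfolding z
      proof (rule field_graph_sum[OF G], rule field_graph_mult[OF G])
        fix i assume "i \<in> {..<length Us}"
        then have "Us ! i \<in> F" using Us(1) by auto
        then show "(Us ! i, f (Us ! i)) \<in> {(x, f x) | x. x \<in> F}" by blast
        show "(q i, f (q i)) \<in> {(x, f x) | x. x \<in> F}"
          using q subfield_Rats[OF F] by blast
      qed
      then show ?thesis by simp
    qed
    have rat: "h r = g r" if r: "r \<in> \<rat>" for r
    proof -
      from r obtain a b where ab: "r = of_int a / of_int b" by (auto elim: Rats_cases')
      have "f r = of_int a / of_int b" if "f \<in> field_embeddings F" for f
      proof -
        have G: "field_graph {(x, f x) | x. x \<in> F}"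
          using that complex_embeddings_field_graph[OF F] field_embeddings_complex by blast
        have "(r, of_int a / of_int b) \<in> {(x, f x) | x. x \<in> F}"
          unfolding ab by (intro field_graph_divide[OF G] field_graph_of_int[OF G])
        then show ?thesis by simp
      qed
      from this[OF h] this[OF g] show ?thesis by simp
    qed
    show "h = g"
    proof (rule extensionalityI)
      show "h \<in> extensional F" "g \<in> extensional F"
        using h g by (auto simp: field_embeddings_def)
      fix z assume "z \<in> F"
      then obtain q where q: "\<forall>i. q i \<in> \<rat>" "z = (\<Sum>i<length Us. q i * Us ! i)"
        using Us(2) by blast
      have "h (Us ! i) = g (Us ! i)" if "i < length Us" for i
        using eq that by (metis nth_mem restrict_apply')
      then show "h z = g z"
        unfolding sum[OF h q] sum[OF g q] using q(1) rat by (auto intro!: sum.cong)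
    qed
  qed
  ultimately show ?thesis
    by (metis finite_imageD finite_subset)
qed

text \<open>
  The product of the conjugates is fixed by every embedding of its algebraic closure, so all roots of
  its minimal polynomial coincide with it.
\<close>

lemma norm_prod_embeddings_ge_1:
  fixes F :: "'a::field_char_0 set"
  assumes nf: "number_field F" and z: "z \<in> ring_of_integers F" "z \<noteq> 0"
  shows "(\<Prod>h\<in>field_embeddings F. norm (h z)) \<ge> 1"
proof -
  note F = number_field_field_graph[OF nf]
  define H where "H = field_embeddings F"
  have finH: "finite H" unfolding H_def by (rule finite_field_embeddings[OF nf])
  have zF: "z \<in> F" "algebraic_int z"
    using z(1) by (auto simp: ring_of_integers_def alg_ints_def)
  have graph: "field_graph {(x, h x) | x. x \<in> F}" if "h \<in> H" for h
    using that complex_embeddings_field_graph[OF F] field_embeddings_complex by (auto simp: H_def)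
  have hz: "algebraic_int (h z)" "h z \<noteq> 0" if "h \<in> H" for h
  proof -
    have "(z, h z) \<in> {(x, h x) | x. x \<in> F}" using zF by blast
    then show "algebraic_int (h z)" "h z \<noteq> 0"
      using algebraic_int_field_graph[OF graph[OF that]] field_graph_zero_iff[OF graph[OF that]] zF z(2)
      by blast+
  qed
  define P where "P = (\<Prod>h\<in>H. h z)"
  have P: "algebraic_int P" "P \<noteq> 0"
    using hz finH by (auto simp: P_def intro!: algebraic_int_prod)
  obtain p :: "int poly" where p: "p \<noteq> 0" "poly (map_poly of_int p) P = 0"
    using P(1) algebraicE' by blast
  have "map_poly of_int p \<noteq> (0 :: complex poly)"
    using p(1) by (auto simp: poly_eq_iff coeff_map_poly)
  then obtain m m' where m: "min_graph_poly (Id_on \<rat>) P m m'"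
    using min_graph_poly_exists[OF field_graph_of_int_poly[OF field_graph_Rats] _ p(2)] by metis
  have [simp]: "m' = m"
    using m by (auto simp: min_graph_poly_def graph_poly_def poly_eq_iff)
  have m0: "m \<noteq> 0" and mQ: "\<And>i. Polynomial.coeff m i \<in> \<rat>"
    using m by (auto simp: min_graph_poly_def graph_poly_def)
  have root: "w = P" if w: "poly m w = 0" for w
  proof -
    obtain M where M: "field_graph M" "Id_on \<rat> \<subseteq> M" "(P, w) \<in> M"
      "Collect algebraic \<subseteq> Domain M"
    proof (rule field_graph_extend[OF field_graph_Rats alg_closed_type_class m])
      show "poly m' w = 0" using w by simp
    qed
    define \<tau> where "\<tau> = the_image M"
    \<comment> \<open>\<open>M\<close> prolongs the map that sends \<open>P\<close> to
      \<open>w\<close>. Composing embeddings of \<open>F\<close> with it permutes the finite set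
      \<open>H\<close>, so it fixes the product \<open>P\<close>.\<close>
    define T where "T = (\<lambda>h. restrict (\<lambda>x. \<tau> (h x)) F)"
    have \<tau>: "(h x, \<tau> (h x)) \<in> M" if "h \<in> H" "x \<in> F" for h x
    proof -
      have "(x, h x) \<in> {(x, h x) | x. x \<in> F}" using that(2) by blast
      then have "algebraic (h x)"
        using algebraic_field_graph[OF graph[OF that(1)]] number_field_algebraic[OF nf that(2)] by blast
      then show ?thesis
        unfolding \<tau>_def using M(4) by (intro the_image_in M(1)) blast
    qed
    have "T ` H \<subseteq> H"
    proof (rule image_subsetI)
      fix h assume h: "h \<in> H"
      have G: "field_graph ({(x, h x) | x. x \<in> F} O M)"
        by (rule field_graph_relcomp[OF graph[OF h] M(1)])
      have in_G: "(x, T h x) \<in> {(x, h x) | x. x \<in> F} O M" if "x \<in> F" for x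
        using \<tau>[OF h that] that by (auto simp: T_def)
      have "F \<subseteq> Domain ({(x, h x) | x. x \<in> F} O M)"
        by (rule subsetI) (rule DomainI[OF in_G])
      then have "T h \<in> complex_embeddings F"
        by (rule field_graph_complex_embedding[OF G _ subfield_1[OF F] _ in_G])
           (simp add: subfield_add[OF F] subfield_mult[OF F])
      then show "T h \<in> H"
        by (simp add: H_def field_embeddings_def T_def)
    qed
    moreover have inj: "inj_on T H"
    proof (rule inj_onI)
      fix h g assume h: "h \<in> H" and g: "g \<in> H" and eq: "T h = T g"
      show "h = g"
      proof (rule extensionalityI)
        show "h \<in> extensional F" "g \<in> extensional F"
          using h g by (auto simp: H_def field_embeddings_def)
        fix x assume x: "x \<in> F"
        have "T h x = T g x" using eq by simp
        then have "\<tau> (h x) = \<tau> (g x)" using x by (simp add: T_def)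
        then have "(\<tau> (h x), h x) \<in> M\<inverse>" "(\<tau> (h x), g x) \<in> M\<inverse>"
          using \<tau>[OF h x] \<tau>[OF g x] by auto
        then show "h x = g x"
          by (rule field_graph_right_unique[OF field_graph_converse[OF M(1)]])
      qed
    qed
    ultimately have bij: "bij_betw T H H"
      using endo_inj_surj[OF finH] by (simp add: bij_betw_def)
    have "(P, \<Prod>h\<in>H. \<tau> (h z)) \<in> M"
      unfolding P_def by (intro field_graph_prod[OF M(1)] \<tau> zF)
    moreover have "(\<Prod>h\<in>H. \<tau> (h z)) = (\<Prod>h\<in>H. T h z)"
      using zF by (simp add: T_def)
    moreover have "(\<Prod>h\<in>H. T h z) = P"
      unfolding P_def by (rule prod.reindex_bij_betw[OF bij])
    ultimately show ?thesis
      using M(1,3) field_graph_right_unique by metis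
  qed
  obtain ws where ws: "length ws = Polynomial.degree m"
    "m = Polynomial.smult (Polynomial.lead_coeff m) (\<Prod>w\<leftarrow>ws. [:- w, 1:])"
    by (rule poly_splits[OF alg_closed_type_class m0])
  define d where "d = Polynomial.degree m"
  have "w = P" if "w \<in> set ws" for w
  proof (rule root)
    have "poly (\<Prod>w\<leftarrow>ws. [:- w, 1:]) w = 0"
      using that by (auto simp: poly_prod_list prod_list_zero_iff)
    then show "poly m w = 0" by (subst ws(2)) simp
  qed
  \<comment> \<open>As all roots equal \<open>P\<close>, the quotient of constant and leading
    coefficient shows that a power of \<open>- P\<close> is rational. This is enough, since only the
    size of \<open>P\<close> matters.\<close>
  then have "ws = replicate d P"
    using ws(1) by (metis d_def replicate_eqI)
  then have "(\<Prod>w\<leftarrow>ws. - w) = (- P) ^ d"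
    by simp
  then have "poly m 0 = Polynomial.lead_coeff m * (- P) ^ d"
    by (subst ws(2)) (simp only: poly_smult poly_prod_list_linear_0)
  then have "(- P) ^ d = Polynomial.coeff m 0 / Polynomial.lead_coeff m"
    using m0 by (simp add: poly_0_coeff_0)
  also have "\<dots> \<in> \<rat>" using mQ by simp
  finally have "(- P) ^ d \<in> \<int>"
    by (rule rational_algebraic_int_is_int[rotated]) (intro algebraic_int_power algebraic_int_minus P)
  then obtain k where k: "(- P) ^ d = of_int k" by (auto elim: Ints_cases)
  with P have "k \<noteq> 0" by auto
  have "norm P ^ d = \<bar>of_int k\<bar>"
    using arg_cong[OF k, of norm] by (simp add: norm_power)
  also have "\<dots> \<ge> 1" using \<open>k \<noteq> 0\<close> by linarith
  finally have "norm P ^ d \<ge> 1" .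
  moreover have "d > 0"
    using min_graph_poly_degree_pos[OF m] by (simp add: d_def)
  ultimately have "norm P \<ge> 1"
    by (metis norm_ge_zero not_le power_less_one_iff)
  then show ?thesis
    by (simp add: P_def H_def prod_norm)
qed

text \<open>
  The constant coefficient of a minimal polynomial of \<open>y\<close> is, up to sign, the relative norm of \<open>y\<close>;
  under an embedding it becomes the product of the images of \<open>y\<close> under the extensions of this embedding.
\<close>

lemma relative_norm_conjugates:
  fixes G :: "('a::field_char_0 \<times> 'b::field) set"
  assumes G: "field_graph G" "Domain G = F" and ac: "alg_closed_type TYPE('b)"
    and m: "min_graph_poly (Id_on F) y m m"
    and u: "(poly m 0 / Polynomial.lead_coeff m, u) \<in> G"
  obtains ws where "length ws = Polynomial.degree m" "u = (\<Prod>w\<leftarrow>ws. - w)"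
    "\<And>w. w \<in> set ws \<Longrightarrow> \<exists>M. field_graph M \<and> G \<subseteq> M \<and> (y, w) \<in> M \<and> Collect algebraic \<subseteq> Domain M"
proof -
  define m' where "m' = map_poly (the_image G) m"
  have g0: "the_image G 0 = 0"
    by (rule the_image_eq[OF G(1) field_graph_0[OF G(1)]])
  have mF: "Polynomial.coeff m i \<in> F" for i
    using m by (auto simp: min_graph_poly_def graph_poly_def)
  have gp: "graph_poly G m m'"
    using the_image_in[OF G(1)] mF G(2) by (auto simp: graph_poly_def m'_def coeff_map_poly g0)
  \<comment> \<open>The domain of \<open>G\<close> is \<open>F\<close>, so minimality over
    \<open>F\<close> is minimality over \<open>G\<close>.\<close>
  have min: "min_graph_poly G y m m'"
    unfolding min_graph_poly_def
  proof (intro conjI allI impI)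
    fix p q assume pq: "graph_poly G p q" "p \<noteq> 0" "poly p y = 0"
    then have "graph_poly (Id_on F) p p"
      using G(2) by (auto simp: graph_poly_def Id_on_def Domain_iff)
    with pq m show "Polynomial.degree m \<le> Polynomial.degree p"
      unfolding min_graph_poly_def by blast
  qed (use gp m in \<open>auto simp: min_graph_poly_def\<close>)
  have m'0: "m' \<noteq> 0"
    using graph_poly_eq_0_iff[OF G(1) gp] m by (auto simp: min_graph_poly_def)
  obtain ws where ws: "length ws = Polynomial.degree m'"
    "m' = Polynomial.smult (Polynomial.lead_coeff m') (\<Prod>w\<leftarrow>ws. [:- w, 1:])"
    by (rule poly_splits[OF ac m'0])
  have deg: "Polynomial.degree m = Polynomial.degree m'"
    by (rule graph_poly_degree[OF G(1) gp])
  have "poly m' 0 = Polynomial.lead_coeff m' * (\<Prod>w\<leftarrow>ws. - w)"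
    by (subst ws(2)) (simp only: poly_smult poly_prod_list_linear_0)
  moreover have "(poly m 0 / Polynomial.lead_coeff m, poly m' 0 / Polynomial.lead_coeff m') \<in> G"
    using gp deg
    by (intro field_graph_divide[OF G(1)] graph_poly_eval[OF G(1) gp] field_graph_0[OF G(1)])
       (auto simp: graph_poly_def)
  ultimately have "u = (\<Prod>w\<leftarrow>ws. - w)"
    using field_graph_right_unique[OF G(1) u] m'0 by fastforce
  moreover have "\<exists>M. field_graph M \<and> G \<subseteq> M \<and> (y, w) \<in> M \<and> Collect algebraic \<subseteq> Domain M"
    if "w \<in> set ws" for w
  proof -
    have "poly (\<Prod>w\<leftarrow>ws. [:- w, 1:]) w = 0"
      using that by (auto simp: poly_prod_list prod_list_zero_iff)
    then have "poly m' w = 0" by (subst ws(2)) simp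
    from field_graph_extend[OF G(1) ac min this] show ?thesis by metis
  qed
  ultimately show ?thesis using ws(1) deg by (intro that[of ws]) simp_all
qed


section \<open>Finite places\<close>

context
  fixes F :: "'a::field set" and v :: "'a \<Rightarrow> real"
  assumes F: "field_graph (Id_on F)" and v: "nonarch_abs_on F v"
begin

lemma
  assumes "x \<in> F"
  shows nonarch_ge_0: "v x \<ge> 0" and nonarch_eq_0_iff: "v x = 0 \<longleftrightarrow> x = 0"
    and nonarch_mult: "y \<in> F \<Longrightarrow> v (x * y) = v x * v y"
    and nonarch_add: "y \<in> F \<Longrightarrow> v (x + y) \<le> max (v x) (v y)"
  using v assms unfolding nonarch_abs_on_def by blast+

lemma nonarch_0: "v 0 = 0"
  using nonarch_eq_0_iff[OF subfield_0[OF F]] by simp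

lemma nonarch_gt_0: "x \<in> F \<Longrightarrow> x \<noteq> 0 \<Longrightarrow> v x > 0"
  using nonarch_ge_0 nonarch_eq_0_iff by (metis less_eq_real_def)

lemma nonarch_1: "v 1 = 1"
proof -
  have "v 1 * v 1 = v 1 * 1"
    using nonarch_mult[OF subfield_1[OF F] subfield_1[OF F]] by simp
  moreover have "v 1 \<noteq> 0"
    using nonarch_eq_0_iff[OF subfield_1[OF F]] by simp
  ultimately show ?thesis by simp
qed

lemma nonarch_uminus: "x \<in> F \<Longrightarrow> v (- x) = v x"
proof -
  assume x: "x \<in> F"
  have m1: "- 1 \<in> F" using subfield_uminus[OF F subfield_1[OF F]] .
  have "v (- 1) * v (- 1) = 1"
    using nonarch_mult[OF m1 m1] nonarch_1 by simp
  then have "v (- 1) = 1"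
    using nonarch_ge_0[OF m1] by (metis abs_of_nonneg real_sqrt_abs2 real_sqrt_one)
  then show ?thesis
    using nonarch_mult[OF m1 x] by simp
qed

lemma nonarch_diff: "x \<in> F \<Longrightarrow> y \<in> F \<Longrightarrow> v (x - y) \<le> max (v x) (v y)"
  using nonarch_add[of x "- y"] nonarch_uminus[of y] subfield_uminus[OF F, of y] by simp

lemma nonarch_power: "x \<in> F \<Longrightarrow> v (x ^ n) = v x ^ n"
  by (induction n) (auto simp: nonarch_1 nonarch_mult subfield_power[OF F])

lemma nonarch_inverse: "x \<in> F \<Longrightarrow> v (inverse x) = inverse (v x)"
proof (cases "x = 0")
  case False
  assume x: "x \<in> F"
  then have "v x * v (inverse x) = 1"
    using nonarch_mult[OF x subfield_inverse[OF F x]] False nonarch_1 by simp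
  then show ?thesis by (metis inverse_unique)
qed (simp add: nonarch_0)

lemma nonarch_divide: "x \<in> F \<Longrightarrow> y \<in> F \<Longrightarrow> v (x / y) = v x / v y"
  using nonarch_mult[of x "inverse y"] nonarch_inverse[of y] subfield_inverse[OF F, of y]
  by (simp add: divide_inverse)

lemma nonarch_sum_le:
  assumes "\<And>i. i \<in> A \<Longrightarrow> f i \<in> F \<and> v (f i) \<le> c" "c \<ge> 0"
  shows "v (sum f A) \<le> c"
  using assms(1)
proof (induction A rule: infinite_finite_induct)
  case (insert i A)
  have "v (f i + sum f A) \<le> max (v (f i)) (v (sum f A))"
    using insert.prems by (intro nonarch_add subfield_sum[OF F]) auto
  also have "\<dots> \<le> c"
    using insert.IH insert.prems[of i] insert.prems by simp
  finally show ?case using insert.hyps by simp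
qed (use assms(2) in \<open>auto simp: nonarch_0\<close>)

lemma nonarch_sum_less:
  assumes "\<And>i. i \<in> A \<Longrightarrow> f i \<in> F \<and> v (f i) < c" "c > 0"
  shows "v (sum f A) < c"
  using assms(1)
proof (induction A rule: infinite_finite_induct)
  case (insert i A)
  have "v (f i + sum f A) \<le> max (v (f i)) (v (sum f A))"
    using insert.prems by (intro nonarch_add subfield_sum[OF F]) auto
  also have "\<dots> < c"
    using insert.IH insert.prems[of i] insert.prems by simp
  finally show ?case using insert.hyps by simp
qed (use assms(2) in \<open>auto simp: nonarch_0\<close>)

lemma nonarch_prod: "(\<And>i. i \<in> A \<Longrightarrow> f i \<in> F) \<Longrightarrow> v (prod f A) = (\<Prod>i\<in>A. v (f i))"
  by (induction A rule: infinite_finite_induct) (auto simp: nonarch_1 nonarch_mult subfield_prod[OF F])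

lemma nonarch_of_nat_le_1: "v (of_nat n) \<le> 1"
proof (induction n)
  case (Suc n)
  have "v (1 + of_nat n) \<le> max (v 1) (v (of_nat n))"
    by (rule nonarch_add[OF subfield_1[OF F] subfield_of_nat[OF F]])
  with Suc nonarch_1 show ?case by simp
qed (simp add: nonarch_0)

lemma nonarch_of_int_le_1: "v (of_int k) \<le> 1"
proof (cases k)
  case (nonneg n)
  then show ?thesis using nonarch_of_nat_le_1 by simp
next
  case (neg n)
  then show ?thesis
    using nonarch_of_nat_le_1[of "Suc n"] nonarch_uminus[OF subfield_of_nat[OF F, of "Suc n"]]
    by (simp del: of_nat_Suc)
qed

lemma nonarch_add_eq:
  assumes "x \<in> F" "y \<in> F" "v x < v y"
  shows "v (x + y) = v y"
proof (rule antisym)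
  show "v (x + y) \<le> v y"
    using nonarch_add[OF assms(1,2)] assms(3) by simp
  have "v (x + y - x) \<le> max (v (x + y)) (v x)"
    using assms by (intro nonarch_diff subfield_add[OF F])
  with assms(3) show "v y \<le> v (x + y)" by (simp add: max_def split: if_splits)
qed

text \<open>By Bezout 1 is an integral combination of \<open>p\<close> and \<open>k\<close>; the
  summand with \<open>p\<close> has value less than 1, so the one with \<open>k\<close> must reach
  1.\<close>

lemma nonarch_of_int_prime:
  assumes p: "Factorial_Ring.prime p" "v (of_nat p) = 1 / real p" and k: "\<not> int p dvd k"
  shows "v (of_int k) = 1"
proof -
  have "Rings.coprime (int p) k"
    using p(1) k by (intro prime_imp_coprime) auto
  then obtain a b where ab: "a * int p + b * k = 1"
    using bezout_int[of "int p" k] by auto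
  then have "(1::'a) = of_int a * of_nat p + of_int b * of_int k"
    by (metis of_int_1 of_int_add of_int_mult of_int_of_nat_eq)
  then have "v 1 \<le> max (v (of_int a * of_nat p)) (v (of_int b * of_int k))"
    using nonarch_add[of "of_int a * of_nat p" "of_int b * of_int k"]
      subfield_mult[OF F] subfield_of_int[OF F] subfield_of_nat[OF F] by simp
  also have "v (of_int a * of_nat p) = v (of_int a) * (1 / real p)"
    using p(2) by (simp add: nonarch_mult subfield_of_int[OF F] subfield_of_nat[OF F])
  also have "v (of_int b * of_int k) = v (of_int b) * v (of_int k)"
    by (simp add: nonarch_mult subfield_of_int[OF F])
  finally have "1 \<le> v (of_int a) * (1 / real p) \<or> 1 \<le> v (of_int b) * v (of_int k)"
    unfolding nonarch_1 by linarith
  moreover have "v (of_int a) * (1 / real p) \<le> 1 * (1 / real p)"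
    by (intro mult_right_mono nonarch_of_int_le_1) simp
  moreover have "1 / real p < 1"
    using prime_gt_1_nat[OF p(1)] by simp
  moreover have "v (of_int b) * v (of_int k) \<le> 1 * v (of_int k)"
    by (intro mult_right_mono nonarch_of_int_le_1 nonarch_ge_0 subfield_of_int[OF F])
  ultimately have "v (of_int k) \<ge> 1" by linarith
  with nonarch_of_int_le_1[of k] show ?thesis by simp
qed

lemma nonarch_of_int_value:
  assumes p: "Factorial_Ring.prime p" "v (of_nat p) = 1 / real p" and k: "k \<noteq> 0"
  obtains n where "v (of_int k) = (1 / real p) ^ n" "int p ^ n dvd k"
proof -
  have "\<not> is_unit (int p)"
    using prime_gt_1_nat[OF p(1)] by auto
  define n where "n = multiplicity (int p) k"
  obtain m where m: "k = int p ^ n * m" "\<not> int p dvd m"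
    unfolding n_def by (rule multiplicity_decompose'[OF k \<open>\<not> is_unit (int p)\<close>])
  have "(of_int k :: 'a) = of_nat p ^ n * of_int m"
    unfolding m(1) by simp
  then have "v (of_int k) = (1 / real p) ^ n"
    using nonarch_of_int_prime[OF p m(2)] p(2)
    by (simp add: nonarch_mult nonarch_power subfield_power[OF F] subfield_of_nat[OF F] subfield_of_int[OF F])
  moreover have "int p ^ n dvd k"
    unfolding n_def by (rule multiplicity_dvd)
  ultimately show ?thesis by (rule that)
qed

text \<open>A nonzero integer divisible by \<open>p ^ n\<close> has size at least
  \<open>p ^ n\<close>. In the counting of residue classes this keeps differences of digits from
  being small at the place.\<close>

lemma nonarch_of_int_ge:
  assumes p: "Factorial_Ring.prime p" "v (of_nat p) = 1 / real p" and k: "k \<noteq> 0"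
  shows "v (of_int k) \<ge> 1 / of_int \<bar>k\<bar>"
proof -
  obtain n where n: "v (of_int k) = (1 / real p) ^ n" "int p ^ n dvd k"
    by (rule nonarch_of_int_value[OF p k])
  have "int p ^ n \<le> \<bar>k\<bar>"
    using dvd_imp_le_int[OF k n(2)] by simp
  then have "real p ^ n \<le> of_int \<bar>k\<bar>"
    by (metis of_int_le_iff of_int_of_nat_eq of_int_power)
  moreover have "real p ^ n > 0"
    using prime_gt_0_nat[OF p(1)] by simp
  ultimately have "1 / of_int \<bar>k\<bar> \<le> 1 / real p ^ n"
    by (rule frac_le[OF zero_le_one order_refl, rotated])
  then show ?thesis
    by (simp only: n(1) power_one_over)
qed

lemma nonarch_prime_unique:
  assumes p: "Factorial_Ring.prime p" "v (of_nat p) = 1 / real p"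
    and q: "Factorial_Ring.prime q" "q \<noteq> p"
  shows "v (of_nat q) = 1"
proof -
  have "\<not> p dvd q"
    using primes_dvd_imp_eq[OF p(1) q(1)] q(2) by auto
  then have "\<not> int p dvd int q"
    by (simp add: int_dvd_int_iff)
  from nonarch_of_int_prime[OF p this] show ?thesis by simp
qed

end

text \<open>If \<open>v x > 1\<close>, the top power in an integral equation would exceed all other
  terms.\<close>

lemma algebraic_int_nonarch_le_1:
  fixes F :: "'a::field_char_0 set"
  assumes F: "field_graph (Id_on F)" and v: "nonarch_abs_on F v" and x: "x \<in> F" "algebraic_int x"
  shows "v x \<le> 1"
proof (rule ccontr)
  assume "\<not> v x \<le> 1"
  then have v1: "v x > 1" by simp
  obtain m c where m: "m > 0" "x ^ m = (\<Sum>i<m. of_int (c i) * x ^ i)"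
    using x(2) by (rule algebraic_int_top_power)
  have "v (\<Sum>i<m. of_int (c i) * x ^ i) \<le> v x ^ (m - 1)"
  proof (rule nonarch_sum_le[OF F v])
    fix i assume "i \<in> {..<m}"
    then have "i \<le> m - 1" by auto
    have "v (of_int (c i) * x ^ i) = v (of_int (c i)) * v x ^ i"
      by (simp add: nonarch_mult[OF F v] nonarch_power[OF F v] x subfield_of_int[OF F] subfield_power[OF F])
    also have "\<dots> \<le> 1 * v x ^ i"
      using v1 by (intro mult_right_mono nonarch_of_int_le_1[OF F v]) auto
    also have "\<dots> \<le> v x ^ (m - 1)"
      using v1 \<open>i \<le> m - 1\<close> by (simp add: power_increasing)
    finally show "of_int (c i) * x ^ i \<in> F \<and> v (of_int (c i) * x ^ i) \<le> v x ^ (m - 1)"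
      by (simp add: subfield_mult[OF F] subfield_of_int[OF F] subfield_power[OF F] x)
  qed (use v1 in auto)
  then have "v x ^ m \<le> v x ^ (m - 1)"
    using m(2) nonarch_power[OF F v x(1), of m] by simp
  moreover have "v x ^ (m - 1) < v x ^ m"
    using v1 m(1) by (intro power_strict_increasing) auto
  ultimately show False by simp
qed

lemma ring_of_integers_D: "x \<in> ring_of_integers F \<Longrightarrow> x \<in> F" "x \<in> ring_of_integers F \<Longrightarrow> algebraic_int x"
  by (auto simp: ring_of_integers_def alg_ints_def)

lemma ring_of_integers_I: "x \<in> F \<Longrightarrow> algebraic_int x \<Longrightarrow> x \<in> ring_of_integers F"
  by (auto simp: ring_of_integers_def alg_ints_def)

lemma
  fixes F :: "'a::field_char_0 set"
  assumes F: "field_graph (Id_on F)"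
  shows roi_diff: "x \<in> ring_of_integers F \<Longrightarrow> y \<in> ring_of_integers F \<Longrightarrow> x - y \<in> ring_of_integers F"
    and roi_mult: "x \<in> ring_of_integers F \<Longrightarrow> y \<in> ring_of_integers F \<Longrightarrow> x * y \<in> ring_of_integers F"
    and roi_power: "x \<in> ring_of_integers F \<Longrightarrow> x ^ n \<in> ring_of_integers F"
    and roi_of_int: "of_int k \<in> ring_of_integers F"
    and roi_sum: "(\<And>i. i \<in> A \<Longrightarrow> f i \<in> ring_of_integers F) \<Longrightarrow> sum f A \<in> ring_of_integers F"
    and roi_prod: "(\<And>i. i \<in> A \<Longrightarrow> f i \<in> ring_of_integers F) \<Longrightarrow> prod f A \<in> ring_of_integers F"
  by (auto intro!: ring_of_integers_I subfield_diff[OF F] subfield_mult[OF F]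
      subfield_power[OF F] subfield_of_int[OF F] subfield_sum[OF F] subfield_prod[OF F]
      algebraic_int_diff algebraic_int_mult algebraic_int_power algebraic_int_sum
      algebraic_int_prod dest: ring_of_integers_D)

lemma finite_placesD:
  assumes "v \<in> finite_places F"
  shows "v \<in> extensional F" "nonarch_abs_on F v"
    "\<exists>p::nat. Factorial_Ring.prime p \<and> v (of_nat p) = 1 / of_nat p"
  using assms by (auto simp: finite_places_def)

text \<open>
  Among the partial sums of a primitive integral equation of \<open>z\<close> one is a \<open>v\<close>-adic unit: the ring of
  \<open>v\<close>-integral elements is a localization of the ring of integers.
\<close>

lemma valuation_ring_denominator:
  fixes F :: "'a::field_char_0 set"
  assumes F: "number_field F" and v: "v \<in> finite_places F" and z: "z \<in> F" "v z \<le> 1"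
  obtains b where "b \<in> ring_of_integers F" "v b = 1" "b * z \<in> ring_of_integers F"
proof -
  note F' = number_field_field_graph[OF F] and v' = finite_placesD(2)[OF v]
  obtain p :: nat where p: "Factorial_Ring.prime p" "v (of_nat p) = 1 / of_nat p"
    using finite_placesD(3)[OF v] by blast
  obtain f0 :: "int poly" where f0: "f0 \<noteq> 0" "poly (map_poly of_int f0) z = 0"
    using number_field_algebraic[OF F z(1)] by (rule algebraicE')
  \<comment> \<open>Primitivity supplies a coefficient that \<open>p\<close> does not divide, that
    is, one of value 1.\<close>
  define f where "f = primitive_part f0"
  have f_f0: "f0 = Polynomial.smult (content f0) f"
    by (simp add: f_def content_times_primitive_part)
  have "f \<noteq> 0" using f0(1) f_f0 by auto
  have cont: "content f = 1"
    unfolding f_def using f0(1) by (simp add: content_primitive_part)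
  define n where "n = Polynomial.degree f"
  define a where "a = Polynomial.coeff f"
  have "map_poly of_int f0 = Polynomial.smult (of_int (content f0)) (map_poly of_int f :: 'a poly)"
    by (subst f_f0) (simp add: poly_eq_iff coeff_map_poly)
  then have "poly (map_poly of_int f) z = 0"
    using f0 by simp
  moreover have deg: "Polynomial.degree (map_poly of_int f :: 'a poly) = n"
    unfolding n_def by (rule degree_map_poly) auto
  ultimately have root: "(\<Sum>i\<le>n. of_int (a i) * z ^ i) = 0"
    unfolding poly_altdef deg a_def by (simp only: coeff_map_poly of_int_0)
  \<comment> \<open>The partial sums of Horner's scheme: they satisfy
    \<open>b j = a j + z * b (Suc j)\<close>, are integral for \<open>j <= n\<close>, and vanish at
    both ends \<open>j = 0\<close> and \<open>j = Suc n\<close>.\<close>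
  define b where "b = (\<lambda>j. \<Sum>i=j..n. of_int (a i) * z ^ (i - j))"
  have bF: "b j \<in> F" for j
    unfolding b_def
    by (intro subfield_sum[OF F'] subfield_mult[OF F'] subfield_of_int[OF F'] subfield_power[OF F'] z)
  have bint: "b j \<in> ring_of_integers F" if "j \<le> n" for j
    using bF algebraic_int_partial_sum[OF root that] by (auto simp: b_def intro: ring_of_integers_I)
  have step: "b j = of_int (a j) + z * b (Suc j)" if "j \<le> n" for j
  proof -
    have "b j = of_int (a j) + (\<Sum>i=Suc j..n. of_int (a i) * z ^ (i - j))"
      unfolding b_def using that by (subst sum.atLeast_Suc_atMost) auto
    also have "(\<Sum>i=Suc j..n. of_int (a i) * z ^ (i - j)) = z * b (Suc j)"
      unfolding b_def sum_distrib_left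
    proof (rule sum.cong)
      fix i assume "i \<in> {Suc j..n}"
      then have "i - j = Suc (i - Suc j)" by auto
      then show "of_int (a i) * z ^ (i - j) = z * (of_int (a i) * z ^ (i - Suc j))"
        by (simp add: mult.left_commute)
    qed simp
    finally show ?thesis .
  qed
  have b_end: "b (Suc n) = 0" by (simp add: b_def)
  have b0: "b 0 = 0"
    using root by (simp add: b_def atLeast0AtMost)
  have "\<exists>i\<le>n. \<not> int p dvd a i"
  proof (rule ccontr)
    assume "\<not> ?thesis"
    then have "\<forall>i. int p dvd a i"
      by (metis a_def coeff_eq_0 dvd_0_right n_def not_le)
    then have "int p dvd content f"
      by (simp add: a_def const_poly_dvd_iff_dvd_content[symmetric] const_poly_dvd_iff)
    with cont prime_gt_1_nat[OF p(1)] show False by auto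
  qed
  then obtain i where i: "i \<le> n" "\<not> int p dvd a i" by blast
  have "\<exists>j\<le>n. v (b j) \<ge> 1"
  proof (rule ccontr)
    assume "\<not> ?thesis"
    then have small: "v (b j) < 1" if "j \<le> Suc n" for j
    proof (cases "j = Suc n")
      case True
      then show ?thesis using b_end nonarch_0[OF F' v'] by simp
    next
      case False
      then have "j \<le> n" using that by simp
      with \<open>\<not> (\<exists>j\<le>n. v (b j) \<ge> 1)\<close> show ?thesis by (meson not_le)
    qed
    \<comment> \<open>If all partial sums had value less than 1, so would all coefficients, because
      \<open>v z <= 1\<close>.\<close>
    have "of_int (a i) = b i - z * b (Suc i)"
      using step[OF i(1)] by simp
    then have "v (of_int (a i)) \<le> max (v (b i)) (v z * v (b (Suc i)))"
      using nonarch_diff[OF F' v' bF subfield_mult[OF F' z(1) bF], of i "Suc i"]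
        nonarch_mult[OF F' v' z(1) bF, of "Suc i"] by simp
    also have "v z * v (b (Suc i)) \<le> 1 * v (b (Suc i))"
      by (intro mult_right_mono z nonarch_ge_0[OF F' v'] bF)
    then have "max (v (b i)) (v z * v (b (Suc i))) < 1"
      using small[of i] small[of "Suc i"] i(1) by simp
    finally show False
      using nonarch_of_int_prime[OF F' v' p i(2)] by simp
  qed
  then obtain j where j: "j \<le> n" "v (b j) \<ge> 1" by blast
  then have "v (b j) = 1"
    using algebraic_int_nonarch_le_1[OF F' v'] ring_of_integers_D[OF bint[OF j(1)]] by fastforce
  moreover have "j \<noteq> 0"
    using j b0 nonarch_0[OF F' v'] by (metis not_one_le_zero)
  then obtain k where k: "j = Suc k" using not0_implies_Suc by blast
  \<comment> \<open>Read one index lower, the recursion shows that \<open>b j\<close>, of value 1,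
    is a denominator of \<open>z\<close>.\<close>
  have "b j * z = b k - of_int (a k)"
    using step[of k] j(1) k by (simp add: mult.commute)
  then have "b j * z \<in> ring_of_integers F"
    using roi_diff[OF F' bint roi_of_int[OF F']] j(1) k by simp
  ultimately show ?thesis using bint[OF j(1)] that by blast
qed

text \<open>It suffices to find \<open>q\<close> with \<open>v q < 1 < w q\<close>: a denominator
  \<open>b\<close> of \<open>q\<close> with \<open>v b = 1\<close> then satisfies
  \<open>w b < 1\<close>, since \<open>b * q\<close> is integral.\<close>

lemma finite_places_separate:
  fixes F :: "'a::field_char_0 set"
  assumes F: "number_field F" and v: "v \<in> finite_places F" and w: "w \<in> finite_places F" and "v \<noteq> w"
  obtains b where "b \<in> ring_of_integers F" "v b = 1" "w b < 1"
proof -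
  note F' = number_field_field_graph[OF F]
  note v' = finite_placesD(2)[OF v] and w' = finite_placesD(2)[OF w]
  obtain p :: nat where p: "Factorial_Ring.prime p" "v (of_nat p) = 1 / of_nat p"
    using finite_placesD(3)[OF v] by blast
  obtain p' :: nat where p': "Factorial_Ring.prime p'" "w (of_nat p') = 1 / of_nat p'"
    using finite_placesD(3)[OF w] by blast
  have p1: "real p > 1" "real p' > 1"
    using prime_gt_1_nat p(1) p'(1) by auto
  have "\<exists>q\<in>F. v q < 1 \<and> w q > 1"
  proof (cases "p = p'")
    case False
    \<comment> \<open>For distinct residue characteristics each prime has value 1 at the other
      place.\<close>
    have "of_nat p / of_nat p' \<in> F"
      by (intro subfield_divide[OF F'] subfield_of_nat[OF F'])
    moreover have "v (of_nat p / of_nat p') = 1 / real p"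
      using nonarch_prime_unique[OF F' v' p p'(1)] False p
      by (simp add: nonarch_divide[OF F' v'] subfield_of_nat[OF F'])
    moreover have "w (of_nat p / of_nat p') = real p'"
      using nonarch_prime_unique[OF F' w' p' p(1)] False p'
      by (simp add: nonarch_divide[OF F' w'] subfield_of_nat[OF F'])
    ultimately show ?thesis using p1 by (intro bexI[of _ "of_nat p / of_nat p'"]) auto
  next
    case True
    have "\<exists>z\<in>F. z \<noteq> 0 \<and> v z < w z"
    proof -
      obtain z where z: "z \<in> F" "v z \<noteq> w z"
        using \<open>v \<noteq> w\<close> finite_placesD(1)[OF v] finite_placesD(1)[OF w] extensionalityI by metis
      have "z \<noteq> 0"
        using z(2) nonarch_0[OF F' v'] nonarch_0[OF F' w'] by auto
      show ?thesis
      proof (cases "v z < w z")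
        case True
        then show ?thesis using z \<open>z \<noteq> 0\<close> by blast
      next
        case False
        then have "v (inverse z) < w (inverse z)"
          using z nonarch_gt_0[OF F' w' z(1) \<open>z \<noteq> 0\<close>]
          by (simp add: nonarch_inverse[OF F' v'] nonarch_inverse[OF F' w'])
        then show ?thesis using \<open>z \<noteq> 0\<close> subfield_inverse[OF F' z(1)] by (intro bexI) auto
      qed
    qed
    then obtain z where z: "z \<in> F" "z \<noteq> 0" "v z < w z" by blast
    have pos: "v z > 0" "w z > 0"
      using nonarch_gt_0[OF F' v' z(1,2)] nonarch_gt_0[OF F' w' z(1,2)] .
    have "log (real p) (v z) < log (real p) (w z)"
      using pos z(3) p1 by simp
    \<comment> \<open>With \<open>r = a / d\<close> strictly between the two logarithms, the values
      of \<open>z ^ d\<close> lie on either side of \<open>real p powr a\<close>; multiplication by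
      the \<open>a\<close>-th power of \<open>p\<close> moves this threshold to 1 at both
      places.\<close>
    then obtain r where r: "r \<in> \<rat>" "log (real p) (v z) < r" "r < log (real p) (w z)"
      using Rats_dense_in_real by blast
    from r(1) obtain a c where ac: "c > 0" "r = of_int a / of_int c" by (rule Rats_cases')
    define d where "d = nat c"
    have d: "d > 0" "r = of_int a / real d" using ac by (auto simp: d_def)
    define pa where "pa = (of_nat p powi a :: 'a)"
    have paF: "pa \<in> F"
      unfolding pa_def power_int_def
      by (simp add: subfield_power[OF F'] subfield_inverse[OF F'] subfield_of_nat[OF F'])
    have val: "u pa = real p powr (- of_int a)" if u: "nonarch_abs_on F u" "u (of_nat p) = 1 / real p" for u
    proof (cases "a \<ge> 0")
      case True
      then have "u pa = (1 / real p) ^ nat a"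
        by (simp add: pa_def power_int_def nonarch_power[OF F' u(1)] subfield_of_nat[OF F'] u(2))
      also have "\<dots> = real p powr (- of_int a)"
        using p1 True by (simp add: powr_minus_divide powr_realpow[symmetric] power_one_over)
      finally show ?thesis .
    next
      case False
      then have "u pa = inverse (1 / real p) ^ nat (- a)"
        by (simp add: pa_def power_int_def nonarch_power[OF F' u(1)] subfield_of_nat[OF F']
            subfield_inverse[OF F'] nonarch_inverse[OF F' u(1)] u(2))
      also have "\<dots> = real p powr (- of_int a)"
        using p1 False by (simp add: powr_realpow[symmetric])
      finally show ?thesis .
    qed
    define q where "q = z ^ d * pa"
    have "q \<in> F" unfolding q_def by (intro subfield_mult[OF F'] subfield_power[OF F'] z paF)
    have "v z < real p powr r"
      using r(2) pos p1 by (simp add: log_less_iff)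
    then have "v z ^ d < (real p powr r) ^ d"
      using pos d(1) by (intro power_strict_mono) auto
    also have "\<dots> = real p powr (r * d)"
      using p1 by (simp add: powr_powr powr_realpow[symmetric])
    also have "r * d = of_int a" using d by simp
    finally have 1: "v z ^ d < real p powr of_int a" .
    have "real p powr r < w z"
      using r(3) pos p1 by (simp add: less_log_iff)
    then have "(real p powr r) ^ d < w z ^ d"
      using pos d(1) by (intro power_strict_mono) auto
    moreover have "(real p powr r) ^ d = real p powr (r * d)"
      using p1 by (simp add: powr_powr powr_realpow[symmetric])
    moreover have "r * d = of_int a" using d by simp
    ultimately have 2: "real p powr of_int a < w z ^ d" by simp
    have "v q = v z ^ d * real p powr (- of_int a)"
      unfolding q_def using val[OF v' p(2)]
      by (simp add: nonarch_mult[OF F' v'] nonarch_power[OF F' v'] subfield_power[OF F'] z paF)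
    also have "\<dots> < 1"
      using 1 p1 by (simp add: powr_minus_divide divide_less_eq)
    finally have "v q < 1" .
    moreover have "w q = w z ^ d * real p powr (- of_int a)"
      unfolding q_def using val[OF w'] p'(2) True
      by (simp add: nonarch_mult[OF F' w'] nonarch_power[OF F' w'] subfield_power[OF F'] z paF)
    then have "w q > 1"
      using 2 p1 by (simp add: powr_minus_divide less_divide_eq)
    ultimately show ?thesis using \<open>q \<in> F\<close> by blast
  qed
  then obtain q where q: "q \<in> F" "v q < 1" "w q > 1" by blast
  obtain b where b: "b \<in> ring_of_integers F" "v b = 1" "b * q \<in> ring_of_integers F"
    using valuation_ring_denominator[OF F v q(1)] q(2) by (metis less_imp_le)
  have "w (b * q) \<le> 1"
    using algebraic_int_nonarch_le_1[OF F' w'] ring_of_integers_D[OF b(3)] by blast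
  then have "w b * w q \<le> 1"
    using nonarch_mult[OF F' w' _ q(1)] ring_of_integers_D[OF b(1)] by simp
  have "w b < 1"
  proof (rule ccontr)
    assume "\<not> w b < 1"
    then have "1 * w q \<le> w b * w q" using q(3) by (intro mult_right_mono) auto
    with \<open>w b * w q \<le> 1\<close> q(3) show False by simp
  qed
  with b show ?thesis using that by blast
qed


section \<open>Local generators of ideals\<close>

lemma cring_ring_on:
  fixes R :: "'a::field set"
  assumes "1 \<in> R" "\<And>x y. x \<in> R \<Longrightarrow> y \<in> R \<Longrightarrow> x - y \<in> R" "\<And>x y. x \<in> R \<Longrightarrow> y \<in> R \<Longrightarrow> x * y \<in> R"
  shows "cring (ring_on R)"
proof -
  interpret U: field "ring_on (UNIV :: 'a set)" by (rule field_ring_on_UNIV)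
  have zero: "0 \<in> R" using assms(1) assms(2)[of 1 1] by simp
  have neg: "- x \<in> R" if "x \<in> R" for x using assms(2)[OF zero that] by simp
  have add: "x + y \<in> R" if "x \<in> R" "y \<in> R" for x y using assms(2)[OF that(1) neg[OF that(2)]] by simp
  have "subring R (ring_on UNIV)"
    by (rule U.subringI) (use assms neg add in \<open>simp_all add: a_inv_ring_on\<close>)
  then have "subcring R (ring_on UNIV)"
    by (rule U.subcringI')
  then show ?thesis
    using U.subcring_iff[of R] by simp
qed

lemma ideal_ring_onI:
  fixes R :: "'a::field set"
  assumes "cring (ring_on R)" "I \<subseteq> R" "0 \<in> I" "\<And>x y. x \<in> I \<Longrightarrow> y \<in> I \<Longrightarrow> x - y \<in> I"
    "\<And>r x. r \<in> R \<Longrightarrow> x \<in> I \<Longrightarrow> r * x \<in> I"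
  shows "ideal I (ring_on R)"
proof -
  interpret cring "ring_on R" by fact
  have neg: "- x \<in> I" if "x \<in> I" for x using assms(4)[OF assms(3) that] by simp
  have add: "x + y \<in> I" if "x \<in> I" "y \<in> I" for x y using assms(4)[OF that(1) neg[OF that(2)]] by simp
  have inv: "\<ominus>\<^bsub>ring_on R\<^esub> x = - x" if "x \<in> I" for x
    using that neg[OF that] assms(2) by (intro minus_equality) auto
  show ?thesis
  proof (rule idealI)
    show "ring (ring_on R)" by (rule ring_axioms)
    show "subgroup I (add_monoid (ring_on R))"
    proof (rule add.subgroupI)
      fix x assume "x \<in> I"
      then show "\<ominus>\<^bsub>ring_on R\<^esub> x \<in> I" using inv neg by simp
    qed (use assms(2,3) add in auto)
    fix a x assume "a \<in> I" "x \<in> carrier (ring_on R)"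
    then show "x \<otimes>\<^bsub>ring_on R\<^esub> a \<in> I" "a \<otimes>\<^bsub>ring_on R\<^esub> x \<in> I"
      using assms(5)[of x a] by (simp_all add: mult.commute)
  qed
qed

lemma ideal_ring_onD:
  assumes "ideal I (ring_on R)"
  shows "I \<subseteq> R" "0 \<in> I" "x \<in> I \<Longrightarrow> y \<in> I \<Longrightarrow> x + y \<in> I" "x \<in> I \<Longrightarrow> r \<in> R \<Longrightarrow> r * x \<in> I"
  using ideal.Icarr[OF assms] additive_subgroup.zero_closed[OF ideal.axioms(1)[OF assms]]
    additive_subgroup.a_closed[OF ideal.axioms(1)[OF assms], of x y] ideal.I_l_closed[OF assms, of x r]
  by auto

lemma genideal_ring_on_minimal: "ideal I (ring_on R) \<Longrightarrow> S \<subseteq> I \<Longrightarrow> Idl\<^bsub>ring_on R\<^esub> S \<subseteq> I"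
  unfolding genideal_def by blast

lemma field_graph_UNIV: "field_graph (Id_on UNIV)"
  by (auto simp: field_graph_def)

section \<open>Discreteness of the values of a finite place\<close>

lemma rational_nonarch_value:
  fixes F :: "'a::field_char_0 set"
  assumes F: "field_graph (Id_on F)" and v: "nonarch_abs_on F v"
    and p: "Factorial_Ring.prime p" "v (of_nat p) = 1 / real p" and q: "q \<in> \<rat>" "q \<noteq> 0"
  shows "\<exists>k::int. v q = real p powr k"
proof -
  from q(1) obtain a b where ab: "b > 0" "q = of_int a / of_int b" by (rule Rats_cases')
  with q(2) have "a \<noteq> 0" by auto
  obtain m where m: "v (of_int a) = (1 / real p) ^ m"
    by (rule nonarch_of_int_value[OF F v p \<open>a \<noteq> 0\<close>])
  obtain n where n: "v (of_int b) = (1 / real p) ^ n"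
    by (rule nonarch_of_int_value[OF F v p]) (use ab in auto)
  have p0: "real p > 0" using prime_gt_0_nat[OF p(1)] by simp
  have pw: "(1 / real p) ^ k = real p powr (- real k)" for k
    using p0 by (simp add: powr_minus_divide powr_realpow power_one_over)
  have "v q = real p powr (- real m) / real p powr (- real n)"
    unfolding ab(2) nonarch_divide[OF F v subfield_of_int[OF F] subfield_of_int[OF F]] m n pw ..
  also have "\<dots> = real p powr (of_int (int n - int m))"
    by (simp add: powr_diff[symmetric])
  finally show ?thesis by blast
qed

text \<open>
  In a nontrivial linear relation over the rationals the maximal absolute value is attained twice, which
  bounds the ramification index.
\<close>

lemma finite_place_ramification:
  fixes F :: "'a::field_char_0 set"
  assumes nf: "number_field F" and v: "nonarch_abs_on F v"
    and p: "Factorial_Ring.prime p" "v (of_nat p) = 1 / real p"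
  shows "\<exists>n. \<forall>f :: nat \<Rightarrow> 'a. (\<forall>i\<le>n. f i \<in> F \<and> f i \<noteq> 0) \<longrightarrow>
    (\<exists>i\<le>n. \<exists>j\<le>n. i \<noteq> j \<and> (\<exists>k::int. v (f i) = v (f j) * real p powr k))"
proof -
  note F = number_field_field_graph[OF nf]
  obtain n where n: "\<forall>f :: nat \<Rightarrow> 'a. (\<forall>i\<le>n. f i \<in> F) \<longrightarrow>
    (\<exists>q. (\<forall>i. q i \<in> \<rat>) \<and> (\<Sum>i\<le>n. q i * f i) = 0 \<and> (\<exists>i\<le>n. q i \<noteq> 0))"
    using number_field_dependence[OF nf] by (rule exE)
  show ?thesis
  proof (rule exI[of _ n], intro allI impI)
    fix f :: "nat \<Rightarrow> 'a" assume f: "\<forall>i\<le>n. f i \<in> F \<and> f i \<noteq> 0"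
    then obtain q where q: "\<forall>i. q i \<in> \<rat>" "(\<Sum>i\<le>n. q i * f i) = 0" "\<exists>i\<le>n. q i \<noteq> 0"
      using n[rule_format, of f] by blast
    define g where "g = (\<lambda>i. q i * f i)"
    have gF: "g i \<in> F" if "i \<le> n" for i
      using that f q(1) subfield_mult[OF F] subfield_Rats[OF F] unfolding g_def by blast
    have "Max ((\<lambda>i. v (g i)) ` {..n}) \<in> (\<lambda>i. v (g i)) ` {..n}"
      by (rule Max_in) auto
    then obtain i where i': "i \<le> n" "v (g i) = Max ((\<lambda>i. v (g i)) ` {..n})"
      by (metis (no_types, lifting) atMost_iff imageE)
    have i: "i \<le> n" "\<And>j. j \<le> n \<Longrightarrow> v (g j) \<le> v (g i)"
      using i'(1) unfolding i'(2) by auto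
    obtain l where l: "l \<le> n" "q l \<noteq> 0" using q(3) by blast
    have "v (g l) > 0"
      using l f gF[OF l(1)] by (intro nonarch_gt_0[OF F v]) (auto simp: g_def)
    with i(2)[OF l(1)] have pos: "v (g i) > 0" by simp
    have "\<exists>j\<le>n. j \<noteq> i \<and> v (g i) \<le> v (g j)"
    proof (rule ccontr)
      assume no: "\<not> ?thesis"
      \<comment> \<open>A single dominant term would determine the value of the whole sum, which is
        0.\<close>
      have "v (sum g ({..n} - {i})) < v (g i)"
      proof (rule nonarch_sum_less[OF F v])
        fix l assume "l \<in> {..n} - {i}"
        then show "g l \<in> F \<and> v (g l) < v (g i)"
          using no gF by (metis DiffD1 DiffD2 atMost_iff insertI1 not_le)
      qed (rule pos)
      then have "v (sum g ({..n} - {i}) + g i) = v (g i)"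
        using i(1) by (intro nonarch_add_eq[OF F v] subfield_sum[OF F] gF) auto
      moreover have "sum g ({..n} - {i}) + g i = 0"
        using q(2) i(1) by (simp add: g_def sum.remove[of _ i] add.commute)
      ultimately show False using pos nonarch_0[OF F v] by simp
    qed
    then obtain j where j: "j \<le> n" "j \<noteq> i" "v (g i) \<le> v (g j)" by blast
    then have eq: "v (g i) = v (g j)" using i(2)[OF j(1)] by simp
    have q0: "q i \<noteq> 0" "q j \<noteq> 0"
      using pos eq nonarch_0[OF F v] by (auto simp: g_def)
    obtain k where k: "v (q i) = real p powr of_int k"
      using rational_nonarch_value[OF F v p, of "q i"] q(1) q0(1) by blast
    obtain l where l: "v (q j) = real p powr of_int l"
      using rational_nonarch_value[OF F v p, of "q j"] q(1) q0(2) by blast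
    have "v (q i) * v (f i) = v (q j) * v (f j)"
      using eq i(1) j(1) f q(1) subfield_Rats[OF F] unfolding g_def
      by (simp add: nonarch_mult[OF F v])
    then have "v (f i) = v (f j) * (real p powr of_int l / real p powr of_int k)"
      using prime_gt_0_nat[OF p(1)] unfolding k l by (simp add: field_simps)
    also have "real p powr of_int l / real p powr of_int k = real p powr of_int (l - k)"
      by (simp add: powr_diff)
    finally show "\<exists>i\<le>n. \<exists>j\<le>n. i \<noteq> j \<and> (\<exists>k::int. v (f i) = v (f j) * real p powr k)"
      using i(1) j(1,2) by blast
  qed
qed

text \<open>Otherwise there is a strictly increasing sequence of values between \<open>s / p\<close>
  and the supremum \<open>s\<close>. The quotient of two of its terms lies strictly between
  \<open>1 / p\<close> and \<open>p\<close> and is not 1, whereas finite ramification yields two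
  terms whose quotient is an integral power of \<open>p\<close>.\<close>

lemma nonarch_max_attained:
  fixes F :: "'a::field_char_0 set"
  assumes nf: "number_field F" and v: "nonarch_abs_on F v"
    and p: "Factorial_Ring.prime p" "v (of_nat p) = 1 / real p"
    and S: "S \<subseteq> F" "\<And>x. x \<in> S \<Longrightarrow> v x \<le> 1" "x0 \<in> S" "x0 \<noteq> 0"
  shows "\<exists>c\<in>S. \<forall>x\<in>S. v x \<le> v c"
proof (rule ccontr)
  assume "\<not> ?thesis"
  then have next_ex: "\<exists>y\<in>S. v y > v c" if "c \<in> S" for c using that by (auto simp: not_le)
  note F = number_field_field_graph[OF nf]
  have p1: "real p > 1" using prime_gt_1_nat[OF p(1)] by simp
  define s where "s = Sup (v ` S)"
  have bdd: "bdd_above (v ` S)" using S(2) by (auto simp: bdd_above_def)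
  have le_s: "v x \<le> s" if "x \<in> S" for x
    unfolding s_def using bdd that by (simp add: cSUP_upper)
  have "s > 0"
    using nonarch_gt_0[OF F v, of x0] le_s[OF S(3)] S by auto
  then have "s / p < s" using p1 by (simp add: divide_less_eq)
  then obtain y0 where y0: "y0 \<in> S" "s / p < v y0"
    using less_cSUP_iff[OF _ bdd, of "s / p"] S(3) unfolding s_def by blast
  obtain u where u: "\<And>i. u i \<in> S \<and> v (u i) > s / p" "\<And>i. v (u i) < v (u (Suc i))"
  proof -
    have "\<exists>u. \<forall>i. (u i \<in> S \<and> s / p < v (u i)) \<and> v (u i) < v (u (Suc i))"
    proof (rule dependent_nat_choice)
      show "\<exists>x. x \<in> S \<and> s / p < v x" using y0 by blast
      fix x and i :: nat assume "x \<in> S \<and> s / p < v x"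
      then show "\<exists>y. (y \<in> S \<and> s / p < v y) \<and> v x < v y"
        using next_ex[of x] by (meson less_trans)
    qed
    then show ?thesis using that by blast
  qed
  have mono: "i < j \<Longrightarrow> v (u i) < v (u j)" for i j
    using u(2) by (rule lift_Suc_mono_less)
  obtain n where n: "\<forall>f :: nat \<Rightarrow> 'a. (\<forall>i\<le>n. f i \<in> F \<and> f i \<noteq> 0) \<longrightarrow>
    (\<exists>i\<le>n. \<exists>j\<le>n. i \<noteq> j \<and> (\<exists>k::int. v (f i) = v (f j) * real p powr k))"
    using finite_place_ramification[OF nf v p] by (rule exE)
  have pos: "v (u i) > 0" for i
    using u(1)[of i] \<open>s > 0\<close> p1 by (smt (verit) divide_pos_pos)
  have "u i \<in> F \<and> u i \<noteq> 0" for i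
    using pos[of i] u(1)[of i] S(1) nonarch_0[OF F v] by auto
  then obtain i j k where ijk: "i \<noteq> j" "v (u i) = v (u j) * real p powr of_int k"
    using n[rule_format, of u] by blast
  have "\<not> k \<ge> 1"
  proof
    assume "k \<ge> 1"
    then have "real p powr 1 \<le> real p powr of_int k"
      using p1 by (intro powr_mono) auto
    then have "v (u j) * real p \<le> v (u i)"
      unfolding ijk(2) using pos[of j] p1 by (intro mult_left_mono) auto
    moreover have "s < v (u j) * real p"
      using u(1)[of j] p1 by (simp add: divide_less_eq)
    ultimately show False using le_s[of "u i"] u(1)[of i] by simp
  qed
  moreover have "\<not> k \<le> -1"
  proof
    assume "k \<le> -1"
    then have "real p powr of_int k \<le> real p powr (-1)"
      using p1 by (intro powr_mono) auto
    then have "v (u i) \<le> v (u j) * (1 / real p)"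
      unfolding ijk(2) using pos[of j] p1 by (intro mult_left_mono) (auto simp: powr_minus_divide)
    also have "\<dots> \<le> s * (1 / real p)"
      using le_s[of "u j"] u(1)[of j] by (intro mult_right_mono) auto
    finally show False using u(1)[of i] by simp
  qed
  ultimately have "k = 0" by simp
  then have "v (u i) = v (u j)" using ijk(2) p1 by simp
  then show False using mono[of i j] mono[of j i] ijk(1) by (metis less_irrefl nat_neq_iff)
qed

text \<open>An element \<open>c\<close> of \<open>J\<close> of largest value generates the extension
  of \<open>J\<close> to the valuation ring. \<open>ideal_abs\<close> evaluates an unspecified
  generator; every generator divides \<open>c\<close> there, so its value is at least that of
  \<open>c\<close>.\<close>

lemma ideal_abs_eq_max:
  fixes F J :: "'a::field_char_0 set"
  assumes nf: "number_field F" and v: "v \<in> finite_places F"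
    and J: "ideal J (ring_on (ring_of_integers F))" "J \<noteq> {0}"
  shows "ideal_abs F v J > 0" and "j \<in> J \<Longrightarrow> v j \<le> ideal_abs F v J"
proof -
  note F = number_field_field_graph[OF nf] and v' = finite_placesD(2)[OF v]
  obtain p :: nat where p: "Factorial_Ring.prime p" "v (of_nat p) = 1 / of_nat p"
    using finite_placesD(3)[OF v] by blast
  note JD = ideal_ring_onD[OF J(1)]
  have JF: "J \<subseteq> F" and J1: "\<And>x. x \<in> J \<Longrightarrow> v x \<le> 1"
    using JD(1) algebraic_int_nonarch_le_1[OF F v'] ring_of_integers_D by blast+
  obtain x0 where x0: "x0 \<in> J" "x0 \<noteq> 0" using J(2) JD(2) by blast
  obtain c where c: "c \<in> J" "\<And>x. x \<in> J \<Longrightarrow> v x \<le> v c"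
    using nonarch_max_attained[OF nf v' p JF J1 x0] by blast
  have c0: "v c > 0"
    using c(2)[OF x0(1)] nonarch_gt_0[OF F v', of x0] x0 JF by fastforce
  then have "c \<noteq> 0" using nonarch_0[OF F v'] by auto
  define Ov where "Ov = valuation_ring F v"
  have OD: "x \<in> Ov \<longleftrightarrow> x \<in> F \<and> v x \<le> 1" for x by (simp add: Ov_def valuation_ring_def)
  interpret Ov: cring "ring_on Ov"
  proof (rule cring_ring_on)
    show "1 \<in> Ov" by (simp add: OD nonarch_1[OF F v'] subfield_1[OF F])
    fix x y assume "x \<in> Ov" "y \<in> Ov"
    then have xy: "x \<in> F" "v x \<le> 1" "y \<in> F" "v y \<le> 1" by (auto simp: OD)
    then show "x - y \<in> Ov"
      using nonarch_diff[OF F v' xy(1,3)] subfield_diff[OF F xy(1,3)] by (simp add: OD)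
    show "x * y \<in> Ov"
      using xy nonarch_mult[OF F v' xy(1,3)] subfield_mult[OF F xy(1,3)]
        mult_le_one[OF xy(2) nonarch_ge_0[OF F v' xy(3)] xy(4)] by (simp add: OD)
  qed
  have PIdl: "PIdl\<^bsub>ring_on Ov\<^esub> a = {x * a | x. x \<in> Ov}" for a
    by (simp add: cgenideal_def)
  have cOv: "c \<in> Ov" using c J1 JF by (auto simp: OD)
  have "Idl\<^bsub>ring_on Ov\<^esub> J = PIdl\<^bsub>ring_on Ov\<^esub> c"
  proof
    show "Idl\<^bsub>ring_on Ov\<^esub> J \<subseteq> PIdl\<^bsub>ring_on Ov\<^esub> c"
    proof (rule genideal_ring_on_minimal)
      show "ideal (PIdl\<^bsub>ring_on Ov\<^esub> c) (ring_on Ov)"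
        by (rule Ov.cgenideal_ideal) (use cOv in simp)
      show "J \<subseteq> PIdl\<^bsub>ring_on Ov\<^esub> c"
      proof
        fix x assume x: "x \<in> J"
        have "x / c \<in> Ov"
          using x c JF c0 subfield_divide[OF F]
          by (auto simp: OD nonarch_divide[OF F v'] subset_iff divide_le_eq)
        then show "x \<in> PIdl\<^bsub>ring_on Ov\<^esub> c"
          unfolding PIdl using \<open>c \<noteq> 0\<close> by (intro CollectI exI[of _ "x / c"]) simp
      qed
    qed
    show "PIdl\<^bsub>ring_on Ov\<^esub> c \<subseteq> Idl\<^bsub>ring_on Ov\<^esub> J"
      unfolding PIdl genideal_def using c(1) ideal_ring_onD(4) by blast
  qed
  then have "local_generator F v J c"
    using cOv by (simp add: local_generator_def Ov_def)
  then have gen: "local_generator F v J (SOME c. local_generator F v J c)"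
    by (rule someI)
  define c' where "c' = (SOME c. local_generator F v J c)"
  have c'Ov: "c' \<in> Ov" and "PIdl\<^bsub>ring_on Ov\<^esub> c = PIdl\<^bsub>ring_on Ov\<^esub> c'"
    using gen \<open>Idl\<^bsub>ring_on Ov\<^esub> J = PIdl\<^bsub>ring_on Ov\<^esub> c\<close>
    by (simp_all add: local_generator_def c'_def Ov_def)
  moreover have "1 \<in> Ov" by (simp add: OD nonarch_1[OF F v'] subfield_1[OF F])
  then have "c \<in> PIdl\<^bsub>ring_on Ov\<^esub> c" unfolding PIdl by force
  ultimately obtain x where x: "x \<in> Ov" "c = x * c'"
    unfolding PIdl by blast
  have "v c = v x * v c'"
    using x(1) c'Ov by (simp add: x(2) nonarch_mult[OF F v'] OD)
  also have "\<dots> \<le> 1 * v c'"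
    using x(1) c'Ov by (intro mult_right_mono nonarch_ge_0[OF F v']) (auto simp: OD)
  finally have "v c \<le> ideal_abs F v J"
    by (simp add: ideal_abs_def c'_def)
  then show "ideal_abs F v J > 0" and "j \<in> J \<Longrightarrow> v j \<le> ideal_abs F v J"
    using c0 c(2)[of j] by auto
qed

lemma alg_closed_type_if_algebraic_closure:
  assumes "algebraic_closure (ring_on (UNIV :: 'b::field set)) K"
  shows "alg_closed_type TYPE('b)"
  unfolding alg_closed_type_def
proof (intro allI impI)
  interpret algebraic_closure "ring_on (UNIV :: 'b set)" K by fact
  fix p :: "'b poly" assume deg_p: "Polynomial.degree p > 0"
  \<comment> \<open>Polynomials as lists over a ring start with the leading coefficient, hence the
    reversal.\<close>
  define P where "P = rev (Polynomial.coeffs p)"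
  have deg: "Polynomials.degree P = Polynomial.degree p"
    by (auto simp: P_def degree_eq_length_coeffs)
  have carrier_P: "P \<in> carrier (poly_ring (ring_on (UNIV :: 'b set)))"
    using deg_p
    by (auto simp: univ_poly_def polynomial_def P_def hd_rev last_coeffs_eq_coeff_degree)
  then have "splitted P"
    using roots_over_carrier by blast
  then have "roots P \<noteq> {#}"
    unfolding splitted_def using deg deg_p by auto
  then obtain x where "x \<in># roots P"
    by blast
  then have x: "is_root P x"
    using roots_mem_iff_is_root[OF carrier_P] by auto
  have pow: "y [^]\<^bsub>ring_on UNIV\<^esub> n = y ^ n" for y :: 'b and n :: nat
    by (induction n) (simp_all add: nat_pow_def)
  have "eval (rev xs) x = poly (Poly xs) x" for xs
    by (induction xs rule: rev_induct) (auto simp: Poly_append poly_monom pow)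
  from this[of "Polynomial.coeffs p"] have "poly p x = 0"
    using x by (simp add: is_root_def P_def)
  then show "\<exists>x. poly p x = 0" ..
qed


section \<open>Linear algebra over complete non-archimedean fields\<close>

lemma Span_ring_on:
  fixes K :: "'a::field set"
  assumes "field_graph (Id_on K)"
  shows "ring.Span (ring_on UNIV) K Us = {\<Sum>i<length Us. c i * Us ! i | c. \<forall>i. c i \<in> K}"
proof -
  interpret field "ring_on (UNIV :: 'a set)" by (rule field_ring_on_UNIV)
  have K: "subfield K (ring_on UNIV)"
    using assms subfield_ring_on_iff by blast
  have "Span K Us = {combine Ks Us | Ks. length Ks = length Us \<and> set Ks \<subseteq> K}"
    using Span_eq_combine_set_length_version[OF K] by simp
  also have "\<dots> = {\<Sum>i<length Us. c i * Us ! i | c. \<forall>i. c i \<in> K}"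
  proof (intro equalityI subsetI)
    fix z assume "z \<in> {combine Ks Us | Ks. length Ks = length Us \<and> set Ks \<subseteq> K}"
    then obtain Ks where Ks: "length Ks = length Us" "set Ks \<subseteq> K" "z = combine Ks Us" by blast
    define c where "c = (\<lambda>i. if i < length Us then Ks ! i else 0)"
    have "\<forall>i. c i \<in> K"
      using Ks(1,2) nth_mem[of _ Ks] subfield_0[OF assms] by (auto simp: c_def)
    moreover have "z = (\<Sum>i<length Us. c i * Us ! i)"
      using Ks by (simp add: combine_ring_on c_def)
    ultimately show "z \<in> {\<Sum>i<length Us. c i * Us ! i | c. \<forall>i. c i \<in> K}" by blast
  next
    fix z assume "z \<in> {\<Sum>i<length Us. c i * Us ! i | c. \<forall>i. c i \<in> K}"
    then obtain c where c: "\<forall>i. c i \<in> K" "z = (\<Sum>i<length Us. c i * Us ! i)" by blast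
    have "z = combine (map c [0..<length Us]) Us"
      using c(2) by (simp add: combine_ring_on)
    then show "z \<in> {combine Ks Us | Ks. length Ks = length Us \<and> set Ks \<subseteq> K}"
      using c(1) by (intro CollectI exI[of _ "map c [0..<length Us]"]) auto
  qed
  finally show ?thesis .
qed

context
  fixes av :: "'b::field \<Rightarrow> real"
  assumes av: "nonarch_abs_on UNIV av"
begin

lemmas av_ge_0 = nonarch_ge_0[OF field_graph_UNIV av UNIV_I]
  and av_eq_0_iff = nonarch_eq_0_iff[OF field_graph_UNIV av UNIV_I]
  and av_mult = nonarch_mult[OF field_graph_UNIV av UNIV_I UNIV_I]
  and av_add = nonarch_add[OF field_graph_UNIV av UNIV_I UNIV_I]
  and av_diff = nonarch_diff[OF field_graph_UNIV av UNIV_I UNIV_I]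
  and av_uminus = nonarch_uminus[OF field_graph_UNIV av UNIV_I]
  and av_divide = nonarch_divide[OF field_graph_UNIV av UNIV_I UNIV_I]
  and av_inverse = nonarch_inverse[OF field_graph_UNIV av UNIV_I]
  and av_gt_0 = nonarch_gt_0[OF field_graph_UNIV av UNIV_I]
  and av_power = nonarch_power[OF field_graph_UNIV av UNIV_I]
  and av_add_eq = nonarch_add_eq[OF field_graph_UNIV av UNIV_I UNIV_I]
  and av_0 = nonarch_0[OF field_graph_UNIV av]
  and av_1 = nonarch_1[OF field_graph_UNIV av]

lemma av_diff_commute: "av (x - y) = av (y - x)"
  using av_uminus[of "x - y"] by simp

lemma av_sum_le: "(\<And>i. i \<in> A \<Longrightarrow> av (f i) \<le> c) \<Longrightarrow> c \<ge> 0 \<Longrightarrow> av (sum f A) \<le> c"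
  using nonarch_sum_le[OF field_graph_UNIV av, of A f c] by blast

lemma av_sum_less: "(\<And>i. i \<in> A \<Longrightarrow> av (f i) < c) \<Longrightarrow> c > 0 \<Longrightarrow> av (sum f A) < c"
  using nonarch_sum_less[OF field_graph_UNIV av, of A f c] by blast

lemma abs_closure_superset: "S \<subseteq> abs_closure av S"
  using av_0 by (force simp: abs_closure_def)

lemma abs_closure_mono: "S \<subseteq> T \<Longrightarrow> abs_closure av S \<subseteq> abs_closure av T"
  by (auto simp: abs_closure_def) blast

lemma abs_closure_idem: "abs_closure av (abs_closure av S) \<subseteq> abs_closure av S"
proof
  fix z assume z: "z \<in> abs_closure av (abs_closure av S)"
  show "z \<in> abs_closure av S"
    unfolding abs_closure_def
  proof (intro CollectI allI impI)
    fix e :: real assume "e > 0"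
    then obtain s where s: "s \<in> abs_closure av S" "av (z - s) < e"
      using z by (auto simp: abs_closure_def)
    then obtain r where r: "r \<in> S" "av (s - r) < e"
      using \<open>e > 0\<close> by (auto simp: abs_closure_def)
    have "av (z - r) \<le> max (av (z - s)) (av (s - r))"
      using av_add[of "z - s" "s - r"] by simp
    then have "av (z - r) < e" using s(2) r(2) by linarith
    with r(1) show "\<exists>s\<in>S. av (z - s) < e" by blast
  qed
qed

lemma abs_closure_subfield:
  assumes S: "field_graph (Id_on S)"
  shows "field_graph (Id_on (abs_closure av S))"
proof -
  have diff: "z - w \<in> abs_closure av S" if z: "z \<in> abs_closure av S" and w: "w \<in> abs_closure av S" for z w
    unfolding abs_closure_def
  proof (intro CollectI allI impI)
    fix e :: real assume "e > 0"
    then obtain s t where st: "s \<in> S" "av (z - s) < e" "t \<in> S" "av (w - t) < e"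
      using z w by (auto simp: abs_closure_def) blast
    have "av (z - w - (s - t)) \<le> max (av (z - s)) (av (w - t))"
      using av_diff[of "z - s" "w - t"] by (simp add: algebra_simps)
    then show "\<exists>s\<in>S. av (z - w - s) < e"
      using st subfield_diff[OF S st(1,3)] by (intro bexI[of _ "s - t"]) linarith+
  qed
  have mult: "z * w \<in> abs_closure av S" if z: "z \<in> abs_closure av S" and w: "w \<in> abs_closure av S" for z w
    unfolding abs_closure_def
  proof (intro CollectI allI impI)
    fix e :: real assume "e > 0"
    define B where "B = av z + av w + 1"
    have B: "B \<ge> 1" "av z \<le> B" "av w \<le> B"
      using av_ge_0[of z] av_ge_0[of w] by (auto simp: B_def)
    \<comment> \<open>\<open>d <= 1\<close> keeps the approximation \<open>t\<close> of
      \<open>w\<close> bounded by \<open>B\<close>, and \<open>d * B <= e\<close> controls both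
      error terms of the product.\<close>
    define d where "d = min 1 (e / B)"
    have d: "d > 0" "d \<le> 1" "d * B \<le> e"
      using \<open>e > 0\<close> B(1) by (auto simp: d_def min_def field_simps)
    obtain s t where st: "s \<in> S" "av (z - s) < d" "t \<in> S" "av (w - t) < d"
      using d(1) z w by (auto simp: abs_closure_def) blast
    have "av (w - (w - t)) \<le> max (av w) (av (w - t))"
      by (rule av_diff)
    then have tB: "av t \<le> B" using st(4) d(2) B by simp
    have "av (z * (w - t)) < d * B"
    proof -
      have "av z * av (w - t) \<le> B * av (w - t)"
        by (intro mult_right_mono B av_ge_0)
      also have "\<dots> < B * d" using B(1) st(4) by simp
      finally show ?thesis by (simp add: av_mult mult.commute)
    qed
    moreover have "av ((z - s) * t) < d * B"
    proof -
      have "av (z - s) * av t \<le> av (z - s) * B"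
        by (intro mult_left_mono tB av_ge_0)
      also have "\<dots> < d * B" using B(1) st(2) by simp
      finally show ?thesis by (simp add: av_mult)
    qed
    moreover have "z * w - s * t = z * (w - t) + (z - s) * t"
      by (simp add: algebra_simps)
    ultimately have "av (z * w - s * t) < d * B"
      using av_add[of "z * (w - t)" "(z - s) * t"] by simp
    then show "\<exists>s\<in>S. av (z * w - s) < e"
      using d(3) subfield_mult[OF S st(1,3)] by (intro bexI[of _ "s * t"]) linarith+
  qed
  have inv: "inverse z \<in> abs_closure av S" if z: "z \<in> abs_closure av S" for z
  proof (cases "z = 0")
    case True
    then show ?thesis using z by simp
  next
    case False
    then have az: "av z > 0" by (rule av_gt_0)
    show ?thesis
      unfolding abs_closure_def
    proof (intro CollectI allI impI)
      fix e :: real assume "e > 0"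
      \<comment> \<open>The first bound gives \<open>av s = av z\<close>, so the difference of the
        inverses has value \<open>av (z - s) / (av z * av z)\<close>, which the second bound makes
        less than \<open>e\<close>.\<close>
      define d where "d = min (av z) (e * (av z * av z))"
      have "d > 0" using az \<open>e > 0\<close> by (simp add: d_def)
      then obtain s where s: "s \<in> S" "av (z - s) < d"
        using z by (auto simp: abs_closure_def)
      have "av (s - z + z) = av z"
        using s(2) by (intro av_add_eq) (simp add: d_def av_diff_commute)
      then have as: "av s = av z" by simp
      then have "s \<noteq> 0" using az av_0 by auto
      have "inverse z - inverse s = (s - z) / (z * s)"
        using False \<open>s \<noteq> 0\<close> by (simp add: field_simps)
      then have "av (inverse z - inverse s) = av (z - s) / (av z * av z)"
        by (simp add: av_divide av_mult as av_diff_commute)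
      also have "\<dots> < e"
        using s(2) az by (simp add: d_def divide_less_eq)
      finally show "\<exists>s\<in>S. av (inverse z - s) < e"
        using subfield_inverse[OF S s(1)] by blast
    qed
  qed
  show ?thesis
    unfolding field_graph_def
    using diff mult inv subsetD[OF abs_closure_superset subfield_1[OF S]] by auto
qed

text \<open>This is the equivalence of norms on a finite-dimensional space over a complete field.
  The induction splits off one vector \<open>u\<close>, whose distance to the span of the others is
  positive.\<close>

lemma coordinates_bounded:
  assumes K: "field_graph (Id_on K)" and compl: "abs_complete av K"
    and indep: "ring.independent (ring_on UNIV) K Us"
  shows "\<exists>\<delta>>0. \<forall>c. (\<forall>i. c i \<in> K) \<longrightarrow>
    (\<forall>i<length Us. \<delta> * av (c i) \<le> av (\<Sum>i<length Us. c i * Us ! i))"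
proof -
  interpret field "ring_on (UNIV :: 'b set)" by (rule field_ring_on_UNIV)
  show ?thesis
    using indep
  proof (induction Us rule: list.induct)
    case Nil
    then show ?case by (auto intro: exI[of _ 1])
  next
    case (Cons u Us)
    define L where "L = (\<lambda>c. \<Sum>i<length Us. c i * Us ! i)"
    have u: "u \<notin> Span K Us" and "independent K Us"
      using independent_backwards(1,2)[OF Cons.prems] by blast+
    then obtain \<delta> where \<delta>: "\<delta> > 0"
      "\<And>c i. \<forall>i. c i \<in> K \<Longrightarrow> i < length Us \<Longrightarrow> \<delta> * av (c i) \<le> av (L c)"
      using Cons.IH unfolding L_def by blast
    have u': "u \<noteq> L c" if "\<forall>i. c i \<in> K" for c
      using u that unfolding Span_ring_on[OF K] L_def by blast
    have L_diff: "L c - L d = L (\<lambda>i. c i - d i)" for c d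
      by (simp add: L_def sum_subtractf left_diff_distrib)
    have L_scale: "L (\<lambda>i. a * c i) = a * L c" for a c
      by (simp add: L_def sum_distrib_left mult.assoc)
    \<comment> \<open>If the distance were 0, the coordinates of approximations to \<open>u\<close>
      would be Cauchy sequences by the induction hypothesis, and their limits in \<open>K\<close>
      would put \<open>u\<close> into the span.\<close>
    have "\<exists>\<eta>>0. \<forall>c. (\<forall>i. c i \<in> K) \<longrightarrow> \<eta> \<le> av (u - L c)"
    proof (rule ccontr)
      assume no: "\<not> ?thesis"
      have "\<exists>c. (\<forall>i. c i \<in> K) \<and> av (u - L c) < 1 / real (Suc m)" for m
        using no[simplified, rule_format, of "1 / real (Suc m)"] by (auto simp: not_le)
      then obtain c where c: "\<And>m i. c m i \<in> K" "\<And>m. av (u - L (c m)) < 1 / real (Suc m)"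
        by metis
      have cauchy: "\<delta> * av (c m i - c l i) < 1 / real (Suc k)"
        if "i < length Us" "m \<ge> k" "l \<ge> k" for i m l k
      proof -
        have "\<delta> * av (c m i - c l i) \<le> av (L (\<lambda>i. c m i - c l i))"
          using \<delta>(2)[of "\<lambda>i. c m i - c l i" i] c(1) subfield_diff[OF K] that(1) by blast
        also have "L (\<lambda>i. c m i - c l i) = (u - L (c l)) - (u - L (c m))"
          by (simp flip: L_diff)
        also have "av \<dots> \<le> max (av (u - L (c l))) (av (u - L (c m)))"
          by (rule av_diff)
        also have "\<dots> < 1 / real (Suc k)"
        proof -
          have "1 / real (Suc l) \<le> 1 / real (Suc k)" "1 / real (Suc m) \<le> 1 / real (Suc k)"
            using that by (auto intro!: divide_left_mono)
          then show ?thesis using c(2)[of l] c(2)[of m] by linarith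
        qed
        finally show ?thesis .
      qed
      have lim_ex: "\<exists>l\<in>K. (\<lambda>m. av (c m i - l)) \<longlonglongrightarrow> 0" if i: "i < length Us" for i
      proof -
        have "\<exists>N. \<forall>m\<ge>N. \<forall>l\<ge>N. av (c m i - c l i) < e" if "e > 0" for e :: real
        proof -
          have "\<delta> * e > 0" using \<delta>(1) that by simp
          then obtain k where k: "1 / real (Suc k) < \<delta> * e"
            using nat_approx_posE by metis
          have "av (c m i - c l i) < e" if "m \<ge> k" "l \<ge> k" for m l
          proof -
            have "\<delta> * av (c m i - c l i) < \<delta> * e"
              using cauchy[OF i that] k by linarith
            then show ?thesis using \<delta>(1) by simp
          qed
          then show ?thesis by blast
        qed
        moreover have "range (\<lambda>m. c m i) \<subseteq> K" using c(1) by auto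
        ultimately show ?thesis
          using compl unfolding abs_complete_def by blast
      qed
      define l where "l = (\<lambda>i. if i < length Us then SOME l. l \<in> K \<and> (\<lambda>m. av (c m i - l)) \<longlonglongrightarrow> 0 else 0)"
      have l: "l i \<in> K" "(\<lambda>m. av (c m i - l i)) \<longlonglongrightarrow> 0" if "i < length Us" for i
        using someI_ex[OF lim_ex[OF that, unfolded Bex_def]] that by (auto simp: l_def)
      have lK: "\<forall>i. l i \<in> K"
        using l(1) subfield_0[OF K] by (auto simp: l_def)
      have "av (u - L l) \<le> e" if "e > 0" for e :: real
      proof -
        have "eventually (\<lambda>m. \<forall>i<length Us. av (c m i - l i) * av (Us ! i) < e) sequentially"
        proof -
          have "eventually (\<lambda>m. av (c m i - l i) * av (Us ! i) < e) sequentially" if "i < length Us" for i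
          proof -
            have "(\<lambda>m. av (c m i - l i) * av (Us ! i)) \<longlonglongrightarrow> 0"
              using tendsto_mult_right[OF l(2)[OF that], of "av (Us ! i)"] by simp
            then show ?thesis using \<open>e > 0\<close> by (rule order_tendstoD)
          qed
          then have "eventually (\<lambda>m. \<forall>i\<in>{..<length Us}. av (c m i - l i) * av (Us ! i) < e) sequentially"
            by (intro eventually_ball_finite) auto
          then show ?thesis by (simp add: Ball_def)
        qed
        moreover have "eventually (\<lambda>m. 1 / real (Suc m) < e) sequentially"
          using LIMSEQ_inverse_real_of_nat[THEN order_tendstoD(2), OF \<open>e > 0\<close>]
          by (simp add: inverse_eq_divide)
        ultimately have "eventually (\<lambda>m. (\<forall>i<length Us. av (c m i - l i) * av (Us ! i) < e) \<and>
            1 / real (Suc m) < e) sequentially"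
          by (rule eventually_conj)
        then obtain m where m: "\<forall>i<length Us. av (c m i - l i) * av (Us ! i) < e" "1 / real (Suc m) < e"
          using eventually_happens'[OF sequentially_bot] by blast
        have "av (L (c m) - L l) \<le> e"
          unfolding L_diff unfolding L_def
          by (rule av_sum_le) (use m(1) \<open>e > 0\<close> in \<open>auto simp: av_mult less_imp_le\<close>)
        moreover have "av (u - L (c m)) \<le> e"
          using c(2)[of m] m(2) by simp
        moreover have "av (u - L l) \<le> max (av (u - L (c m))) (av (L (c m) - L l))"
          using av_add[of "u - L (c m)" "L (c m) - L l"] by simp
        ultimately show ?thesis by simp
      qed
      then have "av (u - L l) \<le> 0"
        by (rule field_le_epsilon[of _ 0, simplified])
      then have "av (u - L l) = 0" using av_ge_0[of "u - L l"] by simp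
      then have "u = L l" using av_eq_0_iff[of "u - L l"] by simp
      with u'[OF lK] show False by simp
    qed
    then obtain \<eta> where \<eta>: "\<eta> > 0" "\<And>c. \<forall>i. c i \<in> K \<Longrightarrow> \<eta> \<le> av (u - L c)" by blast
    \<comment> \<open>For a combination \<open>T\<close>, the bound on the coefficient of
      \<open>u\<close> gives \<open>av (c 0 * u) <= av T * (av u / \<eta>)\<close>; so the rest of
      the combination is at most \<open>av T * B\<close>, to which the induction hypothesis
      applies.\<close>
    define B where "B = max 1 (av u / \<eta>)"
    have "B > 0" by (simp add: B_def)
    define \<delta>' where "\<delta>' = min \<eta> (\<delta> / B)"
    have "\<delta>' > 0" using \<eta>(1) \<delta>(1) \<open>B > 0\<close> by (simp add: \<delta>'_def)
    moreover have "\<delta>' * av (c i) \<le> av (\<Sum>i<length (u # Us). c i * (u # Us) ! i)"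
      if c: "\<forall>i. c i \<in> K" and i: "i < length (u # Us)" for c i
    proof -
      define d where "d = (\<lambda>i. c (Suc i))"
      define T where "T = c 0 * u + L d"
      have T: "(\<Sum>i<length (u # Us). c i * (u # Us) ! i) = T"
        by (simp add: T_def L_def d_def sum.lessThan_Suc_shift del: sum.lessThan_Suc)
      have dK: "\<forall>i. d i \<in> K" using c by (simp add: d_def)
      have c0: "\<eta> * av (c 0) \<le> av T"
      proof (cases "c 0 = 0")
        case True
        then show ?thesis using av_ge_0[of T] av_0 by simp
      next
        case False
        have "\<forall>i. (- inverse (c 0)) * d i \<in> K"
          using c dK subfield_mult[OF K] subfield_uminus[OF K] subfield_inverse[OF K] by blast
        from \<eta>(2)[OF this] have "\<eta> \<le> av (u + inverse (c 0) * L d)"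
          unfolding L_scale by simp
        then have "av (c 0) * \<eta> \<le> av (c 0) * av (u + inverse (c 0) * L d)"
          by (intro mult_left_mono av_ge_0)
        also have "\<dots> = av T"
          using False by (simp add: T_def distrib_left mult.assoc[symmetric] flip: av_mult)
        finally show ?thesis by (simp add: mult.commute)
      qed
      have "av (L d) \<le> max (av T) (av (c 0 * u))"
        using av_diff[of T "c 0 * u"] by (simp add: T_def)
      also have "av (c 0 * u) \<le> av T * (av u / \<eta>)"
      proof -
        have "av (c 0) \<le> av T / \<eta>" using c0 \<eta>(1) by (simp add: pos_le_divide_eq mult.commute)
        then have "av (c 0) * av u \<le> av T / \<eta> * av u" by (intro mult_right_mono av_ge_0)
        then show ?thesis by (simp add: av_mult)
      qed
      then have "max (av T) (av (c 0 * u)) \<le> av T * B"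
      proof -
        assume "av (c 0 * u) \<le> av T * (av u / \<eta>)"
        also have "\<dots> \<le> av T * B" by (intro mult_left_mono av_ge_0) (simp add: B_def)
        finally have 1: "av (c 0 * u) \<le> av T * B" .
        have "av T * 1 \<le> av T * B" by (intro mult_left_mono av_ge_0) (simp add: B_def)
        with 1 show ?thesis by simp
      qed
      finally have Ld: "av (L d) \<le> av T * B" .
      show ?thesis
      proof (cases i)
        case 0
        have "\<delta>' * av (c 0) \<le> \<eta> * av (c 0)"
          by (intro mult_right_mono av_ge_0) (simp add: \<delta>'_def)
        with c0 show ?thesis unfolding T 0 by simp
      next
        case (Suc k)
        have "\<delta>' * av (c i) \<le> \<delta> / B * av (d k)"
          unfolding Suc d_def by (intro mult_right_mono av_ge_0) (simp add: \<delta>'_def)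
        also have "\<dots> = \<delta> * av (d k) / B" by simp
        also have "\<dots> \<le> av (L d) / B"
          using \<delta>(2)[OF dK, of k] i Suc \<open>B > 0\<close> by (intro divide_right_mono) auto
        also have "\<dots> \<le> av T" using Ld \<open>B > 0\<close> by (simp add: pos_divide_le_eq)
        finally show ?thesis unfolding T .
      qed
    qed
    ultimately show ?case by blast
  qed
qed

text \<open>A limit \<open>z\<close> outside the span would extend the list to an independent one.
  Its own coordinate in \<open>z - s\<close> is 1, so the distance from \<open>z\<close> to every
  \<open>s\<close> in the span would have a positive lower bound.\<close>

lemma Span_closed:
  assumes K: "field_graph (Id_on K)" and compl: "abs_complete av K"
    and indep: "ring.independent (ring_on UNIV) K Us"
  shows "abs_closure av (ring.Span (ring_on UNIV) K Us) \<subseteq> ring.Span (ring_on UNIV) K Us"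
proof
  interpret field "ring_on (UNIV :: 'b set)" by (rule field_ring_on_UNIV)
  fix z assume z: "z \<in> abs_closure av (Span K Us)"
  show "z \<in> Span K Us"
  proof (rule ccontr)
    assume "z \<notin> Span K Us"
    then have "independent K (z # Us)"
      using indep by (intro li_Cons) auto
    then obtain \<delta> where \<delta>: "\<delta> > 0" "\<forall>c. (\<forall>i. c i \<in> K) \<longrightarrow>
        (\<forall>i<length (z # Us). \<delta> * av (c i) \<le> av (\<Sum>i<length (z # Us). c i * (z # Us) ! i))"
      using coordinates_bounded[OF K compl] by blast
    obtain s where s: "s \<in> Span K Us" "av (z - s) < \<delta>"
      using z \<delta>(1) by (auto simp: abs_closure_def)
    then obtain c where c: "\<forall>i. c i \<in> K" "s = (\<Sum>i<length Us. c i * Us ! i)"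
      unfolding Span_ring_on[OF K] by blast
    define d where "d = (\<lambda>i. case i of 0 \<Rightarrow> 1 | Suc k \<Rightarrow> - c k)"
    have "\<forall>i. d i \<in> K"
      using c(1) subfield_1[OF K] subfield_uminus[OF K] by (simp add: d_def split: nat.split)
    then have "\<delta> * av (d 0) \<le> av (\<Sum>i<length (z # Us). d i * (z # Us) ! i)"
      using \<delta>(2) by simp
    also have "(\<Sum>i<length (z # Us). d i * (z # Us) ! i) = z - s"
      by (simp add: c(2) d_def sum.lessThan_Suc_shift sum_negf del: sum.lessThan_Suc)
    finally show False using s(2) by (simp add: d_def av_1)
  qed
qed

end

section \<open>Integers of the number field that are independent over the p-adic numbers\<close>

lemma ring_hom_emb:
  fixes F :: "'a::field set" and emb :: "'a \<Rightarrow> 'b::field"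
  assumes F: "field_graph (Id_on F)" and emb: "emb \<in> Ring.ring_hom (ring_on F) (ring_on UNIV)"
  shows "x \<in> F \<Longrightarrow> y \<in> F \<Longrightarrow> emb (x - y) = emb x - emb y"
    "x \<in> F \<Longrightarrow> emb (inverse x) = inverse (emb x)"
    "emb 0 = 0" "emb (of_int k) = of_int k"
    "(\<And>i. i \<in> A \<Longrightarrow> f i \<in> F) \<Longrightarrow> emb (sum f A) = (\<Sum>i\<in>A. emb (f i))"
proof -
  note G = field_graph_hom[OF F emb]
  have eq: "emb x = u" if "(x, u) \<in> {(x, emb x) | x. x \<in> F}" for x u
    using that by auto
  have mem: "(x, emb x) \<in> {(x, emb x) | x. x \<in> F}" if "x \<in> F" for x
    using that by blast
  show "x \<in> F \<Longrightarrow> y \<in> F \<Longrightarrow> emb (x - y) = emb x - emb y"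
    by (intro eq field_graph_diff[OF G] mem)
  show "x \<in> F \<Longrightarrow> emb (inverse x) = inverse (emb x)"
    by (intro eq field_graph_inverse[OF G] mem)
  show "emb 0 = 0"
    by (intro eq field_graph_0[OF G])
  show "emb (of_int k) = of_int k"
    by (intro eq field_graph_of_int[OF G])
  show "(\<And>i. i \<in> A \<Longrightarrow> f i \<in> F) \<Longrightarrow> emb (sum f A) = (\<Sum>i\<in>A. emb (f i))"
    by (intro eq field_graph_sum[OF G] mem)
qed

lemma subfield_image:
  fixes F :: "'a::field set" and emb :: "'a \<Rightarrow> 'b::field"
  assumes F: "field_graph (Id_on F)" and emb: "emb \<in> Ring.ring_hom (ring_on F) (ring_on UNIV)"
    and K: "field_graph (Id_on K)" "K \<subseteq> F"
  shows "field_graph (Id_on (emb ` K))"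
proof -
  note hom = ring_hom_emb[OF F emb] and hom' = ring_hom_ring_onD[OF emb]
  have 1: "1 \<in> emb ` K" using subfield_1[OF K(1)] hom'(3) by force
  have 2: "emb x - emb y \<in> emb ` K" "emb x * emb y \<in> emb ` K" if "x \<in> K" "y \<in> K" for x y
    using imageI[OF subfield_diff[OF K(1) that], of emb] imageI[OF subfield_mult[OF K(1) that], of emb]
    unfolding hom(1)[OF subsetD[OF K(2) that(1)] subsetD[OF K(2) that(2)]]
      hom'(2)[OF subsetD[OF K(2) that(1)] subsetD[OF K(2) that(2)]] .
  have 3: "inverse (emb x) \<in> emb ` K" if "x \<in> K" for x
    using imageI[OF subfield_inverse[OF K(1) that], of emb] unfolding hom(2)[OF subsetD[OF K(2) that]] .
  show ?thesis
    unfolding field_graph_def using 1 2 3 by auto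
qed

text \<open>A basis of the completion \<open>L\<close> over \<open>K\<close> is moved into the dense
  subfield \<open>F\<close> and then multiplied by a common denominator. Both changes preserve the
  lower bound for integral combinations, the second one at the expense of the constant.\<close>

lemma local_degree_integers:
  fixes F :: "'a::field_char_0 set" and emb :: "'a \<Rightarrow> 'b::field"
  assumes nf: "number_field F" and v: "nonarch_abs_on F v" and lc: "local_closure F v emb av"
  shows "\<exists>e \<delta>. \<delta> > 0 \<and> (\<forall>i<local_degree F emb av. e i \<in> ring_of_integers F) \<and>
    (\<forall>c :: nat \<Rightarrow> int. \<forall>i<local_degree F emb av.
       \<delta> * v (of_int (c i)) \<le> v (\<Sum>j<local_degree F emb av. of_int (c j) * e j))"
proof -
  interpret field "ring_on (UNIV :: 'b set)" by (rule field_ring_on_UNIV)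
  note F = number_field_field_graph[OF nf]
  have emb: "emb \<in> Ring.ring_hom (ring_on F) (ring_on UNIV)" and av: "nonarch_abs_on UNIV av"
    and v_emb: "\<And>x. x \<in> F \<Longrightarrow> av (emb x) = v x"
    and complL: "abs_complete av (abs_closure av (emb ` F))"
    using lc by (auto simp: local_closure_def)
  note hom = ring_hom_emb[OF F emb] and hom' = ring_hom_ring_onD[OF emb]
  define K where "K = abs_closure av (emb ` \<rat>)"
  define L where "L = abs_closure av (emb ` F)"
  have QF: "\<rat> \<subseteq> F" using subfield_Rats[OF F] by blast
  have K: "field_graph (Id_on K)"
    unfolding K_def by (rule abs_closure_subfield[OF av subfield_image[OF F emb field_graph_Rats QF]])
  have L: "field_graph (Id_on L)"
    unfolding L_def by (rule abs_closure_subfield[OF av subfield_image[OF F emb F order_refl]])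
  have Ks: "subfield K (ring_on UNIV)" and Ls: "subfield L (ring_on UNIV)"
    using K L subfield_ring_on_iff by blast+
  have KL: "K \<subseteq> L"
    unfolding K_def L_def using QF by (intro abs_closure_mono[OF av]) auto
  \<comment> \<open>A closed subset of the complete field \<open>L\<close> is complete.\<close>
  have complK: "abs_complete av K"
    unfolding abs_complete_def
  proof (intro allI impI)
    fix u :: "nat \<Rightarrow> 'b"
    assume u: "range u \<subseteq> K" "\<forall>e>0. \<exists>N. \<forall>m\<ge>N. \<forall>n\<ge>N. av (u m - u n) < e"
    then obtain l where l: "(\<lambda>n. av (u n - l)) \<longlonglongrightarrow> 0"
      using complL KL unfolding abs_complete_def L_def by (meson subset_trans)
    have "l \<in> abs_closure av K"
      unfolding abs_closure_def
    proof (intro CollectI allI impI)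
      fix e :: real assume "e > 0"
      then have "eventually (\<lambda>n. av (u n - l) < e) sequentially"
        by (rule order_tendstoD(2)[OF l])
      then obtain n where "av (u n - l) < e"
        using eventually_happens'[OF sequentially_bot] by blast
      then show "\<exists>s\<in>K. av (l - s) < e"
        using u(1) av_diff_commute[OF av] by (metis rangeI subsetD)
    qed
    then have "l \<in> K"
      unfolding K_def using abs_closure_idem[OF av] by blast
    with l show "\<exists>l\<in>K. (\<lambda>n. av (u n - l)) \<longlonglongrightarrow> 0" by blast
  qed
  have K_emb: "emb q \<in> K" if "q \<in> \<rat>" for q
    unfolding K_def by (rule subsetD[OF abs_closure_superset[OF av] imageI[OF that]])
  obtain Us where Us: "set Us \<subseteq> F"
    "\<forall>z\<in>F. \<exists>q. (\<forall>i. q i \<in> \<rat>) \<and> z = (\<Sum>i<length Us. q i * Us ! i)"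
    by (rule number_field_basis[OF nf])
  have emb_Span: "emb ` F \<subseteq> Span K (map emb Us)"
  proof (rule image_subsetI)
    fix z assume "z \<in> F"
    then obtain q where q: "\<forall>i. q i \<in> \<rat>" "z = (\<Sum>i<length Us. q i * Us ! i)"
      using Us(2) by blast
    have UsF: "Us ! i \<in> F" if "i < length Us" for i
      using Us(1) that by auto
    have "emb z = (\<Sum>i<length Us. emb (q i * Us ! i))"
      unfolding q(2) using q(1) QF UsF by (intro hom(5) subfield_mult[OF F]) auto
    also have "\<dots> = (\<Sum>i<length (map emb Us). emb (q i) * map emb Us ! i)"
      using q(1) QF UsF by (intro sum.cong) (auto simp: hom'(2) subset_iff)
    finally have "emb z = (\<Sum>i<length (map emb Us). emb (q i) * map emb Us ! i)" .
    then show "emb z \<in> Span K (map emb Us)"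
      unfolding Span_ring_on[OF K]
      by (intro CollectI exI[of _ "\<lambda>i. emb (q i)"] conjI) (use K_emb q(1) in simp_all)
  qed
  obtain Vs where Vs: "independent K Vs" "Span K Vs = Span K (map emb Us)"
    using filter_base[OF Ks, of "map emb Us"] by auto
  \<comment> \<open>The span is closed and contains the image of \<open>F\<close>, hence also its
    closure \<open>L\<close>. This finiteness is what makes \<open>local_degree\<close> a genuine
    dimension.\<close>
  have "L \<subseteq> Span K (map emb Us)"
    using abs_closure_mono[OF av emb_Span] Span_closed[OF av K complK Vs(1)]
    unfolding L_def Vs(2) by blast
  moreover have "subalgebra K L (ring_on UNIV)"
  proof (intro subalgebra.intro subalgebra_axioms.intro)
    show "subgroup L (add_monoid (ring_on UNIV))"
      using subfieldE(1)[OF Ls] by (simp add: subring_def)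
    show "k \<otimes>\<^bsub>ring_on UNIV\<^esub> x \<in> L" if "k \<in> K" "x \<in> L" for k x
      using subfield_mult[OF L] that KL by auto
  qed
  ultimately have "finite_dimension K L"
    using subalbegra_incl_imp_finite_dimension[OF Ks Span_finite_dimension[OF Ks]] by auto
  define n where "n = local_degree F emb av"
  have "dimension n K L"
    using finite_dimensionE[OF Ks \<open>finite_dimension K L\<close>]
    by (simp add: n_def local_degree_def over_def K_def L_def)
  then obtain Ws where Ws: "independent K Ws" "length Ws = n" "Span K Ws = L"
    using exists_base[OF Ks] by blast
  obtain \<delta> where \<delta>: "\<delta> > 0" "\<forall>c. (\<forall>i. c i \<in> K) \<longrightarrow>
      (\<forall>i<length Ws. \<delta> * av (c i) \<le> av (\<Sum>i<length Ws. c i * Ws ! i))"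
    using coordinates_bounded[OF av K complK Ws(1)] by blast
  have "set Ws \<subseteq> L"
    using Span_base_incl[OF Ks, of Ws] Ws(3) by auto
  \<comment> \<open>An error below \<open>\<delta>\<close> is tolerable: if \<open>\<gamma>\<close>
    is the largest value of a coefficient, the unperturbed combination has value at least
    \<open>\<delta> * \<gamma>\<close>, while the perturbation stays strictly below this and does
    not affect the value of the sum.\<close>
  then have "\<forall>i<n. \<exists>f\<in>F. av (Ws ! i - emb f) < \<delta>"
    using \<delta>(1) Ws(2) nth_mem unfolding L_def abs_closure_def by blast
  then obtain f where f: "\<And>i. i < n \<Longrightarrow> f i \<in> F" "\<And>i. i < n \<Longrightarrow> av (Ws ! i - emb (f i)) < \<delta>"
    by metis
  have bound: "\<delta> * v (of_int (c i)) \<le> v (\<Sum>j<n. of_int (c j) * f j)" if i: "i < n" for c :: "nat \<Rightarrow> int" and i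
  proof -
    define \<gamma> where "\<gamma> = Max ((\<lambda>i. av (of_int (c i))) ` {..<n})"
    have "\<gamma> \<in> (\<lambda>i. av (of_int (c i))) ` {..<n}"
      unfolding \<gamma>_def using i by (intro Max_in) auto
    then obtain k where k: "k < n" "\<gamma> = av (of_int (c k))" by auto
    have max: "av (of_int (c j)) \<le> \<gamma>" if "j < n" for j
      unfolding \<gamma>_def using that by (intro Max_ge) auto
    have vc: "v (of_int (c j)) = av (of_int (c j))" for j
      using v_emb[OF subfield_of_int[OF F], of "c j"] hom(4) by simp
    have val: "v (\<Sum>j<n. of_int (c j) * f j) = av (\<Sum>j<n. of_int (c j) * emb (f j))"
    proof -
      have "(\<Sum>j<n. of_int (c j) * f j) \<in> F"
        by (intro subfield_sum[OF F] subfield_mult[OF F] subfield_of_int[OF F] f) simp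
      moreover have "emb (\<Sum>j<n. of_int (c j) * f j) = (\<Sum>j<n. emb (of_int (c j) * f j))"
        by (intro hom(5) subfield_mult[OF F] subfield_of_int[OF F] f) simp
      moreover have "\<dots> = (\<Sum>j<n. of_int (c j) * emb (f j))"
        using f(1) by (intro sum.cong) (auto simp: hom'(2) hom(4) subfield_of_int[OF F])
      ultimately show ?thesis using v_emb by metis
    qed
    show ?thesis
    proof (cases "\<gamma> = 0")
      case True
      then have "v (of_int (c i)) \<le> 0" using max[OF i] vc by simp
      then have "\<delta> * v (of_int (c i)) \<le> 0" using \<delta>(1) by (simp add: mult_le_0_iff)
      also have "0 \<le> v (\<Sum>j<n. of_int (c j) * f j)" unfolding val by (rule av_ge_0[OF av])
      finally show ?thesis .
    next
      case False
      then have "\<gamma> > 0" using k(2) av_ge_0[OF av, of "of_int (c k)"] by simp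
      define s where "s = (\<Sum>j<n. of_int (c j) * Ws ! j)"
      define t where "t = (\<Sum>j<n. of_int (c j) * (emb (f j) - Ws ! j))"
      have "\<forall>j. (of_int (c j) :: 'b) \<in> K" using subfield_of_int[OF K] by blast
      from \<delta>(2)[rule_format, of "\<lambda>j. of_int (c j)" k, OF this[rule_format]]
      have "\<delta> * av (of_int (c k)) \<le> av s"
        using k(1) Ws(2) unfolding s_def by simp
      then have s: "\<delta> * \<gamma> \<le> av s" using k(2) by simp
      have t: "av t < \<delta> * \<gamma>"
        unfolding t_def
      proof (rule av_sum_less[OF av])
        fix j assume "j \<in> {..<n}"
        then have j: "j < n" by simp
        have "av (of_int (c j)) * av (emb (f j) - Ws ! j) \<le> \<gamma> * av (emb (f j) - Ws ! j)"
          by (intro mult_right_mono max[OF j] av_ge_0[OF av])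
        also have "\<dots> < \<gamma> * \<delta>"
          using f(2)[OF j] \<open>\<gamma> > 0\<close> by (simp add: av_diff_commute[OF av])
        finally show "av (of_int (c j) * (emb (f j) - Ws ! j)) < \<delta> * \<gamma>"
          by (simp add: av_mult[OF av] mult.commute)
      qed (use \<delta>(1) \<open>\<gamma> > 0\<close> in simp)
      have "av (t + s) = av s"
        using s t by (intro av_add_eq[OF av]) simp
      moreover have "t + s = (\<Sum>j<n. of_int (c j) * emb (f j))"
        by (simp add: t_def s_def sum.distrib[symmetric] algebra_simps)
      moreover have "\<delta> * v (of_int (c i)) \<le> \<delta> * \<gamma>"
        using max[OF i] \<delta>(1) vc by simp
      ultimately show ?thesis using s val by simp
    qed
  qed
  have "\<forall>i<n. \<exists>k::nat. k > 0 \<and> algebraic_int (of_nat k * f i)"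
    using number_field_algebraic[OF nf f(1)] algebraic_int_multiple by metis
  then obtain k where k: "\<And>i. i < n \<Longrightarrow> k i > 0" "\<And>i. i < n \<Longrightarrow> algebraic_int (of_nat (k i) * f i)"
    by metis
  define m where "m = (\<Prod>i<n. k i)"
  have "m > 0" unfolding m_def using k(1) by (intro prod_pos) auto
  have mf: "of_nat m * f i \<in> ring_of_integers F" if i: "i < n" for i
  proof (rule ring_of_integers_I)
    show "of_nat m * f i \<in> F"
      by (intro subfield_mult[OF F] subfield_of_nat[OF F] f i)
    have "m = (\<Prod>j\<in>{..<n} - {i}. k j) * k i"
      unfolding m_def using i by (subst prod.remove[of _ i]) auto
    then have "of_nat m * f i = of_nat (\<Prod>j\<in>{..<n} - {i}. k j) * (of_nat (k i) * f i)"
      by (simp add: mult.assoc)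
    moreover have "algebraic_int (of_nat (\<Prod>j\<in>{..<n} - {i}. k j) * (of_nat (k i) * f i))"
      by (rule algebraic_int_mult[OF algebraic_int_of_nat k(2)[OF i]])
    ultimately show "algebraic_int (of_nat m * f i)"
      by (simp only:)
  qed
  have "v (of_nat m) > 0"
    using \<open>m > 0\<close> by (intro nonarch_gt_0[OF F v] subfield_of_nat[OF F]) simp
  moreover have "v (of_nat m) * \<delta> * v (of_int (c i)) \<le> v (\<Sum>j<n. of_int (c j) * (of_nat m * f j))"
    if "i < n" for c :: "nat \<Rightarrow> int" and i
  proof -
    have "v (of_nat m) * (\<delta> * v (of_int (c i))) \<le> v (of_nat m) * v (\<Sum>j<n. of_int (c j) * f j)"
      using bound[OF that, of c] \<open>v (of_nat m) > 0\<close> by simp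
    also have "\<dots> = v (of_nat m * (\<Sum>j<n. of_int (c j) * f j))"
      by (intro nonarch_mult[OF F v, symmetric] subfield_of_nat[OF F] subfield_sum[OF F]
          subfield_mult[OF F] subfield_of_int[OF F] f) simp
    also have "of_nat m * (\<Sum>j<n. of_int (c j) * f j) = (\<Sum>j<n. of_int (c j) * (of_nat m * f j))"
      by (simp add: sum_distrib_left mult.left_commute)
    finally show ?thesis by (simp add: mult.assoc)
  qed
  ultimately show ?thesis
    using mf \<delta>(1) unfolding n_def
    by (intro exI[of _ "\<lambda>i. of_nat m * f i"] exI[of _ "v (of_nat m) * \<delta>"]) auto
qed


section \<open>The product formula inequality\<close>

text \<open>The exponent of the largest power of \<open>p\<close> below \<open>x\<close>. The
  disjunct \<open>m = 0\<close> covers \<open>x <= 1\<close>, where no power lies below; in the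
  count a single digit is then left.\<close>

lemma exists_prime_power_between:
  fixes x :: real
  assumes "p > 1"
  shows "\<exists>m. (m = 0 \<or> real p ^ m < x) \<and> x \<le> real p ^ Suc m"
proof -
  obtain n where "x < real p ^ n"
    using real_arch_pow[of "real p" x] assms by auto
  also have "real p ^ n \<le> real p ^ Suc n"
    using assms by (intro power_increasing) auto
  finally have "x \<le> real p ^ Suc n" by simp
  then show ?thesis
  proof (induction n)
    case 0
    then show ?case by (intro exI[of _ 0] conjI disjI1) simp_all
  next
    case (Suc n)
    show ?case
    proof (cases "x \<le> real p ^ Suc n")
      case True
      then show ?thesis by (rule Suc.IH)
    next
      case False
      with Suc.prems show ?thesis by (intro exI[of _ "Suc n"]) simp
    qed
  qed
qed

text \<open>The elements that separate \<open>v\<close> from each of the other places are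
  multiplied; at a given place the factors made for the other places are integral and cannot
  increase the value.\<close>

lemma finite_places_separate_all:
  fixes F :: "'a::field_char_0 set"
  assumes nf: "number_field F" and S: "finite S" "S \<subseteq> finite_places F" and v: "v \<in> S"
  shows "\<exists>b\<in>ring_of_integers F. v b = 1 \<and> (\<forall>w\<in>S - {v}. w b < 1)"
proof -
  note F = number_field_field_graph[OF nf]
  have "\<forall>w\<in>S - {v}. \<exists>b. b \<in> ring_of_integers F \<and> v b = 1 \<and> w b < 1"
  proof
    fix w assume w: "w \<in> S - {v}"
    have vw: "v \<in> finite_places F" "w \<in> finite_places F" "v \<noteq> w"
      using subsetD[OF S(2) v] subsetD[OF S(2), of w] w by auto
    obtain b where "b \<in> ring_of_integers F" "v b = 1" "w b < 1"
      by (rule finite_places_separate[OF nf vw])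
    then show "\<exists>b. b \<in> ring_of_integers F \<and> v b = 1 \<and> w b < 1" by blast
  qed
  then obtain b where b: "\<And>w. w \<in> S - {v} \<Longrightarrow> b w \<in> ring_of_integers F \<and> v (b w) = 1 \<and> w (b w) < 1"
    by metis
  have bF: "b w \<in> F" if "w \<in> S - {v}" for w using b[OF that] ring_of_integers_D by blast
  define B where "B = (\<Prod>w\<in>S - {v}. b w)"
  have "B \<in> ring_of_integers F"
    unfolding B_def using b by (intro roi_prod[OF F]) blast
  moreover have "v B = 1"
    unfolding B_def using b v S bF nonarch_prod[OF F finite_placesD(2), of v "S - {v}" b]
    by (auto intro!: prod.neutral)
  moreover have "w B < 1" if w: "w \<in> S - {v}" for w
  proof -
    have w': "nonarch_abs_on F w" using w S finite_placesD(2) by blast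
    have "w B = (\<Prod>u\<in>S - {v}. w (b u))"
      unfolding B_def by (rule nonarch_prod[OF F w' bF])
    also have "\<dots> = w (b w) * (\<Prod>u\<in>S - {v} - {w}. w (b u))"
      using w S by (intro prod.remove) auto
    also have "\<dots> \<le> w (b w) * 1"
    proof (intro mult_left_mono prod_le_1)
      fix u assume "u \<in> S - {v} - {w}"
      then have u: "u \<in> S - {v}" by auto
      show "0 \<le> w (b u) \<and> w (b u) \<le> 1"
        using nonarch_ge_0[OF F w' bF[OF u]] algebraic_int_nonarch_le_1[OF F w' bF[OF u]]
          b[OF u] ring_of_integers_D(2) by blast
    qed (rule nonarch_ge_0[OF F w' bF[OF w]])
    also have "\<dots> < 1" using b[OF w] by simp
    finally show ?thesis .
  qed
  ultimately show ?thesis by blast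
qed

text \<open>Independence over the p-adic numbers in quantitative form. Only integer coefficients and
  elements of \<open>F\<close> occur, so that the local field disappears from the counting.\<close>

definition local_integer_basis ::
  "'a::field_char_0 set \<Rightarrow> ('a \<Rightarrow> real) \<Rightarrow> nat \<Rightarrow> (nat \<Rightarrow> 'a) \<Rightarrow> real \<Rightarrow> bool" where
  "local_integer_basis F v n e \<delta> \<longleftrightarrow> \<delta> > 0 \<and> (\<forall>i<n. e i \<in> ring_of_integers F) \<and>
     (\<forall>c :: nat \<Rightarrow> int. \<forall>i<n. \<delta> * v (of_int (c i)) \<le> v (\<Sum>j<n. of_int (c j) * e j))"

text \<open>The family consists of digit expansions, with \<open>p v ^ m v\<close> possible digits
  for each basis element at each place. The factor \<open>b v ^ M\<close> has value 1 at
  \<open>v\<close> and at most \<open>\<rho> w\<close> at the other places \<open>w\<close>, so that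
  congruence at \<open>w\<close> concerns the digits of \<open>w\<close> alone; it replaces the
  Chinese remainder theorem.\<close>

lemma incongruent_family:
  fixes F :: "'a::field_char_0 set"
  assumes nf: "number_field F" and S: "finite S" "S \<subseteq> finite_places F"
    and p: "\<And>v. v \<in> S \<Longrightarrow> Factorial_Ring.prime (p v) \<and> v (of_nat (p v)) = 1 / real (p v)"
    and e: "\<And>v. v \<in> S \<Longrightarrow> local_integer_basis F v (n v) (e v) (\<delta> v)"
    and \<rho>: "\<And>v. v \<in> S \<Longrightarrow> \<rho> v > 0"
  shows "\<exists>(A :: (('a \<Rightarrow> real) \<times> nat \<Rightarrow> nat) set) z. finite A \<and> z ` A \<subseteq> ring_of_integers F \<and>
    (\<Prod>v\<in>S. (\<delta> v / (real (p v) * \<rho> v)) ^ n v) \<le> real (card A) \<and>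
    (\<forall>a\<in>A. \<forall>b\<in>A. (\<forall>w\<in>S. w (z a - z b) \<le> \<rho> w) \<longrightarrow> a = b)"
proof -
  note F = number_field_field_graph[OF nf]
  have na: "nonarch_abs_on F v" if "v \<in> S" for v
    using that S finite_placesD(2) by blast
  have \<delta>: "\<delta> v > 0" and eO: "\<And>i. i < n v \<Longrightarrow> e v i \<in> ring_of_integers F"
    and eb: "\<And>c :: nat \<Rightarrow> int. \<And>i. i < n v \<Longrightarrow>
       \<delta> v * v (of_int (c i)) \<le> v (\<Sum>j<n v. of_int (c j) * e v j)" if "v \<in> S" for v
    using e[OF that] by (auto simp: local_integer_basis_def)
  have "\<forall>v\<in>S. \<exists>m. (m = 0 \<or> real (p v) ^ m < \<delta> v / \<rho> v) \<and> \<delta> v / \<rho> v \<le> real (p v) ^ Suc m"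
    using exists_prime_power_between p prime_gt_1_nat by blast
  \<comment> \<open>\<open>p v ^ m v\<close> is 1 or lies below
    \<open>\<delta> v / \<rho> v\<close>, which lets the digits be told apart; and it is at least
    that quotient divided by \<open>p v\<close>, which explains the \<open>p v\<close> in the lower
    bound for the count.\<close>
  then obtain m where m: "\<And>v. v \<in> S \<Longrightarrow> m v = 0 \<or> real (p v) ^ m v < \<delta> v / \<rho> v"
    "\<And>v. v \<in> S \<Longrightarrow> \<delta> v / \<rho> v \<le> real (p v) ^ Suc (m v)"
    by metis
  have "\<forall>v\<in>S. \<exists>b. b \<in> ring_of_integers F \<and> v b = 1 \<and> (\<forall>w\<in>S - {v}. w b < 1)"
    using finite_places_separate_all[OF nf S] by blast
  then obtain b where b: "\<And>v. v \<in> S \<Longrightarrow> b v \<in> ring_of_integers F" "\<And>v. v \<in> S \<Longrightarrow> v (b v) = 1"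
    "\<And>v w. v \<in> S \<Longrightarrow> w \<in> S \<Longrightarrow> w \<noteq> v \<Longrightarrow> w (b v) < 1"
    by (metis Diff_iff singletonD)
  have "\<exists>M. \<forall>v\<in>S. \<forall>w\<in>S. w \<noteq> v \<longrightarrow> w (b v) ^ M \<le> \<rho> w"
  proof -
    have "eventually (\<lambda>M. w (b v) ^ M \<le> \<rho> w) sequentially" if "v \<in> S" "w \<in> S" "w \<noteq> v" for v w
    proof -
      have "(\<lambda>M. w (b v) ^ M) \<longlonglongrightarrow> 0"
        using b that nonarch_ge_0[OF F na[OF that(2)], of "b v"] ring_of_integers_D(1)[OF b(1)]
        by (intro LIMSEQ_power_zero) simp
      from order_tendstoD(2)[OF this \<rho>[OF that(2)]] show ?thesis
        by (rule eventually_mono) simp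
    qed
    then have "eventually (\<lambda>M. \<forall>v\<in>S. \<forall>w\<in>S. w \<noteq> v \<longrightarrow> w (b v) ^ M \<le> \<rho> w) sequentially"
      using S(1) by (intro eventually_ball_finite ballI) (auto intro: eventually_mono)
    then show ?thesis
      using eventually_happens'[OF sequentially_bot] by blast
  qed
  then obtain M where M: "\<And>v w. v \<in> S \<Longrightarrow> w \<in> S \<Longrightarrow> w \<noteq> v \<Longrightarrow> w (b v) ^ M \<le> \<rho> w" by blast
  define I where "I = Sigma S (\<lambda>v. {..<n v})"
  define A where "A = (\<Pi>\<^sub>E x\<in>I. {..<p (fst x) ^ m (fst x)})"
  define g where "g = (\<lambda>x. b (fst x) ^ M * e (fst x) (snd x))"
  define z where "z = (\<lambda>a. \<Sum>x\<in>I. of_nat (a x) * g x)"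
  have finI: "finite I" using S(1) by (simp add: I_def)
  have finA: "finite A" unfolding A_def using finI by (intro finite_PiE) auto
  have gO: "g x \<in> ring_of_integers F" if "x \<in> I" for x
    using that unfolding g_def I_def by (auto intro!: roi_mult[OF F] roi_power[OF F] b eO)
  have zO: "z a \<in> ring_of_integers F" for a
    unfolding z_def using roi_of_int[OF F, of "int _"] by (intro roi_sum[OF F] roi_mult[OF F] gO) auto
  have "(\<Prod>v\<in>S. (\<delta> v / (real (p v) * \<rho> v)) ^ n v) \<le> real (card A)"
  proof -
    have "card A = (\<Prod>x\<in>I. p (fst x) ^ m (fst x))"
      unfolding A_def using finI by (simp add: card_PiE)
    also have "\<dots> = (\<Prod>v\<in>S. \<Prod>i\<in>{..<n v}. p v ^ m v)"
      unfolding I_def using S(1) by (subst prod.Sigma) (auto simp: case_prod_beta)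
    finally have "real (card A) = (\<Prod>v\<in>S. (real (p v) ^ m v) ^ n v)"
      by simp
    moreover have "(\<Prod>v\<in>S. (\<delta> v / (real (p v) * \<rho> v)) ^ n v) \<le> (\<Prod>v\<in>S. (real (p v) ^ m v) ^ n v)"
    proof (rule prod_mono)
      fix v assume v: "v \<in> S"
      have p0: "real (p v) > 0" using p[OF v] prime_gt_0_nat by simp
      have "\<delta> v / (real (p v) * \<rho> v) = (\<delta> v / \<rho> v) / real (p v)" by simp
      also have "\<dots> \<le> real (p v) ^ Suc (m v) / real (p v)"
        using m(2)[OF v] p0 by (intro divide_right_mono) auto
      also have "\<dots> = real (p v) ^ m v" using p0 by simp
      finally show "0 \<le> (\<delta> v / (real (p v) * \<rho> v)) ^ n v \<and>
          (\<delta> v / (real (p v) * \<rho> v)) ^ n v \<le> (real (p v) ^ m v) ^ n v"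
        using \<delta>[OF v] \<rho>[OF v] p0 by (auto intro!: power_mono)
    qed
    ultimately show ?thesis by simp
  qed
  moreover have "a = a'" if a: "a \<in> A" "a' \<in> A" and small: "\<forall>w\<in>S. w (z a - z a') \<le> \<rho> w" for a a'
  proof (rule extensionalityI)
    show "a \<in> extensional I" "a' \<in> extensional I"
      using a by (auto simp: A_def PiE_def)
    define c where "c = (\<lambda>x. int (a x) - int (a' x))"
    have zc: "z a - z a' = (\<Sum>x\<in>I. of_int (c x) * g x)"
      by (simp add: z_def c_def sum_subtractf[symmetric] left_diff_distrib)
    fix x assume x: "x \<in> I"
    define w where "w = fst x"
    define i where "i = snd x"
    have w: "w \<in> S" and i: "i < n w" and xwi: "x = (w, i)"
      using x by (auto simp: I_def w_def i_def)
    note w' = na[OF w]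
    have gF: "of_int k * g y \<in> F" if "y \<in> I" for k y
      using ring_of_integers_D(1)[OF gO[OF that]] by (intro subfield_mult[OF F] subfield_of_int[OF F])
    define I1 where "I1 = {y \<in> I. fst y = w}"
    have split: "(\<Sum>y\<in>I. of_int (c y) * g y)
        = (\<Sum>y\<in>I1. of_int (c y) * g y) + (\<Sum>y\<in>I - I1. of_int (c y) * g y)"
      using finI by (subst sum.subset_diff[of I1 I]) (auto simp: I1_def add.commute)
    have others: "w (\<Sum>y\<in>I - I1. of_int (c y) * g y) \<le> \<rho> w"
    proof (rule nonarch_sum_le[OF F w'])
      fix y assume y: "y \<in> I - I1"
      then have v: "fst y \<in> S" "fst y \<noteq> w" "snd y < n (fst y)" by (auto simp: I_def I1_def)
      have bF: "b (fst y) \<in> F" and eF: "e (fst y) (snd y) \<in> F"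
        using ring_of_integers_D(1) b(1)[OF v(1)] eO[OF v(1,3)] by blast+
      have "w (of_int (c y) * g y) = w (of_int (c y)) * (w (b (fst y)) ^ M * w (e (fst y) (snd y)))"
        using bF eF by (simp add: g_def nonarch_mult[OF F w'] nonarch_power[OF F w'] subfield_of_int[OF F]
            subfield_mult[OF F] subfield_power[OF F])
      also have "\<dots> \<le> 1 * (\<rho> w * 1)"
      proof (intro mult_mono)
        show "w (of_int (c y)) \<le> 1" by (rule nonarch_of_int_le_1[OF F w'])
        show "w (b (fst y)) ^ M \<le> \<rho> w" using M[OF v(1) w] v(2) by simp
        show "w (e (fst y) (snd y)) \<le> 1"
          using algebraic_int_nonarch_le_1[OF F w' eF] eO[OF v(1,3)] ring_of_integers_D(2) by blast
      qed (use \<rho>[OF w] nonarch_ge_0[OF F w'] bF eF in \<open>auto intro!: mult_nonneg_nonneg\<close>)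
      finally show "of_int (c y) * g y \<in> F \<and> w (of_int (c y) * g y) \<le> \<rho> w"
        using gF y by simp
    qed (use \<rho>[OF w] in simp)
    have FI1: "(\<Sum>y\<in>I1. of_int (c y) * g y) \<in> F" "(\<Sum>y\<in>I - I1. of_int (c y) * g y) \<in> F"
      by (intro subfield_sum[OF F] gF, auto simp: I1_def)+
    have "w (\<Sum>y\<in>I1. of_int (c y) * g y) = w ((z a - z a') - (\<Sum>y\<in>I - I1. of_int (c y) * g y))"
      unfolding zc split by simp
    also have "\<dots> \<le> max (w (z a - z a')) (w (\<Sum>y\<in>I - I1. of_int (c y) * g y))"
      using FI1 zO ring_of_integers_D(1) by (intro nonarch_diff[OF F w'] subfield_diff[OF F]) auto
    also have "\<dots> \<le> \<rho> w" using small w others by simp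
    finally have I1_le: "w (\<Sum>y\<in>I1. of_int (c y) * g y) \<le> \<rho> w" .
    have "(\<Sum>y\<in>I1. of_int (c y) * g y) = (\<Sum>j<n w. of_int (c (w, j)) * g (w, j))"
      by (rule sum.reindex_bij_witness[of _ "\<lambda>j. (w, j)" snd]) (use w in \<open>auto simp: I1_def I_def\<close>)
    also have "\<dots> = b w ^ M * (\<Sum>j<n w. of_int (c (w, j)) * e w j)"
      by (simp add: g_def sum_distrib_left mult.left_commute)
    finally have "w (b w ^ M * (\<Sum>j<n w. of_int (c (w, j)) * e w j)) \<le> \<rho> w"
      using I1_le by simp
    moreover have "w (b w ^ M * (\<Sum>j<n w. of_int (c (w, j)) * e w j))
        = w (\<Sum>j<n w. of_int (c (w, j)) * e w j)"
    proof -
      have "b w \<in> F" "(\<Sum>j<n w. of_int (c (w, j)) * e w j) \<in> F"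
        using b(1)[OF w] eO[OF w] ring_of_integers_D(1)
        by (auto intro!: subfield_sum[OF F] subfield_mult[OF F] subfield_of_int[OF F])
      then show ?thesis
        using b(2)[OF w] by (simp add: nonarch_mult[OF F w'] nonarch_power[OF F w'] subfield_power[OF F])
    qed
    ultimately have "\<delta> w * w (of_int (c (w, i))) \<le> \<rho> w"
      using eb[OF w i, of "\<lambda>j. c (w, j)"] by simp
    then have le: "w (of_int (c x)) \<le> \<rho> w / \<delta> w"
      using \<delta>[OF w] by (simp add: xwi pos_le_divide_eq mult.commute)
    have "a x \<in> {..<p w ^ m w}" "a' x \<in> {..<p w ^ m w}"
      unfolding w_def using a x PiE_mem[of _ I "\<lambda>x. {..<p (fst x) ^ m (fst x)}" x]
      unfolding A_def by blast+
    then have "a x < p w ^ m w" "a' x < p w ^ m w" by simp_all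
    then have c_less: "\<bar>c x\<bar> < int (p w ^ m w)" unfolding c_def by linarith
    \<comment> \<open>A nonzero \<open>c x\<close> would be smaller than
      \<open>\<delta> w / \<rho> w\<close> in size, so its value at \<open>w\<close> would exceed
      \<open>\<rho> w / \<delta> w\<close>, contrary to \<open>le\<close>.\<close>
    have "c x = 0"
    proof (rule ccontr)
      assume c0: "c x \<noteq> 0"
      then have "m w \<noteq> 0" using c_less by (cases "m w = 0") simp_all
      then have big: "real (p w) ^ m w < \<delta> w / \<rho> w" using m(1)[OF w] by simp
      have pos: "\<bar>real_of_int (c x)\<bar> > 0" using c0 by simp
      have "real_of_int \<bar>c x\<bar> < real_of_int (int (p w ^ m w))"
        using c_less by (rule of_int_less_iff[THEN iffD2])
      then have "\<bar>real_of_int (c x)\<bar> < \<delta> w / \<rho> w" using big by simp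
      then have "1 / (\<delta> w / \<rho> w) < 1 / \<bar>real_of_int (c x)\<bar>"
        using pos by (intro divide_strict_left_mono mult_pos_pos) simp_all
      also have "\<dots> \<le> w (of_int (c x))"
        using nonarch_of_int_ge[OF F w' _ _ c0, of "p w"] p[OF w] by simp
      finally show False using le by simp
    qed
    then show "a x = a' x" by (simp add: c_def)
  qed
  ultimately show ?thesis
    using finA zO by (intro exI[of _ A] exI[of _ z]) auto
qed

section \<open>Complex embeddings and integers in archimedean boxes\<close>

lemma field_embeddings_hom:
  assumes F: "field_graph (Id_on F)" and h: "h \<in> field_embeddings F"
  shows "x \<in> F \<Longrightarrow> y \<in> F \<Longrightarrow> h (x - y) = h x - h y"
    "x \<in> F \<Longrightarrow> y \<in> F \<Longrightarrow> h (x * y) = h x * h y"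
    "x \<in> F \<Longrightarrow> h (x ^ n) = h x ^ n"
    "x \<in> F \<Longrightarrow> y \<in> F \<Longrightarrow> h (x / y) = h x / h y"
    "h (of_int k) = of_int k"
    "(\<And>i. i \<in> A \<Longrightarrow> f i \<in> F) \<Longrightarrow> h (sum f A) = (\<Sum>i\<in>A. h (f i))"
    "x \<in> F \<Longrightarrow> h x = 0 \<longleftrightarrow> x = 0"
proof -
  note G = complex_embeddings_field_graph[OF F field_embeddings_complex[OF h]]
  have eq: "h x = u" if "(x, u) \<in> {(x, h x) | x. x \<in> F}" for x u
    using that by auto
  have mem: "(x, h x) \<in> {(x, h x) | x. x \<in> F}" if "x \<in> F" for x
    using that by blast
  show "x \<in> F \<Longrightarrow> y \<in> F \<Longrightarrow> h (x - y) = h x - h y"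
    by (intro eq field_graph_diff[OF G] mem)
  show "x \<in> F \<Longrightarrow> y \<in> F \<Longrightarrow> h (x * y) = h x * h y"
    by (intro eq field_graph_mult[OF G] mem)
  show "x \<in> F \<Longrightarrow> h (x ^ n) = h x ^ n"
    by (intro eq field_graph_power[OF G] mem)
  show "x \<in> F \<Longrightarrow> y \<in> F \<Longrightarrow> h (x / y) = h x / h y"
    by (intro eq field_graph_divide[OF G] mem)
  show "h (of_int k) = of_int k"
    by (intro eq field_graph_of_int[OF G])
  show "(\<And>i. i \<in> A \<Longrightarrow> f i \<in> F) \<Longrightarrow> h (sum f A) = (\<Sum>i\<in>A. h (f i))"
    by (intro eq field_graph_sum[OF G] mem)
  show "x \<in> F \<Longrightarrow> h x = 0 \<longleftrightarrow> x = 0"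
    using field_graph_zero_iff[OF G mem] by blast
qed

text \<open>The isomorphism of the prime fields, from which complex embeddings of \<open>F\<close>
  and of the algebraic numbers are obtained by prolongation.\<close>

lemma field_graph_of_rat:
  "field_graph {(of_rat q :: 'a::field_char_0, of_rat q :: 'b::field_char_0) | q. True}"
  (is "field_graph ?G")
  unfolding field_graph_def
proof (intro conjI allI impI)
  show "(1, 1) \<in> ?G" by (intro CollectI exI[of _ 1]) simp
next
  fix x u y w assume "(x, u) \<in> ?G" "(y, w) \<in> ?G"
  then obtain q r where "x = of_rat q" "u = of_rat q" "y = of_rat r" "w = of_rat r"
    by auto
  then show "(x - y, u - w) \<in> ?G" "(x * y, u * w) \<in> ?G"
    by (auto simp: of_rat_diff[symmetric] of_rat_mult[symmetric])
next
  fix x u assume "(x, u) \<in> ?G"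
  then show "(inverse x, inverse u) \<in> ?G"
    by (auto simp: of_rat_inverse[symmetric])
next
  fix u assume "(0, u) \<in> ?G"
  then show "u = 0" by auto
qed

lemma field_embeddings_nonempty:
  fixes F :: "'a::field_char_0 set"
  assumes nf: "number_field F"
  shows "field_embeddings F \<noteq> {}"
proof -
  note F = number_field_field_graph[OF nf]
  define G where "G = {(of_rat q :: 'a, of_rat q :: complex) | q. True}"
  have "field_graph G"
    unfolding G_def by (rule field_graph_of_rat)
  then obtain M where M: "field_graph M" "G \<subseteq> M" "Collect algebraic \<subseteq> Domain M"
    by (rule field_graph_extend_algebraic[OF _ alg_closed_type_class])
  have D: "F \<subseteq> Domain M"
    using M(3) number_field_algebraic[OF nf] by blast
  have "the_image M \<in> complex_embeddings F"
    by (rule field_graph_complex_embedding[OF M(1) D subfield_1[OF F]])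
       (use D in \<open>auto simp: subfield_add[OF F] subfield_mult[OF F] intro!: the_image_in[OF M(1)]\<close>)
  then show ?thesis
    using restrict_field_embedding[OF _ F] by blast
qed

lemma cnj_field_embedding:
  assumes F: "field_graph (Id_on F)" and h: "h \<in> field_embeddings F"
  shows "restrict (\<lambda>x. cnj (h x)) F \<in> field_embeddings F"
proof -
  note G = complex_embeddings_field_graph[OF F field_embeddings_complex[OF h]]
  have C: "field_graph {(z, cnj z) | z. True}"
    by (auto simp: field_graph_def)
  have "(\<lambda>x. cnj (h x)) \<in> complex_embeddings F"
    by (rule field_graph_complex_embedding[OF field_graph_relcomp[OF G C]])
       (auto simp: subfield_1[OF F] subfield_add[OF F] subfield_mult[OF F] Domain_iff relcomp_unfold)
  then show ?thesis by (rule restrict_field_embedding[OF _ F])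
qed

lemma norm_le_add_coordinates:
  fixes w :: complex
  assumes "\<bar>Re w + Im w\<bar> < e" "\<bar>Re w - Im w\<bar> < e"
  shows "norm w < 2 * e"
proof -
  have "\<bar>Re w\<bar> < e" "\<bar>Im w\<bar> < e" using assms by linarith+
  then show ?thesis using cmod_le[of w] by linarith
qed

lemma floor_cell:
  fixes x y r c :: real
  assumes c: "c > 0" and x: "\<bar>x\<bar> \<le> r" and y: "\<bar>y\<bar> \<le> r"
    and eq: "nat \<lfloor>(x + r) * c\<rfloor> = nat \<lfloor>(y + r) * c\<rfloor>"
  shows "\<bar>x - y\<bar> < 1 / c"
proof -
  have 0: "(x + r) * c \<ge> 0" "(y + r) * c \<ge> 0"
    using c x y by (auto intro!: mult_nonneg_nonneg)
  then have "\<lfloor>(x + r) * c\<rfloor> \<ge> 0" "\<lfloor>(y + r) * c\<rfloor> \<ge> 0" by simp_all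
  with eq have "\<lfloor>(x + r) * c\<rfloor> = \<lfloor>(y + r) * c\<rfloor>" by linarith
  then have "\<bar>(x + r) * c - (y + r) * c\<bar> < 1" by linarith
  moreover have "(x + r) * c - (y + r) * c = (x - y) * c" by (simp add: algebra_simps)
  ultimately have "\<bar>x - y\<bar> * c < 1"
    using c by (simp add: abs_mult)
  then show ?thesis using c by (simp add: pos_less_divide_eq)
qed

text \<open>
  Pigeonhole: two integers in a common cell of a box of small volume would have a difference of norm
  smaller than 1. The coordinates \<open>Re + Im\<close> of an embedding and of its conjugate determine both parts.
\<close>

lemma card_integers_in_box:
  fixes F :: "'a::field_char_0 set"
  assumes nf: "number_field F" and N: "N \<in> F" "N \<noteq> 0" and C: "C > 0"
    and Z: "Z \<subseteq> ring_of_integers F" "\<And>z h. z \<in> Z \<Longrightarrow> h \<in> field_embeddings F \<Longrightarrow> norm (h z) \<le> C * norm (h N)"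
    and m: "m > 0" "(8 * C / real m) ^ card (field_embeddings F) * (\<Prod>h\<in>field_embeddings F. norm (h N)) < 1"
  shows "card Z \<le> (m + 1) ^ card (field_embeddings F)"
proof -
  note F = number_field_field_graph[OF nf]
  define H where "H = field_embeddings F"
  have finH: "finite H" unfolding H_def by (rule finite_field_embeddings[OF nf])
  \<comment> \<open>The coordinate \<open>Re + Im\<close> is at most twice the norm, so
    \<open>r\<close> is half the side of the box.\<close>
  define r where "r = (\<lambda>h :: 'a \<Rightarrow> complex. 2 * (C * norm (h N)))"
  define T where "T = (\<lambda>(h :: 'a \<Rightarrow> complex) z. Re (h z) + Im (h z) :: real)"
  \<comment> \<open>The side \<open>2 * r h\<close> is cut into \<open>m\<close> pieces. At the
    right end the floor takes the value \<open>m\<close>, which gives \<open>m + 1\<close>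
    labels.\<close>
  define c where "c = (\<lambda>h. real m / (2 * r h))"
  define cell where "cell = (\<lambda>z. restrict (\<lambda>h. nat \<lfloor>(T h z + r h) * c h\<rfloor>) H)"
  have r0: "r h > 0" if "h \<in> H" for h
    using field_embeddings_hom(7)[OF F, of h N] that N C by (simp add: r_def H_def)
  have T_le: "\<bar>T h z\<bar> \<le> r h" if "z \<in> Z" "h \<in> H" for z h
  proof -
    have "\<bar>T h z\<bar> \<le> 2 * norm (h z)"
      using abs_Re_le_cmod[of "h z"] abs_Im_le_cmod[of "h z"] by (simp add: T_def)
    also have "\<dots> \<le> r h" using Z(2)[of z h] that by (simp add: r_def H_def)
    finally show ?thesis .
  qed
  have "cell ` Z \<subseteq> (\<Pi>\<^sub>E h\<in>H. {..m})"
  proof (rule image_subsetI)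
    fix z assume z: "z \<in> Z"
    have "nat \<lfloor>(T h z + r h) * c h\<rfloor> \<le> m" if h: "h \<in> H" for h
    proof -
      have "(T h z + r h) * c h \<le> (2 * r h) * c h"
        using T_le[OF z h] r0[OF h] by (intro mult_right_mono) (auto simp: c_def)
      also have "\<dots> = real m" using r0[OF h] by (simp add: c_def)
      finally have "\<lfloor>(T h z + r h) * c h\<rfloor> \<le> int m" by linarith
      then show ?thesis by simp
    qed
    then show "cell z \<in> (\<Pi>\<^sub>E h\<in>H. {..m})" by (auto simp: cell_def)
  qed
  moreover have "inj_on cell Z"
  proof (rule inj_onI, rule ccontr)
    fix z z' assume zz': "z \<in> Z" "z' \<in> Z" "cell z = cell z'" "z \<noteq> z'"
    define d where "d = z - z'"
    have d: "d \<in> ring_of_integers F" "d \<noteq> 0"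
      using zz' Z(1) roi_diff[OF F] by (auto simp: d_def)
    have zF: "z \<in> F" "z' \<in> F" "d \<in> F" using zz' Z(1) ring_of_integers_D(1) d(1) by blast+
    have Td: "\<bar>T h d\<bar> < 4 * (C * norm (h N)) / m" if h: "h \<in> H" for h
    proof -
      have "cell z h = cell z' h" using zz'(3) by simp
      then have "nat \<lfloor>(T h z + r h) * c h\<rfloor> = nat \<lfloor>(T h z' + r h) * c h\<rfloor>"
        using h by (simp add: cell_def)
      then have "\<bar>T h z - T h z'\<bar> < 1 / c h"
        using r0[OF h] m(1) T_le zz' h by (intro floor_cell[of "c h" _ "r h"]) (auto simp: c_def)
      moreover have "T h z - T h z' = T h d"
        using field_embeddings_hom(1)[OF F, of h z z'] h zF by (simp add: T_def d_def H_def)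
      ultimately show ?thesis by (simp add: c_def r_def)
    qed
    have "norm (h d) \<le> 8 * C / m * norm (h N)" if h: "h \<in> H" for h
    proof -
      \<comment> \<open>For the conjugate embedding the coordinate is \<open>Re - Im\<close>. If
        both coordinates are below \<open>4 * (C * norm (h N)) / m\<close>, the norm is below twice
        this, whence the constant 8.\<close>
      define h' where "h' = restrict (\<lambda>x. cnj (h x)) F"
      have h': "h' \<in> H" using cnj_field_embedding[OF F] h by (simp add: h'_def H_def)
      have "\<bar>T h d\<bar> < 4 * (C * norm (h N)) / m" by (rule Td[OF h])
      moreover have "\<bar>T h' d\<bar> < 4 * (C * norm (h N)) / m"
        using Td[OF h'] N by (simp add: h'_def)
      ultimately have "norm (h d) < 2 * (4 * (C * norm (h N)) / m)"
        using zF by (intro norm_le_add_coordinates) (auto simp: T_def h'_def)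
      then show ?thesis by simp
    qed
    then have "(\<Prod>h\<in>H. norm (h d)) \<le> (\<Prod>h\<in>H. 8 * C / m * norm (h N))"
      by (intro prod_mono) auto
    also have "\<dots> = (8 * C / m) ^ card H * (\<Prod>h\<in>H. norm (h N))"
      by (simp only: prod.distrib prod_constant)
    also have "\<dots> < 1" using m(2) by (simp add: H_def)
    finally show False
      using norm_prod_embeddings_ge_1[OF nf d] by (simp add: H_def)
  qed
  moreover have "finite (\<Pi>\<^sub>E h\<in>H. {..m})" using finH by (intro finite_PiE) auto
  ultimately have "card Z \<le> card (\<Pi>\<^sub>E h\<in>H. {..m})"
    by (intro card_inj_on_le)
  also have "\<dots> = (m + 1) ^ card H" using finH by (simp add: card_PiE)
  finally show ?thesis by (simp add: H_def)
qed

text \<open>Coordinates with respect to an integral spanning list are rounded down. The error has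
  coordinates in the unit interval, so the norms of the list bound it uniformly in \<open>x\<close>;
  the summand 1 in \<open>C\<close> provides positivity.\<close>

lemma integer_approximation:
  fixes F :: "'a::field_char_0 set"
  assumes nf: "number_field F"
  shows "\<exists>C>0. \<forall>x\<in>F. \<exists>o'\<in>ring_of_integers F. \<forall>h\<in>field_embeddings F. norm (h (x - o')) \<le> C"
proof -
  note F = number_field_field_graph[OF nf]
  define H where "H = field_embeddings F"
  have finH: "finite H" unfolding H_def by (rule finite_field_embeddings[OF nf])
  obtain Us where Us: "set Us \<subseteq> F"
    "\<forall>z\<in>F. \<exists>q. (\<forall>i. q i \<in> \<rat>) \<and> z = (\<Sum>i<length Us. q i * Us ! i)"
    by (rule number_field_basis[OF nf])
  define n where "n = length Us"
  have UF: "Us ! i \<in> F" if "i < n" for i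
    using Us(1) that by (auto simp: n_def)
  have "\<exists>k::nat. k > 0 \<and> algebraic_int (of_nat k * Us ! i)" if "i < n" for i
    using number_field_algebraic[OF nf UF[OF that]] by (metis algebraic_int_multiple)
  then obtain k :: "nat \<Rightarrow> nat" where
    k: "\<And>i. i < n \<Longrightarrow> k i > 0" "\<And>i. i < n \<Longrightarrow> algebraic_int (of_nat (k i) * Us ! i)"
    by metis
  define w where "w = (\<lambda>i. of_nat (k i) * Us ! i)"
  have wO: "w i \<in> ring_of_integers F" if "i < n" for i
    using that k(2) UF subfield_mult[OF F subfield_of_nat[OF F]] by (auto simp: w_def intro: ring_of_integers_I)
  have wF: "w i \<in> F" if "i < n" for i using ring_of_integers_D(1)[OF wO[OF that]] .
  define C where "C = 1 + (\<Sum>h\<in>H. \<Sum>i<n. norm (h (w i)))"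
  have sum_le: "(\<Sum>i<n. norm (h (w i))) \<le> C" if "h \<in> H" for h
    using member_le_sum[of h H "\<lambda>h. \<Sum>i<n. norm (h (w i))"] that finH
    by (simp add: C_def sum_nonneg)
  have "C > 0" by (simp add: C_def sum_nonneg add_pos_nonneg)
  moreover have "\<exists>o'\<in>ring_of_integers F. \<forall>h\<in>H. norm (h (x - o')) \<le> C" if x: "x \<in> F" for x
  proof -
    obtain q where q: "\<forall>i. q i \<in> \<rat>" "x = (\<Sum>i<n. q i * Us ! i)"
      using Us(2) x unfolding n_def by blast
    have "\<exists>a b. b > 0 \<and> q i / of_nat (k i) = of_int a / of_int b" for i
    proof -
      have "q i / of_nat (k i) \<in> \<rat>" using q(1) by auto
      then obtain a b where "b > 0" "q i / of_nat (k i) = of_int a / of_int b" by (rule Rats_cases')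
      then show ?thesis by blast
    qed
    then obtain a b where ab: "\<And>i. b i > (0::int)" "\<And>i. q i / of_nat (k i) = of_int (a i) / of_int (b i)"
      by metis
    define f where "f = (\<lambda>i. of_int (a i mod b i) / of_int (b i) :: 'a)"
    define o' where "o' = (\<Sum>i<n. of_int (a i div b i) * w i)"
    have "o' \<in> ring_of_integers F"
      unfolding o'_def using wO by (intro roi_sum[OF F] roi_mult[OF F] roi_of_int[OF F]) auto
    have fF: "f i \<in> F" for i
      unfolding f_def by (intro subfield_divide[OF F] subfield_of_int[OF F])
    have "x - o' = (\<Sum>i<n. f i * w i)"
      unfolding q(2) o'_def sum_subtractf[symmetric]
    proof (rule sum.cong)
      fix i assume "i \<in> {..<n}"
      then have ki: "of_nat (k i) \<noteq> (0 :: 'a)" using k(1)[of i] by simp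
      have "q i * Us ! i = (q i / of_nat (k i)) * w i"
        using ki by (simp add: w_def)
      moreover have "q i / of_nat (k i) - of_int (a i div b i) = f i"
      proof -
        have "(of_int (a i) :: 'a) = of_int (b i) * of_int (a i div b i) + of_int (a i mod b i)"
          by (simp flip: of_int_mult of_int_add)
        then show ?thesis
          using ab(1)[of i] unfolding ab(2) f_def by (simp add: field_simps)
      qed
      ultimately show "q i * Us ! i - of_int (a i div b i) * w i = f i * w i"
        by (metis left_diff_distrib)
    qed simp
    moreover have "norm (h (\<Sum>i<n. f i * w i)) \<le> C" if h: "h \<in> H" for h
    proof -
      note hom = field_embeddings_hom[OF F h[unfolded H_def]]
      have "h (\<Sum>i<n. f i * w i) = (\<Sum>i<n. h (f i * w i))"
        by (rule hom(6)) (auto intro: subfield_mult[OF F] fF wF)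
      also have "norm \<dots> \<le> (\<Sum>i<n. norm (h (f i * w i)))"
        by (rule norm_sum)
      also have "\<dots> \<le> (\<Sum>i<n. norm (h (w i)))"
      proof (rule sum_mono)
        fix i assume "i \<in> {..<n}"
        then have i: "i < n" by simp
        have "h (f i) = of_int (a i mod b i) / of_int (b i)"
          unfolding f_def by (simp add: hom(4,5) subfield_of_int[OF F])
        then have "norm (h (f i)) = real_of_int (a i mod b i) / real_of_int (b i)"
          using ab(1)[of i] by (simp add: norm_divide)
        also have "\<dots> \<le> 1"
          using ab(1)[of i] less_imp_le[OF pos_mod_bound[of "b i" "a i"]] by simp
        finally have "norm (h (f i)) * norm (h (w i)) \<le> 1 * norm (h (w i))"
          by (intro mult_right_mono) auto
        then show "norm (h (f i * w i)) \<le> norm (h (w i))"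
          using hom(2)[OF fF wF[OF i], of i] by (simp add: norm_mult)
      qed
      also have "\<dots> \<le> C" by (rule sum_le[OF h])
      finally show ?thesis .
    qed
    ultimately show ?thesis
      using \<open>o' \<in> ring_of_integers F\<close> by (intro bexI[of _ o'] ballI) simp_all
  qed
  ultimately show ?thesis unfolding H_def by blast
qed

lemma nonneg_power_bound_imp_ge_1:
  fixes c C R :: real
  assumes "c > 0" "R > 0" "\<And>k::nat. c \<le> C * R ^ k"
  shows "R \<ge> 1"
proof (rule ccontr)
  assume "\<not> R \<ge> 1"
  then have "(\<lambda>k. C * R ^ k) \<longlonglongrightarrow> C * 0"
    using assms(2) by (intro tendsto_mult_left LIMSEQ_power_zero) simp
  then have "c \<le> C * 0"
    by (rule Lim_bounded2) (use assms(3) in auto)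
  with assms(1) show False by simp
qed

text \<open>
  The inequality part of the product formula: the residue classes of the ring of integers modulo a high
  power of \<open>N\<close> are counted from below by the finite places and from above by the infinite ones.
\<close>

theorem product_formula_ge_1:
  fixes F :: "'a::field_char_0 set"
  assumes nf: "number_field F" and S: "finite S" "S \<subseteq> finite_places F"
    and e: "\<And>v. v \<in> S \<Longrightarrow> \<exists>e \<delta>. local_integer_basis F v (n v) e \<delta>"
    and N: "N \<in> ring_of_integers F" "N \<noteq> 0"
  shows "(\<Prod>h\<in>field_embeddings F. norm (h N)) * (\<Prod>v\<in>S. v N ^ n v) \<ge> 1"
proof -
  note F = number_field_field_graph[OF nf]
  define H where "H = field_embeddings F"
  define D where "D = (\<Prod>h\<in>H. norm (h N))"
  define d where "d = card H"
  have finH: "finite H" unfolding H_def by (rule finite_field_embeddings[OF nf])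
  have "d > 0"
    using finH field_embeddings_nonempty[OF nf] by (simp add: d_def H_def card_gt_0_iff)
  have D1: "D \<ge> 1" unfolding D_def H_def by (rule norm_prod_embeddings_ge_1[OF nf N])
  have NF: "N \<in> F" using ring_of_integers_D(1)[OF N(1)] .
  have na: "nonarch_abs_on F v" if "v \<in> S" for v
    using that S finite_placesD(2) by blast
  have vN: "v N > 0" if "v \<in> S" for v
    using nonarch_gt_0[OF F na[OF that] NF N(2)] .
  obtain e \<delta> where e\<delta>: "\<And>v. v \<in> S \<Longrightarrow> local_integer_basis F v (n v) (e v) (\<delta> v)"
    using e by metis
  have "\<forall>v\<in>S. \<exists>p::nat. Factorial_Ring.prime p \<and> v (of_nat p) = 1 / real p"
    using finite_placesD(3) S(2) by blast
  then obtain p where p: "\<And>v. v \<in> S \<Longrightarrow> Factorial_Ring.prime (p v) \<and> v (of_nat (p v)) = 1 / real (p v)"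
    by metis
  obtain C where C: "C > 0" "\<And>x. x \<in> F \<Longrightarrow> \<exists>o'\<in>ring_of_integers F. \<forall>h\<in>H. norm (h (x - o')) \<le> C"
    using integer_approximation[OF nf] unfolding H_def by metis
  \<comment> \<open>The part of the lower bound that does not depend on \<open>k\<close>: for
    \<open>\<rho> v = v N ^ k\<close> the count from below is \<open>c0 / P ^ k\<close>.\<close>
  define c0 where "c0 = (\<Prod>v\<in>S. (\<delta> v / real (p v)) ^ n v)"
  have c0: "c0 > 0"
    unfolding c0_def using e\<delta> p prime_gt_0_nat
    by (intro prod_pos zero_less_power divide_pos_pos) (auto simp: local_integer_basis_def)
  define P where "P = (\<Prod>v\<in>S. v N ^ n v)"
  have "P > 0" unfolding P_def using vN by (intro prod_pos zero_less_power) auto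
  have "c0 \<le> (8 * C + 2) ^ d * (D * P) ^ k" for k
  proof -
    define \<rho> where "\<rho> = (\<lambda>v :: 'a \<Rightarrow> real. v N ^ k)"
    have \<rho>: "\<rho> v > 0" if "v \<in> S" for v using vN[OF that] by (simp add: \<rho>_def)
    have "\<exists>(A :: (('a \<Rightarrow> real) \<times> nat \<Rightarrow> nat) set) z. finite A \<and> z ` A \<subseteq> ring_of_integers F \<and>
        (\<Prod>v\<in>S. (\<delta> v / (real (p v) * \<rho> v)) ^ n v) \<le> real (card A) \<and>
        (\<forall>a\<in>A. \<forall>b\<in>A. (\<forall>w\<in>S. w (z a - z b) \<le> \<rho> w) \<longrightarrow> a = b)"
      by (rule incongruent_family[OF nf S p e\<delta> \<rho>])
    then obtain A :: "(('a \<Rightarrow> real) \<times> nat \<Rightarrow> nat) set" and z where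
      A: "finite A" "z ` A \<subseteq> ring_of_integers F"
      "(\<Prod>v\<in>S. (\<delta> v / (real (p v) * \<rho> v)) ^ n v) \<le> real (card A)"
      "\<forall>a\<in>A. \<forall>b\<in>A. (\<forall>w\<in>S. w (z a - z b) \<le> \<rho> w) \<longrightarrow> a = b"
      by (elim exE conjE) (rule that)
    define Nk where "Nk = N ^ k"
    have Nk: "Nk \<in> ring_of_integers F" "Nk \<in> F" "Nk \<noteq> 0"
      unfolding Nk_def using N roi_power[OF F] subfield_power[OF F] NF by auto
    \<comment> \<open>Rounding \<open>z a / Nk\<close> to an integer \<open>o' a\<close> yields a
      representative of \<open>z a\<close> modulo \<open>Nk\<close> all of whose conjugates lie in
      the box.\<close>
    have "\<forall>a\<in>A. \<exists>o'\<in>ring_of_integers F. \<forall>h\<in>H. norm (h (z a / Nk - o')) \<le> C"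
      using A(2) C(2) subfield_divide[OF F _ Nk(2)] ring_of_integers_D(1) by blast
    then obtain o' where o': "\<And>a. a \<in> A \<Longrightarrow> o' a \<in> ring_of_integers F"
      "\<And>a h. a \<in> A \<Longrightarrow> h \<in> H \<Longrightarrow> norm (h (z a / Nk - o' a)) \<le> C"
      by metis
    define y where "y = (\<lambda>a. z a - Nk * o' a)"
    have zO: "z a \<in> ring_of_integers F" if "a \<in> A" for a using A(2) that by blast
    have yO: "y ` A \<subseteq> ring_of_integers F"
      unfolding y_def using zO o'(1) Nk(1) by (auto intro!: roi_diff[OF F] roi_mult[OF F])
    have "inj_on y A"
    proof (rule inj_onI)
      fix a b assume ab: "a \<in> A" "b \<in> A" "y a = y b"
      then have eq: "z a - z b = Nk * (o' a - o' b)"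
        by (simp add: y_def algebra_simps)
      have "w (z a - z b) \<le> \<rho> w" if w: "w \<in> S" for w
      proof -
        have oo: "o' a - o' b \<in> ring_of_integers F"
          using o'(1) ab by (intro roi_diff[OF F]) auto
        have "w (z a - z b) = w Nk * w (o' a - o' b)"
          unfolding eq by (rule nonarch_mult[OF F na[OF w] Nk(2) ring_of_integers_D(1)[OF oo]])
        also have "\<dots> \<le> w Nk * 1"
          using ring_of_integers_D[OF oo] Nk(2)
          by (intro mult_left_mono algebraic_int_nonarch_le_1[OF F na[OF w]] nonarch_ge_0[OF F na[OF w]])
        also have "w Nk * 1 = \<rho> w"
          unfolding Nk_def \<rho>_def using nonarch_power[OF F na[OF w] NF] by simp
        finally show ?thesis .
      qed
      then show "a = b" using A(4) ab by blast
    qed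
    have y_le: "norm (h u) \<le> C * norm (h Nk)" if u: "u \<in> y ` A" and h: "h \<in> field_embeddings F" for u h
    proof -
      note hom = field_embeddings_hom[OF F h]
      obtain a where a: "a \<in> A" "u = y a" using u by blast
      have in_F: "z a / Nk - o' a \<in> F"
        using zO[OF a(1)] o'(1)[OF a(1)] Nk ring_of_integers_D(1)
        by (intro subfield_diff[OF F] subfield_divide[OF F]) auto
      have "u = (z a / Nk - o' a) * Nk"
        using Nk(3) by (simp add: a(2) y_def field_simps)
      then have "norm (h u) = norm (h (z a / Nk - o' a)) * norm (h Nk)"
        using hom(2)[OF in_F Nk(2)] by (simp add: norm_mult)
      also have "\<dots> \<le> C * norm (h Nk)"
        using o'(2)[OF a(1), of h] h by (intro mult_right_mono) (auto simp: H_def)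
      finally show ?thesis .
    qed
    have prodNk: "(\<Prod>h\<in>field_embeddings F. norm (h Nk)) = D ^ k"
      unfolding D_def H_def Nk_def prod_power_distrib
      by (rule prod.cong) (simp_all add: field_embeddings_hom(3)[OF F _ NF] norm_power)
    \<comment> \<open>\<open>t\<close> is the \<open>d\<close>-th root of \<open>D ^ k\<close>: any
      \<open>m\<close> above \<open>8 * C * t\<close> satisfies the volume condition, and
      \<open>t >= 1\<close> allows the bound \<open>m + 1 <= (8 * C + 2) * t\<close>.\<close>
    define t where "t = D powr (real k / real d)"
    have t1: "t \<ge> 1" unfolding t_def using D1 by (intro ge_one_powr_ge_zero) auto
    have td: "t ^ d = D ^ k"
      unfolding t_def using D1 \<open>d > 0\<close> by (simp add: powr_power powr_realpow)
    define m where "m = nat \<lfloor>8 * C * t\<rfloor> + 1"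
    have "8 * C * t > 0" using C(1) t1 by simp
    then have m: "8 * C * t < real m" "real m \<le> 8 * C * t + 1" "m > 0"
      unfolding m_def by linarith+
    have "8 * C / real m * t < 1"
      using m(1,3) by (simp add: divide_less_eq)
    then have "(8 * C / real m * t) ^ d < 1 ^ d"
      using C(1) t1 \<open>d > 0\<close> by (intro power_strict_mono) auto
    then have small: "(8 * C / real m) ^ card (field_embeddings F) * (\<Prod>h\<in>field_embeddings F. norm (h Nk)) < 1"
      unfolding prodNk td[symmetric] d_def H_def by (simp only: power_mult_distrib power_one)
    have "card A = card (y ` A)"
      using \<open>inj_on y A\<close> by (simp add: card_image)
    also have "\<dots> \<le> (m + 1) ^ d"
      unfolding d_def H_def
      by (rule card_integers_in_box[OF nf Nk(2,3) C(1) yO y_le m(3) small])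
    finally have "real (card A) \<le> (real m + 1) ^ d"
      by (metis of_nat_1 of_nat_add of_nat_le_iff of_nat_power)
    also have "\<dots> \<le> ((8 * C + 2) * t) ^ d"
      using m(2) t1 C(1) by (intro power_mono) (auto simp: algebra_simps)
    also have "\<dots> = (8 * C + 2) ^ d * D ^ k"
      by (simp add: power_mult_distrib td)
    finally have "real (card A) \<le> (8 * C + 2) ^ d * D ^ k" .
    moreover have "(\<Prod>v\<in>S. (\<delta> v / (real (p v) * \<rho> v)) ^ n v) = c0 / P ^ k"
    proof -
      have "(\<delta> v / (real (p v) * \<rho> v)) ^ n v = (\<delta> v / real (p v)) ^ n v / (v N ^ n v) ^ k" for v
        by (simp add: \<rho>_def power_divide power_mult_distrib power_mult[symmetric] mult.commute)
      then show ?thesis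
        by (simp add: c0_def P_def prod_dividef prod_power_distrib)
    qed
    ultimately have "c0 / P ^ k \<le> (8 * C + 2) ^ d * D ^ k"
      using A(3) by simp
    then show ?thesis
      using \<open>P > 0\<close> by (simp add: pos_divide_le_eq power_mult_distrib mult.assoc)
  qed
  \<comment> \<open>A positive lower bound valid for all \<open>k\<close> excludes geometric decay;
    all constants were chosen before \<open>k\<close>.\<close>
  then have "D * P \<ge> 1"
    using c0 D1 \<open>P > 0\<close> by (intro nonneg_power_bound_imp_ge_1[of c0 "D * P" "(8 * C + 2) ^ d"]) auto
  then show ?thesis by (simp add: D_def P_def H_def)
qed


section \<open>The transfinite diameter of a disk\<close>

text \<open>The product over ordered pairs, that is, the absolute value of a discriminant. The index
  set is arbitrary so that single points can be deleted.\<close>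

definition pair_product :: "('i \<Rightarrow> complex) \<Rightarrow> 'i set \<Rightarrow> real" where
  "pair_product z A = (\<Prod>i\<in>A. \<Prod>j\<in>A - {i}. norm (z i - z j))"

lemma pair_product_eq_square:
  "pair_product z {..<n::nat} = (\<Prod>(i, j)\<in>{(i, j). i < j \<and> j < n}. norm (z i - z j))\<^sup>2"
proof -
  define U where "U = {(i, j). i < j \<and> j < n}"
  have "U \<subseteq> {..<n} \<times> {..<n}" by (auto simp: U_def)
  then have finU: "finite U" by (rule finite_subset) simp
  have "pair_product z {..<n} = (\<Prod>(i, j)\<in>Sigma {..<n} (\<lambda>i. {..<n} - {i}). norm (z i - z j))"
    unfolding pair_product_def by (rule prod.Sigma) auto
  also have "Sigma {..<n} (\<lambda>i. {..<n} - {i}) = U \<union> prod.swap ` U"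
  proof (intro equalityI subsetI)
    fix x assume "x \<in> Sigma {..<n} (\<lambda>i. {..<n} - {i})"
    then obtain i j where x: "x = (i, j)" "i < n" "j < n" "i \<noteq> j" by auto
    show "x \<in> U \<union> prod.swap ` U"
    proof (cases "i < j")
      case True
      then show ?thesis using x by (simp add: U_def)
    next
      case False
      then have "(j, i) \<in> U" using x by (simp add: U_def)
      then have "prod.swap (j, i) \<in> prod.swap ` U" by (rule imageI)
      then show ?thesis using x by simp
    qed
  qed (auto simp: U_def)
  also have "(\<Prod>(i, j)\<in>U \<union> prod.swap ` U. norm (z i - z j))
      = (\<Prod>(i, j)\<in>U. norm (z i - z j)) * (\<Prod>(i, j)\<in>prod.swap ` U. norm (z i - z j))"
    using finU by (intro prod.union_disjoint) (auto simp: U_def)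
  also have "(\<Prod>(i, j)\<in>prod.swap ` U. norm (z i - z j)) = (\<Prod>(i, j)\<in>U. norm (z i - z j))"
    by (subst prod.reindex) (auto simp: norm_minus_commute case_prod_beta intro!: prod.cong inj_swap[THEN inj_on_subset])
  finally show ?thesis by (simp add: U_def power2_eq_square)
qed

text \<open>A pair of distinct indices survives the deletion of each of the other
  \<open>card A - 2\<close> indices.\<close>

lemma pair_product_delete:
  assumes "finite A"
  shows "(\<Prod>k\<in>A. pair_product z (A - {k})) = pair_product z A ^ (card A - 2)"
proof -
  define f where "f = (\<lambda>i j. norm (z i - z j))"
  have "(\<Prod>k\<in>A. pair_product z (A - {k})) = (\<Prod>k\<in>A. \<Prod>i | i \<in> A \<and> i \<noteq> k. \<Prod>j\<in>A - {k} - {i}. f i j)"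
    unfolding pair_product_def f_def by (intro prod.cong) auto
  also have "\<dots> = (\<Prod>i\<in>A. \<Prod>k | k \<in> A \<and> i \<noteq> k. \<Prod>j\<in>A - {k} - {i}. f i j)"
    by (rule prod.swap_restrict) (use assms in auto)
  also have "\<dots> = (\<Prod>i\<in>A. (\<Prod>j\<in>A - {i}. f i j) ^ (card A - 2))"
  proof (rule prod.cong)
    fix i assume i: "i \<in> A"
    have "(\<Prod>k | k \<in> A \<and> i \<noteq> k. \<Prod>j\<in>A - {k} - {i}. f i j)
        = (\<Prod>k\<in>A - {i}. \<Prod>j | j \<in> A - {i} \<and> j \<noteq> k. f i j)"
      by (intro prod.cong) auto
    also have "\<dots> = (\<Prod>j\<in>A - {i}. \<Prod>k | k \<in> A - {i} \<and> j \<noteq> k. f i j)"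
      by (rule prod.swap_restrict) (use assms in auto)
    also have "\<dots> = (\<Prod>j\<in>A - {i}. f i j ^ (card A - 2))"
    proof (rule prod.cong)
      fix j assume j: "j \<in> A - {i}"
      have "{k. k \<in> A - {i} \<and> j \<noteq> k} = A - {i} - {j}" by auto
      moreover have "card (A - {i} - {j}) = card A - 2"
        using assms i j by (simp add: card_Diff_singleton)
      ultimately show "(\<Prod>k | k \<in> A - {i} \<and> j \<noteq> k. f i j) = f i j ^ (card A - 2)"
        by simp
    qed simp
    finally show "(\<Prod>k | k \<in> A \<and> i \<noteq> k. \<Prod>j\<in>A - {k} - {i}. f i j) = (\<Prod>j\<in>A - {i}. f i j) ^ (card A - 2)"
      by (simp add: prod_power_distrib)
  qed simp
  also have "\<dots> = pair_product z A ^ (card A - 2)"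
    by (simp add: pair_product_def f_def prod_power_distrib)
  finally show ?thesis .
qed

lemma pair_product_nonneg: "pair_product z A \<ge> 0"
  by (simp add: pair_product_def prod_nonneg)

lemma pair_product_le:
  assumes "finite A" "z ` A \<subseteq> E" "\<And>y. y \<in> E \<Longrightarrow> norm y \<le> B"
  shows "pair_product z A \<le> (2 * B) ^ (card A * (card A - 1))"
proof (cases "A = {}")
  case True
  then show ?thesis by (simp add: pair_product_def)
next
  case False
  then have "B \<ge> 0" using assms(2,3) norm_ge_zero order_trans by blast
  have le: "norm (z i - z j) \<le> 2 * B" if "i \<in> A" "j \<in> A" for i j
    using norm_triangle_ineq4[of "z i" "z j"] assms(3)[of "z i"] assms(3)[of "z j"] assms(2) that by force
  have "pair_product z A \<le> (\<Prod>i\<in>A. (2 * B) ^ (card A - 1))"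
    unfolding pair_product_def
  proof (rule prod_mono)
    fix i assume i: "i \<in> A"
    have "(\<Prod>j\<in>A - {i}. norm (z i - z j)) \<le> (\<Prod>j\<in>A - {i}. 2 * B)"
      using le i by (intro prod_mono) auto
    then show "0 \<le> (\<Prod>j\<in>A - {i}. norm (z i - z j)) \<and> (\<Prod>j\<in>A - {i}. norm (z i - z j)) \<le> (2 * B) ^ (card A - 1)"
      using i assms(1) by (simp add: prod_nonneg)
  qed
  also have "\<dots> = (2 * B) ^ (card A * (card A - 1))"
    by (simp only: prod_constant power_mult[symmetric] mult.commute)
  finally show ?thesis .
qed

lemma pair_product_reindex:
  assumes "bij_betw e A B"
  shows "pair_product (z \<circ> e) A = pair_product z B"
proof -
  have inj: "inj_on e A" and im: "e ` A = B" using assms by (auto simp: bij_betw_def)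
  have "pair_product z B = (\<Prod>i\<in>A. \<Prod>j\<in>B - {e i}. norm (z (e i) - z j))"
    unfolding pair_product_def by (rule prod.reindex_bij_betw[OF assms, symmetric])
  also have "\<dots> = (\<Prod>i\<in>A. \<Prod>j\<in>A - {i}. norm (z (e i) - z (e j)))"
  proof (rule prod.cong)
    fix i assume i: "i \<in> A"
    have "bij_betw e (A - {i}) (B - {e i})"
      unfolding bij_betw_def
      using inj_on_subset[OF inj, of "A - {i}"] inj_on_image_set_diff[OF inj, of A "{i}"] im i by auto
    then show "(\<Prod>j\<in>B - {e i}. norm (z (e i) - z j)) = (\<Prod>j\<in>A - {i}. norm (z (e i) - z (e j)))"
      by (rule prod.reindex_bij_betw[symmetric])
  qed simp
  finally show ?thesis by (simp add: pair_product_def)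
qed

lemma nth_diameter_eq:
  assumes "n \<ge> 2"
  shows "nth_diameter E n = (SUP z \<in> {z. z ` {..<n} \<subseteq> E}. pair_product z {..<n} powr (1 / (real n * (real n - 1))))"
proof -
  have "(\<Prod>(i, j)\<in>{(i, j). i < j \<and> j < n}. norm (z i - z j)) powr (2 / (real n * (real n - 1)))
      = pair_product z {..<n} powr (1 / (real n * (real n - 1)))" for z
  proof -
    define P where "P = (\<Prod>(i, j)\<in>{(i, j). i < j \<and> j < n}. norm (z i - z j))"
    have "P \<ge> 0" unfolding P_def by (intro prod_nonneg) auto
    then have "(P\<^sup>2) powr (1 / (real n * (real n - 1))) = P powr (2 / (real n * (real n - 1)))"
      by (cases "P = 0") (simp_all add: powr_powr flip: powr_numeral)
    then show ?thesis by (simp add: pair_product_eq_square P_def)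
  qed
  then show ?thesis by (simp add: nth_diameter_def)
qed

context
  fixes E :: "complex set" and B :: real
  assumes E: "E \<noteq> {}" "\<And>y. y \<in> E \<Longrightarrow> norm y \<le> B"
begin

lemma configurations_nonempty: "{z. z ` {..<n::nat} \<subseteq> E} \<noteq> {}"
  using E(1) by (auto intro!: exI[of _ "\<lambda>_. SOME y. y \<in> E"] simp: some_in_eq)

lemma bdd_above_pair_product:
  "bdd_above ((\<lambda>z. pair_product z {..<n} powr (1 / (real n * (real n - 1)))) ` {z. z ` {..<n} \<subseteq> E})"
proof (rule bdd_aboveI2)
  fix z assume "z \<in> {z. z ` {..<n} \<subseteq> E}"
  then have "pair_product z {..<n} \<le> (2 * B) ^ (card {..<n} * (card {..<n} - 1))"
    by (intro pair_product_le[OF _ _ E(2)]) auto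
  moreover have "1 / (real n * (real n - 1)) \<ge> 0"
    by (cases n) auto
  ultimately show "pair_product z {..<n} powr (1 / (real n * (real n - 1)))
      \<le> ((2 * B) ^ (card {..<n} * (card {..<n} - 1))) powr (1 / (real n * (real n - 1)))"
    by (intro powr_mono2 pair_product_nonneg)
qed

lemma nth_diameter_ge:
  assumes "n \<ge> 2" "z ` {..<n} \<subseteq> E"
  shows "pair_product z {..<n} powr (1 / (real n * (real n - 1))) \<le> nth_diameter E n"
  unfolding nth_diameter_eq[OF assms(1)]
  using bdd_above_pair_product assms(2) by (intro cSUP_upper) auto

lemma pair_product_le_nth_diameter:
  assumes A: "finite A" "card A = n" "n \<ge> 2" "z ` A \<subseteq> E"
  shows "pair_product z A \<le> nth_diameter E n ^ (n * (n - 1))"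
proof -
  obtain e where e: "bij_betw e {..<n} A"
    using A(1,2) ex_bij_betw_nat_finite lessThan_atLeast0 by metis
  have "real n * (real n - 1) > 0" using A(3) by simp
  have "(z \<circ> e) ` {..<n} \<subseteq> E"
    using e A(4) by (auto simp: bij_betw_def)
  from nth_diameter_ge[OF A(3) this]
  have le: "pair_product z A powr (1 / (real n * (real n - 1))) \<le> nth_diameter E n"
    by (simp add: pair_product_reindex[OF e])
  have "real (n * (n - 1)) = real n * (real n - 1)" using A(3) by (simp add: of_nat_diff)
  then have e1: "1 / (real n * (real n - 1)) * real (n * (n - 1)) = 1"
    using A(3) by simp
  have "n * (n - 1) \<noteq> 0" using A(3) by simp
  have "pair_product z A = (pair_product z A powr (1 / (real n * (real n - 1)))) ^ (n * (n - 1))"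
  proof (cases "pair_product z A = 0")
    case True
    then show ?thesis using \<open>n * (n - 1) \<noteq> 0\<close> by (simp only: powr_0 power_0_left if_False)
  next
    case False
    have "(pair_product z A powr (1 / (real n * (real n - 1)))) ^ (n * (n - 1))
        = pair_product z A powr (real (n * (n - 1)) * (1 / (real n * (real n - 1))))"
      by (rule powr_power[OF False])
    also have "real (n * (n - 1)) * (1 / (real n * (real n - 1))) = 1"
      using e1 by (subst mult.commute)
    finally show ?thesis using pair_product_nonneg[of z A] by simp
  qed
  also have "\<dots> \<le> nth_diameter E n ^ (n * (n - 1))"
    using le by (intro power_mono) auto
  finally show ?thesis .
qed

text \<open>Fekete's argument: deleting one of \<open>n + 1\<close> points leaves a product bounded
  by the \<open>n\<close>-th diameter, and multiplying these bounds over all points gives a bound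
  for a power of the full product.\<close>

lemma nth_diameter_decreasing:
  assumes n: "n \<ge> 2"
  shows "nth_diameter E (Suc n) \<le> nth_diameter E n"
proof -
  have D0: "nth_diameter E n \<ge> 0"
  proof -
    obtain z where "z ` {..<n} \<subseteq> E" using configurations_nonempty by blast
    from nth_diameter_ge[OF n this] show ?thesis
      by (rule order_trans[rotated]) simp
  qed
  show ?thesis
    unfolding nth_diameter_eq[OF le_SucI[OF n]]
  proof (rule cSUP_least[OF configurations_nonempty])
    fix z assume z: "z \<in> {z. z ` {..<Suc n} \<subseteq> E}"
    define W where "W = pair_product z {..<Suc n}"
    have W0: "W \<ge> 0" unfolding W_def by (rule pair_product_nonneg)
    have "W ^ (n - 1) = (\<Prod>k\<in>{..<Suc n}. pair_product z ({..<Suc n} - {k}))"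
      using pair_product_delete[of "{..<Suc n}" z] by (simp add: W_def)
    also have "\<dots> \<le> (\<Prod>k\<in>{..<Suc n}. nth_diameter E n ^ (n * (n - 1)))"
    proof (rule prod_mono)
      fix k assume "k \<in> {..<Suc n}"
      then have "pair_product z ({..<Suc n} - {k}) \<le> nth_diameter E n ^ (n * (n - 1))"
        using z n by (intro pair_product_le_nth_diameter) auto
      then show "0 \<le> pair_product z ({..<Suc n} - {k}) \<and>
          pair_product z ({..<Suc n} - {k}) \<le> nth_diameter E n ^ (n * (n - 1))"
        using pair_product_nonneg by blast
    qed
    also have "\<dots> = (nth_diameter E n ^ (Suc n * n)) ^ (n - 1)"
      by (simp only: prod_constant card_lessThan power_mult[symmetric] mult_ac)
    finally have "W \<le> nth_diameter E n ^ (Suc n * n)"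
      using n D0 by (subst (asm) power_mono_iff) (auto simp: W0)
    then have "W powr (1 / (real (Suc n) * (real (Suc n) - 1)))
        \<le> (nth_diameter E n ^ (Suc n * n)) powr (1 / (real (Suc n) * (real (Suc n) - 1)))"
      using W0 n by (intro powr_mono2) auto
    also have "\<dots> = nth_diameter E n"
    proof (cases "nth_diameter E n = 0")
      case True
      then show ?thesis using n by simp
    next
      case False
      then have "nth_diameter E n > 0" using D0 by simp
      have e: "real (Suc n * n) * (1 / (real (Suc n) * (real (Suc n) - 1))) = 1"
        using n by (simp del: of_nat_Suc) (simp add: algebra_simps)
      have "nth_diameter E n ^ (Suc n * n) = nth_diameter E n powr real (Suc n * n)"
        using \<open>nth_diameter E n > 0\<close> by (rule powr_realpow[symmetric])
      then show ?thesis
        using \<open>nth_diameter E n > 0\<close> by (simp only: powr_powr e powr_one)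
    qed
    finally show "pair_product z {..<Suc n} powr (1 / (real (Suc n) * (real (Suc n) - 1))) \<le> nth_diameter E n"
      by (simp add: W_def)
  qed
qed

text \<open>The transfinite diameter is defined by \<open>lim\<close>, so convergence has to be
  established: the sequence decreases from index 2 on, hence the shift, and \<open>R\<close> bounds
  it from below.\<close>

lemma transfinite_diameter_ge:
  assumes "\<And>n. n \<ge> 2 \<Longrightarrow> R \<le> nth_diameter E n"
  shows "R \<le> transfinite_diameter E"
proof -
  define D where "D = (\<lambda>n. nth_diameter E (n + 2))"
  have "decseq D"
    unfolding D_def by (rule decseq_SucI) (use nth_diameter_decreasing in simp)
  moreover have "R \<le> D n" for n unfolding D_def by (rule assms) simp
  ultimately obtain L where L: "D \<longlonglongrightarrow> L"
    using decseq_convergent by blast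
  then have "nth_diameter E \<longlonglongrightarrow> L"
    unfolding D_def by (rule LIMSEQ_offset)
  then have "transfinite_diameter E = L"
    using E(1) by (simp add: transfinite_diameter_def limI)
  moreover have "R \<le> L"
    by (rule LIMSEQ_le_const[OF L]) (use \<open>\<And>n. R \<le> D n\<close> in auto)
  ultimately show ?thesis by simp
qed

end

text \<open>Average of \<open>p\<close> over the vertices of a regular polygon inscribed in the circle.\<close>

lemma monic_poly_large_on_circle:
  fixes p :: "complex poly"
  assumes p: "Polynomial.lead_coeff p = 1" "Polynomial.degree p = n" and R: "R > 0"
  shows "\<exists>w. norm w = R \<and> norm (poly p w) \<ge> R ^ n"
proof (rule ccontr)
  assume "\<not> ?thesis"
  then have small: "norm (poly p w) < R ^ n" if "norm w = R" for w using that by (auto simp: not_le)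
  define \<omega> where "\<omega> = cis (2 * pi / real (Suc n))"
  have \<omega>N: "\<omega> ^ Suc n = 1"
    unfolding \<omega>_def Complex.DeMoivre by (simp del: of_nat_Suc)
  have \<omega>k: "\<omega> ^ k \<noteq> 1" if "0 < k" "k < Suc n" for k
  proof
    assume "\<omega> ^ k = 1"
    then have "cis (real k * (2 * pi / real (Suc n))) = 1"
      by (simp only: \<omega>_def Complex.DeMoivre)
    then have "cos (real k * (2 * pi / real (Suc n))) = 1"
      by (simp add: complex_eq_iff)
    then obtain i :: int where "real k * (2 * pi / real (Suc n)) = of_int i * 2 * pi"
      using cos_one_2pi_int by auto
    then have "2 * pi * (real k / real (Suc n)) = 2 * pi * of_int i" by (simp add: mult_ac)
    then have "real k / real (Suc n) = of_int i" by (simp only: mult_cancel_left) simp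
    moreover have "0 < real k / real (Suc n)" "real k / real (Suc n) < 1"
      using that by (auto simp: divide_less_eq)
    ultimately show False by simp
  qed
  have norm_\<omega>: "norm (\<omega> ^ j) = 1" for j by (simp add: \<omega>_def norm_power)
  \<comment> \<open>The weight \<open>\<omega> ^ j\<close> raises the exponent to
    \<open>i + 1\<close>, which for \<open>i <= n\<close> is a multiple of the order
    \<open>n + 1\<close> only if \<open>i = n\<close>. So the weighted average picks out the leading
    coefficient.\<close>
  have geo: "(\<Sum>j<Suc n. \<omega> ^ j * (of_real R * \<omega> ^ j) ^ i) = (if i = n then of_nat (Suc n) * of_real R ^ n else 0)"
    if "i \<le> n" for i
  proof -
    have "(\<Sum>j<Suc n. \<omega> ^ j * (of_real R * \<omega> ^ j) ^ i) = of_real R ^ i * (\<Sum>j<Suc n. (\<omega> ^ Suc i) ^ j)"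
      unfolding sum_distrib_left
      by (rule sum.cong) (simp_all add: power_mult_distrib power_mult[symmetric] power_add[symmetric] algebra_simps)
    also have "(\<Sum>j<Suc n. (\<omega> ^ Suc i) ^ j) = (if i = n then of_nat (Suc n) else 0)"
    proof (cases "i = n")
      case True
      then show ?thesis using \<omega>N by (simp del: power_Suc)
    next
      case False
      then have "\<omega> ^ Suc i \<noteq> 1" using \<omega>k[of "Suc i"] that by simp
      moreover have "(\<omega> ^ Suc i) ^ Suc n = 1"
        by (metis \<omega>N power_mult mult.commute power_one)
      ultimately show ?thesis
        using False by (simp add: geometric_sum del: power_Suc sum.lessThan_Suc)
    qed
    finally show ?thesis by simp
  qed
  have "(\<Sum>j<Suc n. \<omega> ^ j * poly p (of_real R * \<omega> ^ j))
      = (\<Sum>j<Suc n. \<Sum>i\<le>n. Polynomial.coeff p i * (\<omega> ^ j * (of_real R * \<omega> ^ j) ^ i))"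
    unfolding poly_altdef p(2) by (simp only: sum_distrib_left mult.left_commute)
  also have "\<dots> = (\<Sum>i\<le>n. \<Sum>j<Suc n. Polynomial.coeff p i * (\<omega> ^ j * (of_real R * \<omega> ^ j) ^ i))"
    by (rule sum.swap)
  also have "\<dots> = (\<Sum>i\<le>n. Polynomial.coeff p i * (if i = n then of_nat (Suc n) * of_real R ^ n else 0))"
    by (rule sum.cong) (simp_all only: sum_distrib_left[symmetric] geo atMost_iff)
  also have "\<dots> = (\<Sum>i\<le>n. if i = n then of_nat (Suc n) * of_real R ^ n else 0)"
    using p by (intro sum.cong) auto
  also have "\<dots> = of_nat (Suc n) * of_real R ^ n" by simp
  finally have eq: "(\<Sum>j<Suc n. \<omega> ^ j * poly p (of_real R * \<omega> ^ j)) = of_nat (Suc n) * of_real R ^ n" .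
  have "real (Suc n) * R ^ n = norm (\<Sum>j<Suc n. \<omega> ^ j * poly p (of_real R * \<omega> ^ j))"
    unfolding eq norm_mult norm_power norm_of_nat using R by simp
  also have "\<dots> \<le> (\<Sum>j<Suc n. norm (\<omega> ^ j * poly p (of_real R * \<omega> ^ j)))"
    by (rule norm_sum)
  also have "\<dots> < (\<Sum>j<Suc n. R ^ n)"
  proof (rule sum_strict_mono)
    fix j
    have "norm (of_real R * \<omega> ^ j) = R" unfolding norm_mult norm_\<omega> using R by simp
    from small[OF this] show "norm (\<omega> ^ j * poly p (of_real R * \<omega> ^ j)) < R ^ n"
      unfolding norm_mult norm_\<omega> by simp
  qed auto
  also have "\<dots> = real (Suc n) * R ^ n" by simp
  finally show False by simp
qed

text \<open>Points are added greedily on the circle: the new point is one where the monic polynomial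
  with the old points as roots has size at least \<open>R ^ n\<close>. In the squared product this
  adds \<open>2 * n\<close> to the exponent.\<close>

lemma disk_configuration:
  assumes R: "R > 0"
  shows "\<exists>z :: nat \<Rightarrow> complex. (\<forall>i<n. norm (z i) = R) \<and>
    (\<Prod>(i, j)\<in>{(i, j). i < j \<and> j < n}. norm (z i - z j)) ^ 2 \<ge> R ^ (n * (n - 1))"
proof (induction n)
  case 0
  then show ?case by simp
next
  case (Suc n)
  then obtain z :: "nat \<Rightarrow> complex" where z: "\<forall>i<n. norm (z i) = R"
    "(\<Prod>(i, j)\<in>{(i, j). i < j \<and> j < n}. norm (z i - z j)) ^ 2 \<ge> R ^ (n * (n - 1))"
    by blast
  define p where "p = (\<Prod>i<n. [:- z i, 1:])"
  have lc: "Polynomial.lead_coeff p = 1"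
    by (simp add: p_def lead_coeff_prod)
  have deg: "Polynomial.degree p = n"
    unfolding p_def by (subst degree_prod_eq_sum_degree) auto
  obtain w where w: "norm w = R" "norm (poly p w) \<ge> R ^ n"
    using monic_poly_large_on_circle[OF lc deg R] by blast
  define z' where "z' = z(n := w)"
  have set: "{(i, j). i < j \<and> j < Suc n} = {(i, j). i < j \<and> j < n} \<union> (\<lambda>i. (i, n)) ` {..<n}"
    by (auto simp: less_Suc_eq)
  have fin: "finite {(i :: nat, j). i < j \<and> j < n}"
    by (rule finite_subset[of _ "{..<n} \<times> {..<n}"]) auto
  have "(\<Prod>(i, j)\<in>{(i, j). i < j \<and> j < Suc n}. norm (z' i - z' j))
      = (\<Prod>(i, j)\<in>{(i, j). i < j \<and> j < n}. norm (z' i - z' j)) * (\<Prod>(i, j)\<in>(\<lambda>i. (i, n)) ` {..<n}. norm (z' i - z' j))"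
    unfolding set by (rule prod.union_disjoint) (use fin in auto)
  also have "(\<Prod>(i, j)\<in>{(i, j). i < j \<and> j < n}. norm (z' i - z' j))
      = (\<Prod>(i, j)\<in>{(i, j). i < j \<and> j < n}. norm (z i - z j))"
    by (rule prod.cong) (auto simp: z'_def)
  also have "(\<Prod>(i, j)\<in>(\<lambda>i. (i, n)) ` {..<n}. norm (z' i - z' j)) = (\<Prod>i<n. norm (z i - w))"
    by (subst prod.reindex) (auto simp: inj_on_def z'_def intro!: prod.cong)
  also have "(\<Prod>i<n. norm (z i - w)) = norm (poly p w)"
    by (simp add: p_def poly_prod prod_norm[symmetric] norm_minus_commute)
  finally have eq: "(\<Prod>(i, j)\<in>{(i, j). i < j \<and> j < Suc n}. norm (z' i - z' j))
      = (\<Prod>(i, j)\<in>{(i, j). i < j \<and> j < n}. norm (z i - z j)) * norm (poly p w)" .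
  have "R ^ (Suc n * (Suc n - 1)) = R ^ (n * (n - 1)) * (R ^ n) ^ 2"
  proof -
    have "Suc n * (Suc n - 1) = n * (n - 1) + n * 2"
      by (cases n) simp_all
    then show ?thesis by (simp only: power_add power_mult)
  qed
  also have "\<dots> \<le> (\<Prod>(i, j)\<in>{(i, j). i < j \<and> j < n}. norm (z i - z j)) ^ 2 * norm (poly p w) ^ 2"
    using z(2) w(2) R by (intro mult_mono power_mono) auto
  also have "\<dots> = (\<Prod>(i, j)\<in>{(i, j). i < j \<and> j < Suc n}. norm (z' i - z' j)) ^ 2"
    by (simp add: eq power_mult_distrib)
  finally show ?case
    using z(1) w(1) by (intro exI[of _ z']) (auto simp: z'_def less_Suc_eq)
qed

lemma transfinite_diameter_disk_ge:
  assumes R: "R > 0"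
  shows "R \<le> transfinite_diameter {y. norm y \<le> R}"
proof (rule transfinite_diameter_ge[where B = R])
  show "{y. norm y \<le> R} \<noteq> ({} :: complex set)" using R by (auto intro!: exI[of _ 0])
  show "y \<in> {y. norm y \<le> R} \<Longrightarrow> norm y \<le> R" for y :: complex by simp
next
  fix n :: nat assume n: "n \<ge> 2"
  obtain z :: "nat \<Rightarrow> complex" where z: "\<forall>i<n. norm (z i) = R" "pair_product z {..<n} \<ge> R ^ (n * (n - 1))"
    using disk_configuration[OF R, of n] unfolding pair_product_eq_square by blast
  have "real (n * (n - 1)) = real n * (real n - 1)" using n by (simp add: of_nat_diff)
  then have "real (n * (n - 1)) * (1 / (real n * (real n - 1))) = 1" using n by simp
  then have "R = (R ^ (n * (n - 1))) powr (1 / (real n * (real n - 1)))"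
    using R by (simp only: powr_realpow[symmetric] powr_powr powr_one)
  also have "\<dots> \<le> pair_product z {..<n} powr (1 / (real n * (real n - 1)))"
    using z(2) R n by (intro powr_mono2) auto
  also have "\<dots> \<le> nth_diameter {y. norm y \<le> R} n"
    by (rule nth_diameter_ge[where B = R]) (use z(1) R n in \<open>auto intro!: exI[of _ 0]\<close>)
  finally show "R \<le> nth_diameter {y. norm y \<le> R} n" .
qed


section \<open>Local capacities\<close>

text \<open>Formulated for a multiplicative function so that it serves both for the non-archimedean
  absolute values and for the complex norm.\<close>

lemma ball_scaled_ball:
  fixes f :: "'b::field \<Rightarrow> real"
  assumes f: "\<And>x y. f (x * y) = f x * f y" "\<And>x. f x \<ge> 0" "\<And>x. f x = 0 \<longleftrightarrow> x = 0"
    and "r > 0" "s > 0"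
  shows "\<exists>q>0. \<forall>y. f y \<le> r \<and> f (c * y) \<le> s \<longleftrightarrow> f y \<le> q"
proof (cases "c = 0")
  case True
  have "f 0 = 0" using f(3) by simp
  then show ?thesis using True assms(4,5) by (intro exI[of _ r]) simp
next
  case False
  then have "f c > 0" using f(2)[of c] f(3)[of c] by simp
  then have "f (c * y) \<le> s \<longleftrightarrow> f y \<le> s / f c" for y
    by (simp add: f(1) pos_le_divide_eq mult.commute)
  then show ?thesis
    using assms(4,5) \<open>f c > 0\<close> by (intro exI[of _ "min r (s / f c)"]) auto
qed

text \<open>A \<open>d\<close>-th root of an integral power of \<open>p\<close> has a value of the
  form \<open>real p powr (a / d)\<close>, and these numbers are dense among the positive
  reals.\<close>

lemma dense_values:
  fixes av :: "'b::field \<Rightarrow> real"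
  assumes av: "nonarch_abs_on UNIV av" and ac: "alg_closed_type TYPE('b)"
    and p: "Factorial_Ring.prime p" "av (of_nat p) = 1 / real p" and r: "0 < r" "r < r'"
  shows "\<exists>y. r < av y \<and> av y < r'"
proof -
  have p1: "real p > 1" using prime_gt_1_nat[OF p(1)] by simp
  have "log (real p) r < log (real p) r'" using r p1 by simp
  then obtain q where q: "q \<in> \<rat>" "log (real p) r < q" "q < log (real p) r'"
    using Rats_dense_in_real by blast
  from q(1) obtain a c where ac': "c > 0" "q = of_int a / of_int c" by (rule Rats_cases')
  define d where "d = nat c"
  have d: "d > 0" "q = of_int a / real d" using ac' by (auto simp: d_def)
  \<comment> \<open>\<open>b\<close> is \<open>p\<close> to the power \<open>- a\<close>, since
    \<open>p\<close> itself has value \<open>1 / p\<close>.\<close>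
  define b where "b = (if a \<ge> 0 then inverse (of_nat p) ^ nat a else of_nat p ^ nat (- a) :: 'b)"
  have b: "av b = real p powr of_int a"
  proof (cases "a \<ge> 0")
    case True
    then have "av b = real p ^ nat a"
      by (simp add: b_def av_power[OF av] av_inverse[OF av] p(2))
    also have "\<dots> = real p powr of_int a"
      using p1 True by (simp add: powr_realpow[symmetric])
    finally show ?thesis .
  next
    case False
    then have "av b = (1 / real p) ^ nat (- a)"
      by (simp add: b_def av_power[OF av] p(2))
    also have "\<dots> = real p powr of_int a"
      using p1 False by (simp add: powr_realpow[symmetric] power_one_over powr_minus_divide)
    finally show ?thesis .
  qed
  define f where "f = Polynomial.monom 1 d + [:- b:]"
  have "Polynomial.degree f = d"
    unfolding f_def using d(1) by (subst degree_add_eq_left) (simp_all add: degree_monom_eq)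
  then obtain y where "poly f y = 0"
    using ac d(1) unfolding alg_closed_type_def by blast
  then have "y ^ d = b" by (simp add: f_def poly_monom)
  then have y: "av y ^ d = real p powr of_int a"
    using b av_power[OF av, of y d] by simp
  have "real p powr of_int a = (real p powr q) ^ d"
    using p1 d by (simp add: powr_powr powr_realpow[symmetric])
  then have "av y = real p powr q"
    using y d(1) av_ge_0[OF av, of y] by (metis power_eq_iff_eq_base powr_ge_zero)
  moreover have "r < real p powr q" using q(2) r p1 by (simp add: log_less_iff)
  moreover have "real p powr q < r'" using q(3) r p1 by (simp add: less_log_iff)
  ultimately show ?thesis by (intro exI[of _ y]) simp
qed

text \<open>A disk that contains 0 is also centred at 0, and density of the values separates any two
  radii.\<close>

lemma disk_radius_unique:
  fixes av :: "'b::field \<Rightarrow> real"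
  assumes av: "nonarch_abs_on UNIV av" and ac: "alg_closed_type TYPE('b)"
    and p: "Factorial_Ring.prime p" "av (of_nat p) = 1 / real p" and r: "r > 0"
  shows "(THE s. is_disk av {y. av y \<le> r} s) = r"
proof (rule the_equality)
  show "is_disk av {y. av y \<le> r} r"
    using r by (auto simp: is_disk_def intro!: exI[of _ 0])
  fix s assume "is_disk av {y. av y \<le> r} s"
  then obtain c where s: "s > 0" and c: "{y. av y \<le> r} = {y. av (y - c) \<le> s}"
    by (auto simp: is_disk_def)
  have "0 \<in> {y. av y \<le> r}" using r av_0[OF av] by simp
  then have cs: "av c \<le> s" unfolding c using av_uminus[OF av, of c] by simp
  have "av (y - c) \<le> s \<longleftrightarrow> av y \<le> s" for y
    using av_diff[OF av, of y c] av_add[OF av, of "y - c" c] cs by auto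
  then have eq: "av y \<le> r \<longleftrightarrow> av y \<le> s" for y using c by auto
  show "s = r"
  proof (rule ccontr)
    assume "s \<noteq> r"
    then consider "s < r" | "r < s" by linarith
    then show False
    proof cases
      case 1
      then show ?thesis using dense_values[OF av ac p s] eq by (meson less_imp_le not_le)
    next
      case 2
      then show ?thesis using dense_values[OF av ac p r] eq by (meson less_imp_le not_le)
    qed
  qed
qed

text \<open>With \<open>a\<close> and \<open>b3\<close> equal to 0, each of the three conditions
  bounds the size of a multiple of \<open>y\<close>, so their intersection is a disk about
  0.\<close>

lemma finite_local_capacity_disk:
  fixes F :: "'a::field_char_0 set" and emb :: "'a \<Rightarrow> 'b::field"
  assumes nf: "number_field F" and v: "v \<in> finite_places F" and lc: "local_closure F v emb av"
    and J: "ideal J (ring_on (ring_of_integers F))" "J \<noteq> {0}"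
    and b: "b1 \<in> F" "b1 \<noteq> 0"
  obtains r where "r > 0" "finite_local_set F J t 0 b1 b2 0 v emb av = {y. av y \<le> r}"
    "finite_local_capacity F emb av (finite_local_set F J t 0 b1 b2 0 v emb av) = r ^ local_degree F emb av"
proof -
  note F = number_field_field_graph[OF nf]
  have emb: "emb \<in> Ring.ring_hom (ring_on F) (ring_on UNIV)" and av: "nonarch_abs_on UNIV av"
    and v_emb: "\<And>x. x \<in> F \<Longrightarrow> av (emb x) = v x"
    and ac: "alg_closed_type TYPE('b)"
    using lc alg_closed_type_if_algebraic_closure by (auto simp: local_closure_def)
  note hom = ring_hom_emb[OF F emb]
  note f = av_mult[OF av] av_ge_0[OF av] av_eq_0_iff[OF av]
  obtain p :: nat where p: "Factorial_Ring.prime p" "v (of_nat p) = 1 / of_nat p"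
    using finite_placesD(3)[OF v] by blast
  have p': "av (of_nat p) = 1 / real p"
    using v_emb[OF subfield_of_nat[OF F, of p]] hom(4)[of "int p"] p(2) by simp
  define E where "E = finite_local_set F J t 0 b1 b2 0 v emb av"
  have b1: "av (emb b1) > 0"
    using v_emb[OF b(1)] nonarch_gt_0[OF F finite_placesD(2)[OF v] b] by simp
  define \<rho> where "\<rho> = ideal_abs F v J"
  have \<rho>: "\<rho> > 0" unfolding \<rho>_def by (rule ideal_abs_eq_max(1)[OF nf v J])
  have "\<exists>q>0. \<forall>y. av y \<le> 1 \<and> av (emb b2 * y) \<le> av (emb b1) \<longleftrightarrow> av y \<le> q"
    by (rule ball_scaled_ball) (simp_all add: f b1)
  then obtain r1 where r1: "r1 > 0" "\<forall>y. av y \<le> 1 \<and> av (emb b2 * y) \<le> av (emb b1) \<longleftrightarrow> av y \<le> r1"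
    by blast
  have "\<exists>q>0. \<forall>y. av y \<le> r1 \<and> av ((emb t - emb b2 / emb b1) * y) \<le> \<rho> \<longleftrightarrow> av y \<le> q"
    by (rule ball_scaled_ball) (simp_all add: f r1(1) \<rho>)
  then obtain r where r: "r > 0" "\<forall>y. av y \<le> r1 \<and> av ((emb t - emb b2 / emb b1) * y) \<le> \<rho> \<longleftrightarrow> av y \<le> r"
    by blast
  have "- (emb b2 * y) / emb b1 + emb t * y = (emb t - emb b2 / emb b1) * y" for y
    by (simp add: algebra_simps)
  then have E: "E = {y. av y \<le> r}"
    using r1(2) r(2) by (auto simp: E_def finite_local_set_def hom(3) \<rho>_def)
  have "0 \<in> E" using r(1) av_0[OF av] by (simp add: E)
  then have "finite_local_capacity F emb av E = r ^ local_degree F emb av"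
    unfolding finite_local_capacity_def using disk_radius_unique[OF av ac p(1) p' r(1)] E by auto
  with r(1) E show ?thesis using that by (simp add: E_def)
qed

section \<open>Infinite places as classes of complex embeddings\<close>

lemma embeddings_same_norm:
  fixes F :: "'a::field_char_0 set"
  assumes F: "field_graph (Id_on F)" and g: "g \<in> field_embeddings F" and h: "h \<in> field_embeddings F"
    and eq: "\<And>x. x \<in> F \<Longrightarrow> norm (g x) = norm (h x)"
  shows "g = h \<or> g = restrict (\<lambda>x. cnj (h x)) F"
proof -
  note G = field_embeddings_hom[OF F g] and H = field_embeddings_hom[OF F h]
  \<comment> \<open>The norms of \<open>g x\<close> and \<open>g x + 1\<close> determine the real
    part, hence \<open>g x\<close> up to conjugation.\<close>
  have pt: "g x = h x \<or> g x = cnj (h x)" if x: "x \<in> F" for x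
  proof -
    have "g (x - of_int (- 1)) = g x + 1" "h (x - of_int (- 1)) = h x + 1"
      using G(1)[OF x subfield_of_int[OF F, of "- 1"]] H(1)[OF x subfield_of_int[OF F, of "- 1"]]
        G(5)[of "- 1"] H(5)[of "- 1"] by simp_all
    then have 1: "(norm (g x + 1))\<^sup>2 = (norm (h x + 1))\<^sup>2"
      using eq[OF subfield_diff[OF F x subfield_of_int[OF F, of "- 1"]]] by simp
    have 2: "(norm (g x))\<^sup>2 = (norm (h x))\<^sup>2" using eq[OF x] by simp
    have "Re (g x) = Re (h x)"
      using 1 2 unfolding cmod_power2 by (simp add: power2_sum)
    moreover from this have "(Im (g x))\<^sup>2 = (Im (h x))\<^sup>2"
      using 2 unfolding cmod_power2 by simp
    ultimately show ?thesis by (auto simp: complex_eq_iff power2_eq_iff)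
  qed
  have ext: "g \<in> extensional F" "h \<in> extensional F"
    using g h by (auto simp: field_embeddings_def)
  show ?thesis
  proof (rule ccontr)
    assume no: "\<not> ?thesis"
    have "\<exists>x\<in>F. g x \<noteq> h x" using no ext extensionalityI by metis
    then obtain x where x: "x \<in> F" "g x \<noteq> h x" by blast
    have "\<exists>y\<in>F. g y \<noteq> cnj (h y)"
    proof (rule ccontr)
      assume "\<not> ?thesis"
      then have "g = restrict (\<lambda>x. cnj (h x)) F"
        using ext by (intro extensionalityI[of _ F]) auto
      with no show False by simp
    qed
    then obtain y where y: "y \<in> F" "g y \<noteq> cnj (h y)" by blast
    \<comment> \<open>A group is not the union of two proper subgroups: the difference of elements
      at which different alternatives hold fits neither of them.\<close>
    have "g x = cnj (h x)" "g y = h y" using pt x y by auto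
    moreover have "g (x - y) = h (x - y) \<or> g (x - y) = cnj (h (x - y))"
      by (rule pt[OF subfield_diff[OF F x(1) y(1)]])
    ultimately show False
      using x(2) y(2) unfolding G(1)[OF x(1) y(1)] H(1)[OF x(1) y(1)] by auto
  qed
qed

definition place_of :: "'a set \<Rightarrow> ('a \<Rightarrow> complex) \<Rightarrow> 'a \<Rightarrow> real" where
  "place_of F h = restrict (\<lambda>x. norm (h x)) F"

lemma infinite_places_eq:
  fixes F :: "'a::field_char_0 set"
  assumes F: "field_graph (Id_on F)"
  shows "infinite_places F = place_of F ` field_embeddings F"
proof (intro equalityI subsetI)
  fix v assume "v \<in> infinite_places F"
  then obtain h where h: "h \<in> complex_embeddings F" "v = restrict (\<lambda>x. norm (h x)) F"
    by (auto simp: infinite_places_def induces_place_def)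
  have "v = place_of F (restrict h F)"
    unfolding h(2) place_of_def by (rule restrict_ext) simp
  then show "v \<in> place_of F ` field_embeddings F"
    using restrict_field_embedding[OF h(1) F] by blast
next
  fix v assume "v \<in> place_of F ` field_embeddings F"
  then show "v \<in> infinite_places F"
    using field_embeddings_complex by (auto simp: infinite_places_def induces_place_def place_of_def)
qed

text \<open>The exponent in the local capacity is thereby the number of embeddings that induce the
  place, which matches a norm taken as a product over embeddings.\<close>

lemma card_place_fiber:
  fixes F :: "'a::field_char_0 set"
  assumes F: "field_graph (Id_on F)" and h: "induces_place F v h"
  shows "card {g \<in> field_embeddings F. place_of F g = v} = (if h ` F \<subseteq> \<real> then 1 else 2)"
proof -
  define h0 where "h0 = restrict h F"
  define h1 where "h1 = restrict (\<lambda>x. cnj (h0 x)) F"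
  have hc: "h \<in> complex_embeddings F" and v: "v = restrict (\<lambda>x. norm (h x)) F"
    using h by (auto simp: induces_place_def)
  have h0: "h0 \<in> field_embeddings F"
    unfolding h0_def by (rule restrict_field_embedding[OF hc F])
  have h1: "h1 \<in> field_embeddings F"
    unfolding h1_def by (rule cnj_field_embedding[OF F h0])
  have v0: "place_of F h0 = v" and v1: "place_of F h1 = v"
    unfolding place_of_def v h0_def h1_def by (auto intro!: restrict_ext)
  have fiber: "{g \<in> field_embeddings F. place_of F g = v} = {h0, h1}"
  proof (intro equalityI subsetI)
    fix g assume "g \<in> {g \<in> field_embeddings F. place_of F g = v}"
    then have g: "g \<in> field_embeddings F" "place_of F g = place_of F h0" using v0 by auto
    have "norm (g x) = norm (h0 x)" if "x \<in> F" for x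
      using fun_cong[OF g(2), of x] that by (simp add: place_of_def)
    from embeddings_same_norm[OF F g(1) h0 this] show "g \<in> {h0, h1}"
      by (auto simp: h1_def)
  qed (use h0 h1 v0 v1 in auto)
  have "h0 = h1 \<longleftrightarrow> h ` F \<subseteq> \<real>"
  proof
    assume eq: "h0 = h1"
    have "h x \<in> \<real>" if "x \<in> F" for x
      using fun_cong[OF eq, of x] that by (simp add: h0_def h1_def Reals_cnj_iff)
    then show "h ` F \<subseteq> \<real>" by blast
  next
    assume real: "h ` F \<subseteq> \<real>"
    show "h0 = h1"
      unfolding h0_def h1_def
    proof (rule restrict_ext)
      fix x assume x: "x \<in> F"
      then have "cnj (h x) = h x" using real Reals_cnj_iff by blast
      then show "h x = cnj (restrict h F x)" using x by simp
    qed
  qed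
  then show ?thesis unfolding fiber by auto
qed

text \<open>The capacity is computed with an unspecified embedding \<open>h\<close>, but only the
  norms of \<open>h b1\<close> and \<open>h b2\<close> enter, and these are the same for all
  embeddings that induce \<open>v\<close>.\<close>

lemma infinite_local_capacity_ge:
  fixes F :: "'a::field_char_0 set"
  assumes F: "field_graph (Id_on F)" and v: "v \<in> infinite_places F"
    and b: "b1 \<in> F" "b1 \<noteq> 0" "b2 \<in> F" and B: "Bx > 0" "By > 0"
  obtains R where "R > 0"
    "\<And>g w. g \<in> field_embeddings F \<Longrightarrow> place_of F g = v \<Longrightarrow> norm w \<le> By \<Longrightarrow>
       norm (g b2 * w) \<le> norm (g b1) * Bx \<Longrightarrow> norm w \<le> R"
    "R ^ card {g \<in> field_embeddings F. place_of F g = v} \<le> infinite_local_capacity F Bx By b1 b2 0 v"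
proof -
  define h where "h = (SOME h. induces_place F v h)"
  have "\<exists>h. induces_place F v h"
    using v unfolding infinite_places_def by (rule CollectD)
  then have h: "induces_place F v h"
    unfolding h_def by (rule someI_ex)
  have hc: "h \<in> complex_embeddings F" and v_eq: "v = restrict (\<lambda>x. norm (h x)) F"
    using h by (auto simp: induces_place_def)
  note G = complex_embeddings_field_graph[OF F hc]
  have h0: "h 0 = 0"
    using field_graph_0[OF G] by auto
  have hb1: "h b1 \<noteq> 0"
    using field_graph_zero_iff[OF G, of b1 "h b1"] b by blast
  have "\<exists>q>0. \<forall>y :: complex. norm y \<le> By \<and> norm (h b2 * y) \<le> norm (h b1) * Bx \<longleftrightarrow> norm y \<le> q"
    by (rule ball_scaled_ball) (use hb1 B in \<open>simp_all add: norm_mult\<close>)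
  then obtain R where R: "R > 0"
    "\<forall>y. norm y \<le> By \<and> norm (h b2 * y) \<le> norm (h b1) * Bx \<longleftrightarrow> norm y \<le> R"
    by blast
  have set: "infinite_local_set Bx By b1 b2 0 h = {y. norm y \<le> R}"
    using R(2) by (auto simp: infinite_local_set_def h0)
  have "R ^ (if h ` F \<subseteq> \<real> then 1 else 2) \<le> infinite_local_capacity F Bx By b1 b2 0 v"
    unfolding infinite_local_capacity_def Let_def h_def[symmetric] set
    using transfinite_diameter_disk_ge[OF R(1)] R(1) by (intro power_mono) auto
  then have cap: "R ^ card {g \<in> field_embeddings F. place_of F g = v} \<le> infinite_local_capacity F Bx By b1 b2 0 v"
    unfolding card_place_fiber[OF F h] .
  have bound: "norm w \<le> R"
    if "g \<in> field_embeddings F" "place_of F g = v" "norm w \<le> By" "norm (g b2 * w) \<le> norm (g b1) * Bx" for g w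
  proof -
    have "norm (g x) = norm (h x)" if "x \<in> F" for x
      using fun_cong[OF \<open>place_of F g = v\<close>, of x] that by (simp add: place_of_def v_eq)
    then have "norm (h b2 * w) \<le> norm (h b1) * Bx"
      using that(4) b by (simp add: norm_mult)
    with that(3) R(2) show ?thesis by blast
  qed
  show ?thesis by (rule that[OF R(1) bound cap])
qed

text \<open>The product of the conjugates is, up to sign, a rational algebraic integer of size less
  than 1, hence 0. Conjugates are quantified as images under prolonged partial isomorphisms, because
  these provide embeddings of \<open>F\<close> and of \<open>alg_ints\<close> at the same
  time.\<close>

lemma algebraic_int_eq_0_if_conjugates_small:
  fixes w :: "'a::field_char_0"
  assumes w: "algebraic_int w"
    and small: "\<And>M u. field_graph (M :: ('a \<times> complex) set) \<Longrightarrow> Collect algebraic \<subseteq> Domain M \<Longrightarrow>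
      (w, u) \<in> M \<Longrightarrow> norm u < 1"
  shows "w = 0"
proof -
  define G where "G = {(of_rat q :: 'a, of_rat q :: complex) | q. True}"
  have G: "field_graph G"
    unfolding G_def by (rule field_graph_of_rat)
  have D: "Domain G = \<rat>" by (auto simp: G_def Rats_def)
  obtain p :: "int poly" where p: "p \<noteq> 0" "poly (map_poly of_int p) w = 0"
    using w algebraicE' by blast
  have "map_poly of_int p \<noteq> (0 :: 'a poly)"
    using p(1) by (auto simp: poly_eq_iff coeff_map_poly)
  then obtain m m' where m: "min_graph_poly (Id_on \<rat>) w m m'"
    by (rule min_graph_poly_exists[OF field_graph_of_int_poly[OF field_graph_Rats] _ p(2)])
  have m'[simp]: "m' = m"
    using m by (auto simp: min_graph_poly_def graph_poly_def poly_eq_iff)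
  have mQ: "Polynomial.coeff m i \<in> \<rat>" for i
    using m by (auto simp: min_graph_poly_def graph_poly_def)
  have "poly m 0 / Polynomial.lead_coeff m \<in> Domain G"
    unfolding D poly_0_coeff_0 using mQ by auto
  then obtain u where u: "(poly m 0 / Polynomial.lead_coeff m, u) \<in> G" by blast
  obtain ws where ws: "length ws = Polynomial.degree m" "u = (\<Prod>w\<leftarrow>ws. - w)"
    "\<And>x. x \<in> set ws \<Longrightarrow> \<exists>M. field_graph M \<and> G \<subseteq> M \<and> (w, x) \<in> M \<and> Collect algebraic \<subseteq> Domain M"
    by (rule relative_norm_conjugates[OF G D alg_closed_type_class m[unfolded m'] u]) blast
  have ws_small: "norm x < 1" "algebraic_int x" if "x \<in> set ws" for x
    using ws(3)[OF that] small algebraic_int_field_graph w by blast+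
  have alg: "algebraic_int (\<Prod>w\<leftarrow>xs. - w)" if "set xs \<subseteq> set ws" for xs
    using that ws_small(2) by (induction xs) (auto intro!: algebraic_int_mult algebraic_int_minus)
  have norm: "norm (\<Prod>w\<leftarrow>xs. - w) \<le> 1" if "set xs \<subseteq> set ws" for xs
    using that less_imp_le[OF ws_small(1)] by (induction xs) (auto simp: norm_mult intro!: mult_le_one)
  obtain x xs where cons: "ws = x # xs"
    using ws(1) min_graph_poly_degree_pos[OF m] by (cases ws) auto
  have "norm u < 1"
  proof -
    have "norm u = norm x * norm (\<Prod>w\<leftarrow>xs. - w)"
      by (simp add: ws(2) cons norm_mult)
    also have "\<dots> \<le> norm x * 1"
      using norm[of xs] cons by (intro mult_left_mono) auto
    also have "\<dots> < 1" using ws_small(1)[of x] cons by simp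
    finally show ?thesis .
  qed
  moreover have "u \<in> \<int>"
    using u alg[of ws] by (intro rational_algebraic_int_is_int) (auto simp: ws(2)[symmetric] G_def)
  ultimately have "u = 0"
    by (auto elim!: Ints_cases)
  then have "0 \<in> set ws"
    unfolding ws(2) by (auto simp: prod_list_zero_iff)
  then obtain M where "field_graph (M :: ('a \<times> complex) set)" "(w, 0) \<in> M"
    using ws(3) by blast
  then show ?thesis using field_graph_zeroD' by blast
qed


section \<open>Solutions\<close>

lemma cring_alg_ints: "cring (ring_on (alg_ints :: 'a::field_char_0 set))"
  by (rule cring_ring_on) (auto simp: alg_ints_def intro: algebraic_int_diff algebraic_int_mult)

lemma genideal_alg_ints:
  fixes J :: "'a::field_char_0 set"
  assumes "J \<subseteq> alg_ints"
  shows "ideal (Idl\<^bsub>ring_on alg_ints\<^esub> J) (ring_on alg_ints)"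
proof -
  interpret cring "ring_on (alg_ints :: 'a set)" by (rule cring_alg_ints)
  show ?thesis using assms by (intro genideal_ideal) simp
qed

lemma alg_ints_embedding:
  fixes h :: "'a::field_char_0 \<Rightarrow> complex"
  assumes h: "h \<in> complex_embeddings alg_ints"
  shows "x \<in> alg_ints \<Longrightarrow> y \<in> alg_ints \<Longrightarrow> h (x * y) = h x * h y"
    "x \<in> alg_ints \<Longrightarrow> y \<in> alg_ints \<Longrightarrow> h (x - y) = h x - h y"
    "h 1 = 1" "h (- 1) = - 1" "x \<in> alg_ints \<Longrightarrow> h (x ^ n) = h x ^ n"
proof -
  have h': "h \<in> Ring.ring_hom (ring_on alg_ints) (ring_on UNIV)"
    using h by (simp add: complex_embeddings_def)
  note hom = ring_hom_ring_onD[OF h']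
  have ai: "algebraic_int x \<Longrightarrow> x \<in> alg_ints" for x :: 'a by (simp add: alg_ints_def)
  show mult: "x \<in> alg_ints \<Longrightarrow> y \<in> alg_ints \<Longrightarrow> h (x * y) = h x * h y" for x y by (rule hom(2))
  show diff: "h (x - y) = h x - h y" if "x \<in> alg_ints" "y \<in> alg_ints" for x y
    using hom(1)[of "x - y" y] that by (simp add: alg_ints_def algebraic_int_diff)
  show "h 1 = 1" by (rule hom(3))
  have "h 0 = 0" using diff[of 0 0] ai by simp
  then show "h (- 1) = - 1" using diff[of 0 1] ai hom(3) by simp
  show "h (x ^ n) = h x ^ n" if "x \<in> alg_ints"
    using that by (induction n) (auto simp: mult hom(3) alg_ints_def algebraic_int_power)
qed

text \<open>\<open>z k\<close> has exact order \<open>2 ^ (k + 1)\<close>, which makes the sequence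
  injective.\<close>

lemma roots_of_unity_sequence:
  obtains z :: "nat \<Rightarrow> 'a::{alg_closed_field, field_char_0}" where
    "\<And>k. z k ^ 2 ^ k = - 1" "\<And>k. algebraic_int (z k)" "inj z"
proof -
  have "\<exists>z :: nat \<Rightarrow> 'a. \<forall>k. z k ^ 2 ^ k = - 1 \<and> algebraic_int (z k)"
  proof -
    have "\<exists>z :: 'a. z ^ 2 ^ k = - 1" for k
    proof -
      define f where "f = Polynomial.monom 1 (2 ^ k) + [:1 :: 'a:]"
      have "Polynomial.degree f = 2 ^ k"
        unfolding f_def by (subst degree_add_eq_left) (simp_all add: degree_monom_eq)
      then obtain z where "poly f z = 0"
        using alg_closed_imp_poly_has_root[of f] by auto
      then show ?thesis
        by (intro exI[of _ z]) (simp add: f_def poly_monom eq_neg_iff_add_eq_0)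
    qed
    then obtain z :: "nat \<Rightarrow> 'a" where z: "\<And>k. z k ^ 2 ^ k = - 1" by metis
    have "algebraic_int (z k)" for k
    proof (rule algebraic_int_root[of "- 1" "Polynomial.monom 1 (2 ^ k)"])
      show "poly (Polynomial.monom 1 (2 ^ k)) (z k) = - 1" by (simp add: poly_monom z)
    qed (auto simp: degree_monom_eq)
    with z show ?thesis by blast
  qed
  then obtain z :: "nat \<Rightarrow> 'a" where z: "\<And>k. z k ^ 2 ^ k = - 1" "\<And>k. algebraic_int (z k)" by blast
  have "z i \<noteq> z j" if "i < j" for i j
  proof
    assume eq: "z i = z j"
    from less_imp_Suc_add[OF that] obtain d where d: "j = i + Suc d" by auto
    have "(2::nat) ^ j = 2 ^ i * (2 * 2 ^ d)" by (simp add: d power_add)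
    then have "z j ^ 2 ^ j = ((z j ^ 2 ^ i)\<^sup>2) ^ 2 ^ d"
      by (simp only: power_mult)
    also have "\<dots> = 1" using z(1)[of i] eq by simp
    finally show False using z(1)[of j] by simp
  qed
  then have "inj z" by (metis injI nat_neq_iff)
  with z show ?thesis by (rule that)
qed

lemma solutions_iff:
  "(x, y) \<in> solutions t a J Bx By \<longleftrightarrow> x \<in> alg_ints \<and> y \<in> alg_ints \<and>
     x + t * y + a \<in> Idl\<^bsub>ring_on alg_ints\<^esub> J \<and>
     (\<forall>h \<in> complex_embeddings alg_ints. norm (h x) \<le> Bx \<and> norm (h y) \<le> By)"
  by (simp add: solutions_def)

text \<open>Every embedding sends \<open>z\<close> to a number whose \<open>n\<close>-th power is
  \<open>- 1\<close>, hence of norm 1. The condition \<open>z ^ n = - 1\<close> covers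
  \<open>z = - 1\<close> with \<open>n = 1\<close> as well.\<close>

lemma solutions_scale:
  fixes J :: "'a::field_char_0 set"
  assumes J: "J \<subseteq> alg_ints" and xy: "(x, y) \<in> solutions t 0 J Bx By"
    and z: "algebraic_int z" "z ^ n = - 1" "n > 0"
  shows "(z * x, z * y) \<in> solutions t 0 J Bx By"
proof -
  have x: "x \<in> alg_ints" and y: "y \<in> alg_ints"
    and I: "x + t * y + 0 \<in> Idl\<^bsub>ring_on alg_ints\<^esub> J"
    and b: "\<forall>h\<in>complex_embeddings alg_ints. norm (h x) \<le> Bx \<and> norm (h y) \<le> By"
    using xy unfolding solutions_iff by blast+
  have zA: "z \<in> alg_ints" using z(1) by (simp add: alg_ints_def)
  have "z * (x + t * y + 0) \<in> Idl\<^bsub>ring_on alg_ints\<^esub> J"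
    by (rule ideal_ring_onD(4)[OF genideal_alg_ints[OF J] I zA])
  then have "z * x + t * (z * y) + 0 \<in> Idl\<^bsub>ring_on alg_ints\<^esub> J"
    by (simp add: algebra_simps)
  moreover have "norm (h (z * x)) \<le> Bx \<and> norm (h (z * y)) \<le> By" if h: "h \<in> complex_embeddings alg_ints" for h
  proof -
    have "norm (h z) ^ n = norm (h (z ^ n))"
      by (simp add: alg_ints_embedding(5)[OF h zA] norm_power)
    also have "\<dots> = 1" by (simp add: z(2) alg_ints_embedding(4)[OF h])
    finally have "norm (h z) = 1"
      using power_eq_iff_eq_base[OF z(3), of "norm (h z)" 1] by simp
    then show ?thesis
      using b h alg_ints_embedding(1)[OF h zA x] alg_ints_embedding(1)[OF h zA y] by (simp add: norm_mult)
  qed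
  moreover have "z * x \<in> alg_ints" "z * y \<in> alg_ints"
    using x y z(1) by (simp_all add: alg_ints_def algebraic_int_mult)
  ultimately show ?thesis
    unfolding solutions_iff by blast
qed

lemma num_nontrivial_zero_or_infinite:
  fixes J :: "'a::{alg_closed_field, field_char_0} set"
  assumes J: "J \<subseteq> alg_ints"
  shows "num_nontrivial_homogeneous_solutions t J Bx By \<in> {0, \<infinity>}"
proof (cases "solutions t 0 J Bx By - {(0, 0)} = {}")
  case True
  show ?thesis
    unfolding num_nontrivial_homogeneous_solutions_def True ecardinality_def by (simp add: zero_enat_def)
next
  case False
  then obtain x y where xy: "(x, y) \<in> solutions t 0 J Bx By" "(x, y) \<noteq> (0, 0)" by auto
  obtain z :: "nat \<Rightarrow> 'a" where z: "\<And>k. z k ^ 2 ^ k = - 1" "\<And>k. algebraic_int (z k)" "inj z"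
    using roots_of_unity_sequence by blast
  have z0: "z k \<noteq> 0" for k using z(1)[of k] by (auto simp: power_0_left)
  have "range (\<lambda>k. (z k * x, z k * y)) \<subseteq> solutions t 0 J Bx By - {(0, 0)}"
    using solutions_scale[OF J xy(1) z(2) z(1)] xy(2) z0 by auto
  moreover have "inj (\<lambda>k. (z k * x, z k * y))"
    using z(3) xy(2) by (auto simp: inj_def)
  ultimately have "infinite (solutions t 0 J Bx By - {(0, 0)})"
    using range_inj_infinite finite_subset by blast
  then show ?thesis
    by (simp add: num_nontrivial_homogeneous_solutions_def ecardinality_def)
qed

lemma num_solutions_le:
  fixes J :: "'a::{alg_closed_field, field_char_0} set"
  assumes J: "J \<subseteq> alg_ints"
  shows "num_solutions t a J (Bx / 2) (By / 2) \<le> 1 + num_nontrivial_homogeneous_solutions t J Bx By"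
proof (cases "solutions t a J (Bx / 2) (By / 2) = {}")
  case True
  show ?thesis unfolding num_solutions_def True by (simp add: ecardinality_def zero_enat_def[symmetric])
next
  case False
  then obtain x0 y0 where 0: "(x0, y0) \<in> solutions t a J (Bx / 2) (By / 2)" by auto
  \<comment> \<open>The base solution is set aside, since its difference with itself is the trivial
    pair; it accounts for the summand 1.\<close>
  define T where "T = solutions t a J (Bx / 2) (By / 2) - {(x0, y0)}"
  define U where "U = solutions t 0 J Bx By - {(0, 0)}"
  define f where "f = (\<lambda>(x, y). (x - x0, y - y0))"
  have "f ` T \<subseteq> U"
  proof (rule image_subsetI)
    fix s assume s: "s \<in> T"
    obtain x y where xy: "s = (x, y)" by (cases s)
    have 1: "x \<in> alg_ints" "y \<in> alg_ints" "x + t * y + a \<in> Idl\<^bsub>ring_on alg_ints\<^esub> J"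
      "\<forall>h\<in>complex_embeddings alg_ints. norm (h x) \<le> Bx / 2 \<and> norm (h y) \<le> By / 2"
      "(x, y) \<noteq> (x0, y0)"
      using s unfolding T_def xy Diff_iff solutions_iff by blast+
    have 2: "x0 \<in> alg_ints" "y0 \<in> alg_ints" "x0 + t * y0 + a \<in> Idl\<^bsub>ring_on alg_ints\<^esub> J"
      "\<forall>h\<in>complex_embeddings alg_ints. norm (h x0) \<le> Bx / 2 \<and> norm (h y0) \<le> By / 2"
      using 0 unfolding solutions_iff by blast+
    note I = genideal_alg_ints[OF J]
    have "- 1 \<in> (alg_ints :: 'a set)" by (simp add: alg_ints_def)
    from ideal_ring_onD(3)[OF I 1(3) ideal_ring_onD(4)[OF I 2(3) this]]
    have "x - x0 + t * (y - y0) + 0 \<in> Idl\<^bsub>ring_on alg_ints\<^esub> J"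
      by (simp add: algebra_simps)
    moreover have "norm (h (x - x0)) \<le> Bx \<and> norm (h (y - y0)) \<le> By" if h: "h \<in> complex_embeddings alg_ints" for h
      using bspec[OF 1(4) h] bspec[OF 2(4) h] norm_triangle_ineq4[of "h x" "h x0"] norm_triangle_ineq4[of "h y" "h y0"]
      unfolding alg_ints_embedding(2)[OF h 1(1) 2(1)] alg_ints_embedding(2)[OF h 1(2) 2(2)] by linarith
    moreover have "x - x0 \<in> alg_ints" "y - y0 \<in> alg_ints"
      using 1(1,2) 2(1,2) by (simp_all add: alg_ints_def algebraic_int_diff)
    ultimately have "(x - x0, y - y0) \<in> solutions t 0 J Bx By"
      unfolding solutions_iff by blast
    then show "f s \<in> U"
      using 1(5) by (simp add: U_def f_def xy)
  qed
  moreover have "inj_on f T" by (auto simp: f_def inj_on_def)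
  ultimately have card: "finite T \<and> card T \<le> card U" if "finite U"
    using that inj_on_finite card_inj_on_le by metis
  have ins: "solutions t a J (Bx / 2) (By / 2) = insert (x0, y0) T" "(x0, y0) \<notin> T"
    using 0 by (auto simp: T_def)
  show ?thesis
  proof (cases "finite U")
    case True
    then have "finite T" "card T \<le> card U" using card by auto
    then have "ecardinality (insert (x0, y0) T) \<le> enat (1 + card U)"
      using ins(2) by (simp add: ecardinality_def)
    then show ?thesis
      unfolding num_solutions_def num_nontrivial_homogeneous_solutions_def ins(1) U_def[symmetric]
      using True by (simp add: ecardinality_def one_enat_def)
  next
    case False
    then show ?thesis
      by (simp add: num_nontrivial_homogeneous_solutions_def ecardinality_def U_def)
  qed
qed

text \<open>Transports a local absolute value to the algebraic numbers in \<open>'a\<close>, where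
  the integrality of a solution and its membership in the ideal generated by \<open>J\<close> are
  known.\<close>

lemma nonarch_pullback:
  fixes M :: "('a::field \<times> 'b::field) set"
  assumes M: "field_graph M" and av: "nonarch_abs_on UNIV av"
  shows "field_graph (Id_on (Domain M))" "nonarch_abs_on (Domain M) (\<lambda>z. av (the_image M z))"
proof -
  show "field_graph (Id_on (Domain M))"
    unfolding field_graph_def
  proof (intro conjI allI impI)
    show "(1, 1) \<in> Id_on (Domain M)" using field_graph_1[OF M] by blast
  next
    fix x u y w assume "(x, u) \<in> Id_on (Domain M)" "(y, w) \<in> Id_on (Domain M)"
    then obtain a b where "x = u" "y = w" "(x, a) \<in> M" "(y, b) \<in> M" by auto
    with field_graph_diff[OF M this(3,4)] field_graph_mult[OF M this(3,4)]
    show "(x - y, u - w) \<in> Id_on (Domain M)" "(x * y, u * w) \<in> Id_on (Domain M)" by auto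
  next
    fix x u assume "(x, u) \<in> Id_on (Domain M)"
    then obtain a where "x = u" "(x, a) \<in> M" by auto
    with field_graph_inverse[OF M this(2)] show "(inverse x, inverse u) \<in> Id_on (Domain M)" by auto
  qed auto
  have im: "(z, the_image M z) \<in> M" if "z \<in> Domain M" for z using the_image_in[OF M that] .
  show "nonarch_abs_on (Domain M) (\<lambda>z. av (the_image M z))"
    unfolding nonarch_abs_on_def
  proof (intro conjI ballI)
    fix x assume x: "x \<in> Domain M"
    show "0 \<le> av (the_image M x)" by (rule av_ge_0[OF av])
    show "av (the_image M x) = 0 \<longleftrightarrow> x = 0"
      using av_eq_0_iff[OF av] field_graph_zero_iff[OF M im[OF x]] by blast
    fix y assume y: "y \<in> Domain M"
    show "av (the_image M (x * y)) = av (the_image M x) * av (the_image M y)"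
      unfolding the_image_eq[OF M field_graph_mult[OF M im[OF x] im[OF y]]] by (rule av_mult[OF av])
    show "av (the_image M (x + y)) \<le> max (av (the_image M x)) (av (the_image M y))"
      unfolding the_image_eq[OF M field_graph_add[OF M im[OF x] im[OF y]]] by (rule av_add[OF av])
  qed
qed

text \<open>Serves for the complex norm and for the local absolute values alike; the signs come from
  the constant coefficient of a product of linear factors.\<close>

lemma prod_list_norm_le:
  fixes f :: "'b::comm_ring_1 \<Rightarrow> real"
  assumes f: "\<And>x y. f (x * y) = f x * f y" "\<And>x. f (- x) = f x" "f 1 = 1" "\<And>x. f x \<ge> 0"
    and "\<And>w. w \<in> set ws \<Longrightarrow> f w \<le> r" "r \<ge> 0"
  shows "f (\<Prod>w\<leftarrow>ws. - w) \<le> r ^ length ws"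
  using assms(5) by (induction ws) (auto simp: f assms(6) intro!: mult_mono)

lemma the_image_alg_ints:
  fixes M :: "('a::field_char_0 \<times> complex) set"
  assumes M: "field_graph M" "Collect algebraic \<subseteq> Domain M"
  shows "the_image M \<in> complex_embeddings alg_ints"
proof (rule field_graph_complex_embedding[OF M(1)])
  show D: "(alg_ints :: 'a set) \<subseteq> Domain M"
    using M(2) by (auto simp: alg_ints_def)
  fix x :: 'a assume "x \<in> alg_ints"
  with D show "(x, the_image M x) \<in> M" by (intro the_image_in[OF M(1)]) blast
qed (auto simp: alg_ints_def algebraic_int_add algebraic_int_mult)

text \<open>Applied to a solution and to its negative, the next lemma shows that \<open>b\<^sub>3\<close> vanishes.\<close>

lemma solution_annihilates_linear_form:
  fixes F J :: "'a::field_char_0 set"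
  assumes nf: "number_field F" and JO: "J \<subseteq> ring_of_integers F" and B: "Bx > 0" "By > 0"
    and b1: "b1 \<in> inverse_ideal F J" and b2: "b2 \<in> F" "b2 - b1 * t \<in> ring_of_integers F"
    and b3: "b3 \<in> ring_of_integers F"
    and small: "\<forall>h\<in>complex_embeddings F.
       norm (h b1) < 1 / (3 * Bx) \<and> norm (h b2) < 1 / (3 * By) \<and> norm (h b3) < 1 / 3"
    and xy: "(x, y) \<in> solutions t 0 J Bx By"
  shows "b1 * x + b2 * y + b3 = 0"
proof (rule algebraic_int_eq_0_if_conjugates_small)
  note F = number_field_field_graph[OF nf]
  have x: "x \<in> alg_ints" and y: "y \<in> alg_ints"
    and I: "x + t * y + 0 \<in> Idl\<^bsub>ring_on alg_ints\<^esub> J"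
    and b: "\<forall>h\<in>complex_embeddings alg_ints. norm (h x) \<le> Bx \<and> norm (h y) \<le> By"
    using xy unfolding solutions_iff by blast+
  have b1F: "b1 \<in> F" and b1J: "\<And>j. j \<in> J \<Longrightarrow> b1 * j \<in> ring_of_integers F"
    using b1 by (auto simp: inverse_ideal_def mult.commute)
  have b3F: "b3 \<in> F" using ring_of_integers_D(1)[OF b3] .
  \<comment> \<open>The algebraic integers that \<open>b1\<close> multiplies into
    \<open>alg_ints\<close> form an ideal containing \<open>J\<close>, hence containing the ideal
    generated by \<open>J\<close>, to which \<open>x + t * y\<close> belongs.\<close>
  have "ideal {z \<in> alg_ints. b1 * z \<in> alg_ints} (ring_on alg_ints)"
  proof (rule ideal_ring_onI[OF cring_alg_ints])
    fix r z :: 'a assume "r \<in> alg_ints" "z \<in> {z \<in> alg_ints. b1 * z \<in> alg_ints}"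
    then have "algebraic_int (r * z)" "algebraic_int (r * (b1 * z))"
      by (auto simp: alg_ints_def intro: algebraic_int_mult)
    then show "r * z \<in> {z \<in> alg_ints. b1 * z \<in> alg_ints}"
      by (simp add: alg_ints_def mult.left_commute)
  qed (auto simp: alg_ints_def right_diff_distrib intro: algebraic_int_diff)
  moreover have "J \<subseteq> {z \<in> alg_ints. b1 * z \<in> alg_ints}"
    using JO b1J by (auto simp: ring_of_integers_def)
  ultimately have "Idl\<^bsub>ring_on alg_ints\<^esub> J \<subseteq> {z \<in> alg_ints. b1 * z \<in> alg_ints}"
    by (rule genideal_ring_on_minimal)
  then have "algebraic_int (b1 * (x + t * y + 0))"
    using I by (auto simp: alg_ints_def)
  moreover have "algebraic_int ((b2 - b1 * t) * y)"
    using b2(2) y by (intro algebraic_int_mult) (auto simp: ring_of_integers_def alg_ints_def)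
  \<comment> \<open>This is where the congruence enters: \<open>b1 * x + b2 * y\<close> equals
    \<open>b1 * (x + t * y) + (b2 - b1 * t) * y\<close>.\<close>
  ultimately have "algebraic_int (b1 * (x + t * y + 0) + (b2 - b1 * t) * y + b3)"
    using ring_of_integers_D(2)[OF b3] by (intro algebraic_int_add)
  then show "algebraic_int (b1 * x + b2 * y + b3)"
    by (simp add: algebra_simps)
  fix M :: "('a \<times> complex) set" and u
  assume M: "field_graph M" "Collect algebraic \<subseteq> Domain M" "(b1 * x + b2 * y + b3, u) \<in> M"
  define h where "h = the_image M"
  have im: "(z, h z) \<in> M" if "algebraic z" for z
    unfolding h_def using M(2) that by (intro the_image_in[OF M(1)]) blast
  have imF: "(z, h z) \<in> M" if "z \<in> F" for z
    using im number_field_algebraic[OF nf that] .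
  have hA: "h \<in> complex_embeddings alg_ints"
    unfolding h_def by (rule the_image_alg_ints[OF M(1,2)])
  have "F \<subseteq> Domain M" using imF by blast
  then have hF: "h \<in> complex_embeddings F"
    by (rule field_graph_complex_embedding[OF M(1) _ subfield_1[OF F] _ imF])
       (simp add: subfield_add[OF F] subfield_mult[OF F])
  have "(x, h x) \<in> M" "(y, h y) \<in> M"
    using x y by (auto simp: alg_ints_def intro!: im)
  then have "(b1 * x + b2 * y + b3, h b1 * h x + h b2 * h y + h b3) \<in> M"
    using imF b1F b2(1) b3F by (intro field_graph_add[OF M(1)] field_graph_mult[OF M(1)])
  then have u: "u = h b1 * h x + h b2 * h y + h b3"
    using field_graph_right_unique[OF M(1) M(3)] by simp
  have hb: "norm (h b1) < 1 / (3 * Bx)" "norm (h b2) < 1 / (3 * By)" "norm (h b3) < 1 / 3"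
    using bspec[OF small hF] by auto
  have hxy: "norm (h x) \<le> Bx" "norm (h y) \<le> By" using bspec[OF b hA] by auto
  \<comment> \<open>Each of the two products is at most \<open>1 / 3\<close>, and the remaining
    summand is strictly less than \<open>1 / 3\<close>.\<close>
  have "norm (h b1) * norm (h x) \<le> 1 / (3 * Bx) * Bx"
    using hb(1) hxy(1) B by (intro mult_mono) auto
  moreover have "norm (h b2) * norm (h y) \<le> 1 / (3 * By) * By"
    using hb(2) hxy(2) B by (intro mult_mono) auto
  moreover have "norm u \<le> norm (h b1) * norm (h x) + norm (h b2) * norm (h y) + norm (h b3)"
    unfolding u by (metis (no_types, opaque_lifting) add_right_mono norm_mult norm_triangle_ineq order_trans)
  ultimately show "norm u < 1" using hb(3) B by simp
qed

text \<open>For \<open>y\<close> different from 0, the constant coefficient \<open>N\<close> of its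
  monic minimal polynomial over \<open>F\<close> is a nonzero integer. The facts
  \<open>infinite\<close> and \<open>finite\<close> bound \<open>N\<close> at each place by the
  \<open>d\<close>-th power of the local radius, so the product formula would give that the
  \<open>d\<close>-th power of the capacity is at least 1.\<close>

lemma solution_zero_if_capacity_less_1:
  fixes F J :: "'a::{alg_closed_field, field_char_0} set"
    and emb :: "('a \<Rightarrow> real) \<Rightarrow> 'a \<Rightarrow> 'b::field" and av :: "('a \<Rightarrow> real) \<Rightarrow> 'b \<Rightarrow> real"
  assumes nf: "number_field F" and J: "ideal J (ring_on (ring_of_integers F))" "J \<noteq> {0}"
    and t: "t \<in> F" and B: "Bx > 0" "By > 0" and b: "b1 \<in> F" "b1 \<noteq> 0" "b2 \<in> F"
    and lc: "\<forall>v\<in>finite_places F. local_closure F v (emb v) (av v)"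
    and cap: "adelic_capacity F J t 0 Bx By b1 b2 0 emb av < 1"
    and xy: "(x, y) \<in> solutions t 0 J Bx By" "b1 * x + b2 * y = 0"
  shows "y = 0"
proof (rule ccontr)
  assume y0: "y \<noteq> 0"
  note F = number_field_field_graph[OF nf]
  note JO = ideal_ring_onD(1)[OF J(1)]
  have x: "algebraic_int x" and y: "algebraic_int y"
    and I: "x + t * y + 0 \<in> Idl\<^bsub>ring_on alg_ints\<^esub> J"
    and bound: "\<forall>h\<in>complex_embeddings alg_ints. norm (h x) \<le> Bx \<and> norm (h y) \<le> By"
    using xy(1) unfolding solutions_iff alg_ints_def by blast+
  have "b1 * x = - (b2 * y)"
    using xy(2) by (simp add: eq_neg_iff_add_eq_0)
  \<comment> \<open>Since \<open>x\<close> is the product of \<open>y\<close> and an element of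
    \<open>F\<close>, a conjugate of \<open>y\<close> determines the one of \<open>x\<close>, and
    all bounds become conditions on \<open>y\<close> alone.\<close>
  then have x_eq: "x = - (b2 * y) / b1"
    using b(2) by (metis nonzero_mult_div_cancel_left)
  obtain f :: "int poly" where f: "f \<noteq> 0" "poly (map_poly of_int f) y = 0"
    using y algebraicE' by blast
  have "map_poly of_int f \<noteq> (0 :: 'a poly)"
    using f(1) by (auto simp: poly_eq_iff coeff_map_poly)
  then obtain m m' where mm': "min_graph_poly (Id_on F) y m m'"
    by (rule min_graph_poly_exists[OF field_graph_of_int_poly[OF F] _ f(2)])
  have "m' = m"
    using mm' by (auto simp: min_graph_poly_def graph_poly_def poly_eq_iff)
  with mm' have m: "min_graph_poly (Id_on F) y m m" by simp
  define d where "d = Polynomial.degree m"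
  have d: "d > 0" using min_graph_poly_degree_pos[OF m] by (simp add: d_def)
  define N where "N = poly m 0 / Polynomial.lead_coeff m"
  have NF: "N \<in> F"
    using m unfolding N_def poly_0_coeff_0
    by (intro subfield_divide[OF F]) (auto simp: min_graph_poly_def graph_poly_def)
  have N: "N \<in> ring_of_integers F" "N \<noteq> 0"
  proof -
    \<comment> \<open>Conjugates within \<open>'a\<close> itself, over the identity of
      \<open>F\<close>: they are nonzero algebraic integers, and so is their product.\<close>
    have "(poly m 0 / Polynomial.lead_coeff m, N) \<in> Id_on F"
      unfolding N_def[symmetric] using NF by (rule Id_onI)
    then obtain ws where "length ws = Polynomial.degree m" and ws: "N = (\<Prod>w\<leftarrow>ws. - w)"
      "\<And>w. w \<in> set ws \<Longrightarrow> \<exists>M. field_graph M \<and> Id_on F \<subseteq> M \<and> (y, w) \<in> M \<and> Collect algebraic \<subseteq> Domain M"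
      by (rule relative_norm_conjugates[OF F Domain_Id_on alg_closed_type_class m]) blast
    have w: "algebraic_int w" "w \<noteq> 0" if "w \<in> set ws" for w
      using ws(2)[OF that] algebraic_int_field_graph y field_graph_zeroD' y0 by blast+
    have "algebraic_int (\<Prod>w\<leftarrow>vs. - w) \<and> (\<Prod>w\<leftarrow>vs. - w) \<noteq> 0" if "set vs \<subseteq> set ws" for vs
      using that w by (induction vs) (auto intro!: algebraic_int_mult)
    then show "N \<in> ring_of_integers F" "N \<noteq> 0"
      using NF ws(1) ring_of_integers_I by auto
  qed
  have infinite: "norm (h N) \<le> R ^ d"
    if h: "h \<in> field_embeddings F" and R: "R > 0"
      "\<And>w. norm w \<le> By \<Longrightarrow> norm (h b2 * w) \<le> norm (h b1) * Bx \<Longrightarrow> norm w \<le> R" for h R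
  proof -
    define G where "G = {(z, h z) | z. z \<in> F}"
    have G: "field_graph G" "Domain G = F"
      using complex_embeddings_field_graph[OF F field_embeddings_complex[OF h]] by (auto simp: G_def)
    have "(poly m 0 / Polynomial.lead_coeff m, h N) \<in> G" using NF by (auto simp: G_def N_def)
    then obtain ws where ws: "length ws = d" "h N = (\<Prod>w\<leftarrow>ws. - w)"
      "\<And>w. w \<in> set ws \<Longrightarrow> \<exists>M. field_graph M \<and> G \<subseteq> M \<and> (y, w) \<in> M \<and> Collect algebraic \<subseteq> Domain M"
      unfolding d_def by (rule relative_norm_conjugates[OF G alg_closed_type_class m]) blast
    have "norm w \<le> R" if "w \<in> set ws" for w
    proof -
      from ws(3)[OF that]
      obtain M where M: "field_graph M" "G \<subseteq> M" "(y, w) \<in> M" "Collect algebraic \<subseteq> Domain M"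
        by blast
      note hA = the_image_alg_ints[OF M(1,4)]
      have "(b1, h b1) \<in> M" "(b2, h b2) \<in> M" using b M(2) by (auto simp: G_def)
      then have xM: "(x, - (h b2 * w) / h b1) \<in> M"
        unfolding x_eq
        by (intro field_graph_divide[OF M(1)] field_graph_minus[OF M(1)] field_graph_mult[OF M(1)] M(3))
      have "norm w \<le> By" "norm (- (h b2 * w) / h b1) \<le> Bx"
        using bspec[OF bound hA] the_image_eq[OF M(1) M(3)] the_image_eq[OF M(1) xM] by auto
      moreover have "h b1 \<noteq> 0"
        using field_embeddings_hom(7)[OF F h b(1)] b(2) by simp
      ultimately show ?thesis
        by (intro R(2)) (simp_all add: norm_divide pos_divide_le_eq mult.commute)
    qed
    then show ?thesis
      unfolding ws(2) ws(1)[symmetric]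
      by (intro prod_list_norm_le) (use R(1) in \<open>auto simp: norm_mult\<close>)
  qed
  have finite: "v N \<le> r ^ d"
    if v: "v \<in> finite_places F" and r: "r > 0"
      "finite_local_set F J t 0 b1 b2 0 v (emb v) (av v) = {w. av v w \<le> r}" for v r
  proof -
    have lcv: "local_closure F v (emb v) (av v)" using lc v by blast
    have emb: "emb v \<in> Ring.ring_hom (ring_on F) (ring_on UNIV)" and av: "nonarch_abs_on UNIV (av v)"
      and v_emb: "\<And>z. z \<in> F \<Longrightarrow> av v (emb v z) = v z"
      and ac: "alg_closed_type TYPE('b)"
      using lcv alg_closed_type_if_algebraic_closure by (auto simp: local_closure_def)
    define G where "G = {(z, emb v z) | z. z \<in> F}"
    have G: "field_graph G" "Domain G = F"
      using field_graph_hom[OF F emb] by (auto simp: G_def)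
    have "(poly m 0 / Polynomial.lead_coeff m, emb v N) \<in> G" using NF by (auto simp: G_def N_def)
    then obtain ws where ws: "length ws = d" "emb v N = (\<Prod>w\<leftarrow>ws. - w)"
      "\<And>w. w \<in> set ws \<Longrightarrow> \<exists>M. field_graph M \<and> G \<subseteq> M \<and> (y, w) \<in> M \<and> Collect algebraic \<subseteq> Domain M"
      unfolding d_def by (rule relative_norm_conjugates[OF G ac m]) blast
    have "av v w \<le> r" if "w \<in> set ws" for w
    proof -
      from ws(3)[OF that]
      obtain M where M: "field_graph M" "G \<subseteq> M" "(y, w) \<in> M" "Collect algebraic \<subseteq> Domain M"
        by blast
      define V where "V = (\<lambda>z. av v (the_image M z))"
      note D = nonarch_pullback(1)[OF M(1) av] and V = nonarch_pullback(2)[OF M(1) av, folded V_def]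
      have alg: "z \<in> Domain M" if "algebraic_int z" for z using M(4) that by blast
      have V_le: "V z \<le> 1" if "algebraic_int z" for z
        by (rule algebraic_int_nonarch_le_1[OF D V alg[OF that] that])
      have V_eq: "V z = av v u" if "(z, u) \<in> M" for z u
        using the_image_eq[OF M(1) that] by (simp add: V_def)
      have FM: "(z, emb v z) \<in> M" if "z \<in> F" for z using that M(2) by (auto simp: G_def)
      define \<rho> where "\<rho> = ideal_abs F v J"
      have \<rho>: "\<rho> > 0" "\<And>j. j \<in> J \<Longrightarrow> v j \<le> \<rho>"
        using ideal_abs_eq_max[OF nf v J] by (auto simp: \<rho>_def)
      \<comment> \<open>This ideal contains \<open>J\<close>, hence \<open>x + t * y\<close>; this
        yields the condition on a conjugate \<open>w\<close> that involves
        \<open>ideal_abs\<close>.\<close>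
      have "ideal {z \<in> alg_ints. V z \<le> \<rho>} (ring_on alg_ints)"
      proof (rule ideal_ring_onI[OF cring_alg_ints])
        show "0 \<in> {z \<in> alg_ints. V z \<le> \<rho>}"
          using \<rho>(1) nonarch_0[OF D V] by (simp add: alg_ints_def)
      next
        fix z z' :: 'a assume "z \<in> {z \<in> alg_ints. V z \<le> \<rho>}" "z' \<in> {z \<in> alg_ints. V z \<le> \<rho>}"
        then have z: "algebraic_int z" "algebraic_int z'" "V z \<le> \<rho>" "V z' \<le> \<rho>"
          by (auto simp: alg_ints_def)
        then show "z - z' \<in> {z \<in> alg_ints. V z \<le> \<rho>}"
          using nonarch_diff[OF D V alg[OF z(1)] alg[OF z(2)]] algebraic_int_diff[OF z(1,2)]
          by (simp add: alg_ints_def)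
      next
        fix c z :: 'a assume "c \<in> alg_ints" "z \<in> {z \<in> alg_ints. V z \<le> \<rho>}"
        then have z: "algebraic_int c" "algebraic_int z" "V z \<le> \<rho>"
          by (auto simp: alg_ints_def)
        have "V (c * z) = V c * V z"
          by (rule nonarch_mult[OF D V alg[OF z(1)] alg[OF z(2)]])
        also have "\<dots> \<le> 1 * \<rho>"
          using z V_le[OF z(1)] nonarch_ge_0[OF D V alg[OF z(2)]] by (intro mult_mono) auto
        finally show "c * z \<in> {z \<in> alg_ints. V z \<le> \<rho>}"
          using algebraic_int_mult[OF z(1,2)] by (simp add: alg_ints_def)
      qed blast
      moreover have "J \<subseteq> {z \<in> alg_ints. V z \<le> \<rho>}"
      proof
        fix j assume j: "j \<in> J"
        then have jO: "j \<in> ring_of_integers F" using JO by blast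
        have "V j = v j"
          using V_eq[OF FM] v_emb ring_of_integers_D(1)[OF jO] by simp
        then show "j \<in> {z \<in> alg_ints. V z \<le> \<rho>}"
          using \<rho>(2)[OF j] ring_of_integers_D(2)[OF jO] by (simp add: alg_ints_def)
      qed
      ultimately have "Idl\<^bsub>ring_on alg_ints\<^esub> J \<subseteq> {z \<in> alg_ints. V z \<le> \<rho>}"
        by (rule genideal_ring_on_minimal)
      then have sum_le: "V (x + t * y + 0) \<le> \<rho>" using I by blast
      define x' where "x' = - (emb v b2 * w + emb v 0) / emb v b1"
      have emb0: "emb v 0 = 0" by (rule ring_hom_emb(3)[OF F emb])
      have b1': "emb v b1 \<noteq> 0"
        using field_graph_zero_iff[OF M(1) FM[OF b(1)]] b(2) by simp
      have xM: "(x, x') \<in> M"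
        unfolding x_eq x'_def emb0 add_0_right
        by (intro field_graph_divide[OF M(1)] field_graph_minus[OF M(1)] field_graph_mult[OF M(1)] M(3) FM b)
      have sM: "(x + t * y + 0, x' + emb v t * w + emb v 0) \<in> M"
        by (intro field_graph_add[OF M(1)] field_graph_mult[OF M(1)] xM M(3) FM t subfield_0[OF F])
      have "av v w \<le> 1" using V_le[OF y] V_eq[OF M(3)] by simp
      moreover have "av v (emb v b2 * w + emb v 0) \<le> av v (emb v b1)"
      proof -
        have "av v x' \<le> 1" using V_le[OF x] V_eq[OF xM] by simp
        then show ?thesis
          using av_gt_0[OF av b1'] by (simp add: x'_def emb0 av_divide[OF av] av_uminus[OF av] pos_divide_le_eq)
      qed
      moreover have "av v (x' + emb v t * w + emb v 0) \<le> ideal_abs F v J"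
        using sum_le V_eq[OF sM] by (simp add: \<rho>_def)
      ultimately have "w \<in> finite_local_set F J t 0 b1 b2 0 v (emb v) (av v)"
        by (simp add: finite_local_set_def x'_def)
      then show ?thesis using r(2) by simp
    qed
    then have "av v (\<Prod>w\<leftarrow>ws. - w) \<le> r ^ length ws"
      using r(1) by (intro prod_list_norm_le) (simp_all add: av_mult[OF av] av_uminus[OF av] av_1[OF av] av_ge_0[OF av])
    then show ?thesis
      using v_emb[OF NF] ws(1,2) by simp
  qed
  define H where "H = field_embeddings F"
  have finH: "finite H" unfolding H_def by (rule finite_field_embeddings[OF nf])
  define Q where "Q = (\<Prod>v\<in>infinite_places F. infinite_local_capacity F Bx By b1 b2 0 v)"
  have inf_le: "(\<Prod>h\<in>H. norm (h N)) \<le> Q ^ d" and Q0: "Q \<ge> 0"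
  proof -
    have places: "infinite_places F = place_of F ` H"
      unfolding H_def by (rule infinite_places_eq[OF F])
    have local: "0 \<le> infinite_local_capacity F Bx By b1 b2 0 v \<and>
        (\<Prod>h\<in>{h \<in> H. place_of F h = v}. norm (h N)) \<le> infinite_local_capacity F Bx By b1 b2 0 v ^ d"
      if v: "v \<in> infinite_places F" for v
    proof -
      obtain R where R: "R > 0"
        "\<And>g w. g \<in> field_embeddings F \<Longrightarrow> place_of F g = v \<Longrightarrow> norm w \<le> By \<Longrightarrow>
           norm (g b2 * w) \<le> norm (g b1) * Bx \<Longrightarrow> norm w \<le> R"
        "R ^ card {g \<in> field_embeddings F. place_of F g = v} \<le> infinite_local_capacity F Bx By b1 b2 0 v"
        by (rule infinite_local_capacity_ge[OF F v b B]) blast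
      have "(\<Prod>h\<in>{h \<in> H. place_of F h = v}. norm (h N)) \<le> (\<Prod>h\<in>{h \<in> H. place_of F h = v}. R ^ d)"
        using infinite[OF _ R(1)] R(2) by (intro prod_mono) (auto simp: H_def)
      also have "\<dots> = (R ^ card {h \<in> H. place_of F h = v}) ^ d"
        by (simp add: power_mult[symmetric] mult.commute)
      also have "\<dots> \<le> infinite_local_capacity F Bx By b1 b2 0 v ^ d"
        using R(1,3) by (intro power_mono) (auto simp: H_def)
      finally show ?thesis
        using R(1,3) by (meson less_le_trans less_imp_le zero_less_power)
    qed
    \<comment> \<open>Embeddings are grouped by the place that they induce, since the capacities are
      indexed by places.\<close>
    have "(\<Prod>h\<in>H. norm (h N)) = (\<Prod>v\<in>infinite_places F. \<Prod>h\<in>{h \<in> H. place_of F h = v}. norm (h N))"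
      unfolding places using finH by (intro prod.group[symmetric]) auto
    also have "\<dots> \<le> (\<Prod>v\<in>infinite_places F. infinite_local_capacity F Bx By b1 b2 0 v ^ d)"
      using local by (intro prod_mono) (auto intro!: prod_nonneg)
    finally show "(\<Prod>h\<in>H. norm (h N)) \<le> Q ^ d"
      by (simp add: Q_def prod_power_distrib)
    show "Q \<ge> 0" unfolding Q_def using local by (intro prod_nonneg) auto
  qed
  define c where "c = (\<lambda>v. finite_local_capacity F (emb v) (av v)
                     (finite_local_set F J t 0 b1 b2 0 v (emb v) (av v)))"
  define n where "n = (\<lambda>v. local_degree F (emb v) (av v))"
  define S where "S = {v \<in> finite_places F. c v \<noteq> 1}"
  have cap': "Q * (\<Prod>v\<in>S. c v) < 1"
    using cap by (simp add: adelic_capacity_def Let_def Q_def S_def c_def)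
  have cS: "0 \<le> c v \<and> v N ^ n v \<le> c v ^ d" if v: "v \<in> finite_places F" for v
  proof -
    have lcv: "local_closure F v (emb v) (av v)" using lc v by blast
    obtain r where r: "r > 0" "finite_local_set F J t 0 b1 b2 0 v (emb v) (av v) = {y. av v y \<le> r}"
      "c v = r ^ n v"
      unfolding c_def n_def by (rule finite_local_capacity_disk[OF nf v lcv J b(1,2)])
    have "v N ^ n v \<le> (r ^ d) ^ n v"
      using finite[OF v r(1,2)] nonarch_ge_0[OF F finite_placesD(2)[OF v] NF] by (intro power_mono)
    then show ?thesis
      using r(1,3) by (simp add: power_mult[symmetric] mult.commute)
  qed
  \<comment> \<open>A product over an infinite index set is 1 by convention. Replacing such a set by
    the empty one leaves the capacity unchanged and provides the finite set of places for the
    product formula.\<close>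
  define S' where "S' = (if finite S then S else {})"
  have S': "finite S'" "S' \<subseteq> finite_places F" by (auto simp: S'_def S_def)
  have prod_S: "(\<Prod>v\<in>S'. c v) = (\<Prod>v\<in>S. c v)" by (simp add: S'_def)
  have basis: "\<exists>e \<delta>. local_integer_basis F v (n v) e \<delta>" if "v \<in> S'" for v
  proof -
    have v: "v \<in> finite_places F" using that S'(2) by blast
    show ?thesis
      unfolding local_integer_basis_def n_def
      using local_degree_integers[OF nf finite_placesD(2)[OF v] bspec[OF lc v]] .
  qed
  have "1 \<le> (\<Prod>h\<in>H. norm (h N)) * (\<Prod>v\<in>S'. v N ^ n v)"
    unfolding H_def by (rule product_formula_ge_1[OF nf S' basis N])
  also have "\<dots> \<le> Q ^ d * (\<Prod>v\<in>S'. c v ^ d)"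
  proof (intro mult_mono inf_le prod_mono)
    fix v assume "v \<in> S'"
    then have v: "v \<in> finite_places F" using S'(2) by blast
    show "0 \<le> v N ^ n v \<and> v N ^ n v \<le> c v ^ d"
      using cS[OF v] nonarch_ge_0[OF F finite_placesD(2)[OF v] NF] by simp
  next
    show "0 \<le> (\<Prod>v\<in>S'. v N ^ n v)"
      using S'(2) nonarch_ge_0[OF F finite_placesD(2) NF] by (intro prod_nonneg) auto
  qed (use Q0 in simp)
  also have "\<dots> = (Q * (\<Prod>v\<in>S. c v)) ^ d"
    by (simp add: prod_S[symmetric] power_mult_distrib prod_power_distrib)
  also have "\<dots> < 1"
  proof -
    have "0 \<le> (\<Prod>v\<in>S. c v)" using cS by (intro prod_nonneg) (auto simp: S_def)
    then have "(Q * (\<Prod>v\<in>S. c v)) ^ d < 1 ^ d"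
      using cap' Q0 d by (intro power_strict_mono) auto
    then show ?thesis by simp
  qed
  finally show False by simp
qed

theorem theorem4p1:
  fixes F J :: "'a::{alg_closed_field, field_char_0} set" and t :: 'a and Bx By :: real
  assumes "number_field F"
    and "ideal J (ring_on (ring_of_integers F))" and "J \<noteq> {0}"
    and "t \<in> ring_of_integers F"
    and "{j + t * u | j u. j \<in> J \<and> u \<in> ring_of_integers F} = ring_of_integers F"
    and "Bx > 0" and "By > 0"
  shows
    "num_nontrivial_homogeneous_solutions t J Bx By \<in> {0, \<infinity>} \<and>
     (\<forall>b1 b2 b3. \<forall>emb :: ('a \<Rightarrow> real) \<Rightarrow> 'a \<Rightarrow> 'b::field. \<forall>av :: ('a \<Rightarrow> real) \<Rightarrow> 'b \<Rightarrow> real.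
        By > 1/3 \<longrightarrow>
        linear_bipoly b1 b2 b3 \<in> bipolys_over (inverse_ideal F J) \<longrightarrow>
        b1 \<noteq> 0 \<longrightarrow>
        linear_bipoly b1 b2 b3 - linear_bipoly b1 (b1 * t) 0
          \<in> bipolys_over (ring_of_integers F) \<longrightarrow>
        (\<forall>h \<in> complex_embeddings F.
           norm (h b1) < 1 / (3 * Bx) \<and> norm (h b2) < 1 / (3 * By) \<and> norm (h b3) < 1 / 3) \<longrightarrow>
        (\<forall>v \<in> finite_places F. local_closure F v (emb v) (av v)) \<longrightarrow>
        adelic_capacity F J t 0 Bx By b1 b2 b3 emb av < 1 \<longrightarrow>
        num_nontrivial_homogeneous_solutions t J Bx By = 0) \<and>
     (\<forall>a \<in> ring_of_integers F.
        num_solutions t a J (Bx/2) (By/2) \<le> 1 + num_nontrivial_homogeneous_solutions t J Bx By) \<and>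
     (\<forall>a \<in> ring_of_integers F.
        num_nontrivial_homogeneous_solutions t J Bx By = \<infinity> \<or>
        num_nontrivial_homogeneous_solutions t J Bx By = 0 \<and>
        num_solutions t a J (Bx/2) (By/2) \<le> 1)"
proof (intro conjI allI impI ballI)
  note nf = assms(1) and J = assms(2,3) and B = assms(6,7)
  note F = number_field_field_graph[OF nf]
  have JO: "J \<subseteq> ring_of_integers F" by (rule ideal_ring_onD(1)[OF J(1)])
  then have JA: "J \<subseteq> alg_ints" by (auto simp: ring_of_integers_def)
  show dichotomy: "num_nontrivial_homogeneous_solutions t J Bx By \<in> {0, \<infinity>}"
    by (rule num_nontrivial_zero_or_infinite[OF JA])
  show le: "num_solutions t a J (Bx/2) (By/2) \<le> 1 + num_nontrivial_homogeneous_solutions t J Bx By" for a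
    by (rule num_solutions_le[OF JA])
  show "num_nontrivial_homogeneous_solutions t J Bx By = \<infinity> \<or>
      num_nontrivial_homogeneous_solutions t J Bx By = 0 \<and> num_solutions t a J (Bx/2) (By/2) \<le> 1" for a
  proof (cases "num_nontrivial_homogeneous_solutions t J Bx By = \<infinity>")
    case False
    then have "num_nontrivial_homogeneous_solutions t J Bx By = 0"
      using dichotomy unfolding insert_iff empty_iff by argo
    then show ?thesis using le[of a] by simp
  qed simp
  fix b1 b2 b3 and emb :: "('a \<Rightarrow> real) \<Rightarrow> 'a \<Rightarrow> 'b" and av :: "('a \<Rightarrow> real) \<Rightarrow> 'b \<Rightarrow> real"
  assume g: "linear_bipoly b1 b2 b3 \<in> bipolys_over (inverse_ideal F J)" and b1: "b1 \<noteq> 0"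
    and cong: "linear_bipoly b1 b2 b3 - linear_bipoly b1 (b1 * t) 0 \<in> bipolys_over (ring_of_integers F)"
    and small: "\<forall>h \<in> complex_embeddings F.
           norm (h b1) < 1 / (3 * Bx) \<and> norm (h b2) < 1 / (3 * By) \<and> norm (h b3) < 1 / 3"
    and lc: "\<forall>v \<in> finite_places F. local_closure F v (emb v) (av v)"
    and cap: "adelic_capacity F J t 0 Bx By b1 b2 b3 emb av < 1"
  have inv: "b1 \<in> inverse_ideal F J" "b2 \<in> inverse_ideal F J"
  proof -
    have "Polynomial.coeff (Polynomial.coeff (linear_bipoly b1 b2 b3) i) j \<in> inverse_ideal F J" for i j
      using g by (simp add: bipolys_over_def)
    \<comment> \<open>The outer index belongs to \<open>x\<close>, the inner one to
      \<open>y\<close>.\<close>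
    from this[of 1 0] this[of 0 1] show "b1 \<in> inverse_ideal F J" "b2 \<in> inverse_ideal F J"
      by (simp_all add: linear_bipoly_def)
  qed
  then have bF: "b1 \<in> F" "b2 \<in> F" by (simp_all add: inverse_ideal_def)
  have int: "b2 - b1 * t \<in> ring_of_integers F" "b3 \<in> ring_of_integers F"
  proof -
    have "Polynomial.coeff (Polynomial.coeff (linear_bipoly b1 b2 b3 - linear_bipoly b1 (b1 * t) 0) i) j
        \<in> ring_of_integers F" for i j
      using cong by (simp add: bipolys_over_def)
    from this[of 0 1] this[of 0 0] show "b2 - b1 * t \<in> ring_of_integers F" "b3 \<in> ring_of_integers F"
      by (simp_all add: linear_bipoly_def)
  qed
  note zero = solution_annihilates_linear_form[OF nf JO B inv(1) bF(2) int small]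
  have "solutions t 0 J Bx By \<subseteq> {(0, 0)}"
  proof
    fix s assume s: "s \<in> solutions t 0 J Bx By"
    obtain x y where xy: "s = (x, y)" by (cases s)
    have sol: "(x, y) \<in> solutions t 0 J Bx By" using s xy by simp
    \<comment> \<open>Subtracting the relation at the negated solution from the one at the solution
      itself isolates \<open>2 * b3\<close>.\<close>
    have "(- 1 * x, - 1 * y) \<in> solutions t 0 J Bx By"
      by (rule solutions_scale[OF JA sol, of "- 1" 1]) simp_all
    from zero[OF this] have neg: "b1 * x + b2 * y - b3 = 0" by (simp add: algebra_simps)
    have pos: "b1 * x + b2 * y + b3 = 0" by (rule zero[OF sol])
    have "2 * b3 = (b1 * x + b2 * y + b3) - (b1 * x + b2 * y - b3)" by simp
    then have b3: "b3 = 0" unfolding neg pos by simp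
    have lin: "b1 * x + b2 * y = 0" using pos b3 by simp
    have "y = 0"
      using solution_zero_if_capacity_less_1[OF nf J ring_of_integers_D(1)[OF assms(4)] B bF(1) b1 bF(2) lc
          cap[unfolded b3] sol lin] .
    with lin b1 show "s \<in> {(0, 0)}" by (simp add: xy)
  qed
  then have "solutions t 0 J Bx By - {(0, 0)} = {}" by blast
  then show "num_nontrivial_homogeneous_solutions t J Bx By = 0"
    unfolding num_nontrivial_homogeneous_solutions_def by (simp only:) (simp add: ecardinality_def zero_enat_def)
qed

end
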